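(* Let $(\alpha_n)_{n\ge0}$ be the sequence of predictive distributions on $\mathbb{R}$ obtained from an initial probability distribution $\alpha_0$, a kernel $K$ and bandwidths $(h_n)$, $h_n>0$, by the recursion, for $n\ge1$ and Borel $A\subseteq\mathbb{R}$, $$\alpha_n(A)=\frac{n-1}{n}\alpha_{n-1}(A)+\frac{1}{n h_n}\int_A K\Big(\frac{x-X_n}{h_n}\Big)dx,$$ where $X_{n+1}\mid X_1,\ldots,X_n\sim\alpha_n$ for all $n\ge0$. For $1\leq i\le n$ let $\mu_i(\cdot;X_i)$ be the probability measure with density $x\mapsto\frac1{h_i}K\big(\frac{x-X_i}{h_i}\big)$, and let $\mu_{n+1*i}(\cdot;X_i)$ be the probability measure with density $$(K_{n+1}*K_i)(x;X_i)=\int\frac1{h_{n+1}}K\Big(\frac{x-y}{h_{n+1}}\Big)\frac1{h_i}K\Big(\frac{y-X_i}{h_i}\Big)dy .$$ Suppose there exist $d>0$ and $C>0$ such that, for all $n\ge i\ge1$, $$\mathrm{TV}\big(\mu_{n+1*i}(\cdot;X_i),\mu_i(\cdot;X_i)\big)\le C\,\frac{h_{n+1}^d}{h_i^d}\quad\text{a.s.}$$ Then $(X_n)_{n\ge1}$ is a.c.i.d. with parameter $$\xi_n:=\frac{1}{n+1}\sum_{i=1}^n\frac1n\,C\,\frac{h_{n+1}^d}{h_i^d},\qquad n\ge1$$ (with $\xi_0:=1$). Moreover, a sufficient condition for $(X_n)_{n\ge1}$ to be asymptotically exchangeable is that $(h_n)$ satisfies $$\frac{h_{n+1}^d}{n+1}\sum_{i=1}^n\frac1{h_i^d}=o\big(\log^{-1}n\big)\quad\text{as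 } n\to\infty .$$
   Context: A kernel is a non-negative integrable function $K:\mathbb{R}\to\mathbb{R}$ with $\int_{\mathbb{R}}K(u)\,du=1$. $\mathrm{TV}(\mu,\nu)=\sup_A|\mu(A)-\nu(A)|$ over Borel sets $A$. Let $\mathcal{G}_n=\sigma(X_1,\ldots,X_n)$, $\mathcal{G}_0$ trivial. Definition (a.c.i.d.). Let $(\xi_n)_{n\ge0}$ be a sequence of $\mathcal{G}$-adapted non-negative random variables. The sequence $(X_n)_{n\ge1}$ is a.c.i.d. with parameter $(\xi_n)_{n\ge0}$ (with respect to $\mathcal{G}$) if for every Borel set $A$ and every $n\ge0$, $$\mathbb{E}\big(\mathbb{P}(X_{n+2}\in A\mid\mathcal{G}_{n+1})\mid\mathcal{G}_n\big)\le \mathbb{P}(X_{n+1}\in A\mid\mathcal{G}_n)+\xi_n\quad\text{a.s.};$$ here $\mathbb{P}(X_{n+1}\in A\mid\mathcal{G}_n)=\alpha_n(A)$. $(X_n)_{n\ge1}$ is asymptotically exchangeable if, as $n\to\infty$, $(X_n,X_{n+1},\ldots)$ converges in distribution (product topology) to some exchangeable sequence $(Z_1,Z_2,\ldots)$. *)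

theory Defs
  imports
    "HOL-Probability.Probability"
    "HOL-Combinatorics.Permutations"
    "HOL-Library.Landau_Symbols"
begin
definition is_kernel :: "(real \<Rightarrow> real) \<Rightarrow> bool" where
  "is_kernel K \<longleftrightarrow> (\<forall>u. 0 \<le> K u) \<and> integrable lborel K \<and> (\<integral>u. K u \<partial>lborel) = 1"

definition scaled_kernel :: "(real \<Rightarrow> real) \<Rightarrow> real \<Rightarrow> real \<Rightarrow> real \<Rightarrow> real" where
  "scaled_kernel K h y x = 1 / h * K ((x - y) / h)"

definition kernel_conv :: "(real \<Rightarrow> real) \<Rightarrow> real \<Rightarrow> real \<Rightarrow> real \<Rightarrow> real \<Rightarrow> real" where
  "kernel_conv K h' h c x = (\<integral>y. scaled_kernel K h' y x * scaled_kernel K h c y \<partial>lborel)"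

definition kernel_measure :: "(real \<Rightarrow> real) \<Rightarrow> real \<Rightarrow> real \<Rightarrow> real measure" where
  "kernel_measure K h c = density lborel (\<lambda>x. ennreal (scaled_kernel K h c x))"

definition kernel_conv_measure :: "(real \<Rightarrow> real) \<Rightarrow> real \<Rightarrow> real \<Rightarrow> real \<Rightarrow> real measure" where
  "kernel_conv_measure K h' h c = density lborel (\<lambda>x. ennreal (kernel_conv K h' h c x))"

definition tv_dist :: "real measure \<Rightarrow> real measure \<Rightarrow> real" where
  "tv_dist \<mu> \<nu> = (SUP A\<in>sets borel. \<bar>measure \<mu> A - measure \<nu> A\<bar>)"

text \<open>Sequences of observations are indexed from 1: the value of \<open>X 0\<close> is irrelevant, and
  \<open>obs_filtration M X 0\<close> is the trivial sigma-algebra.\<close>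

definition obs_filtration :: "'a measure \<Rightarrow> (nat \<Rightarrow> 'a \<Rightarrow> real) \<Rightarrow> nat \<Rightarrow> 'a measure" where
  "obs_filtration M X n =
     sigma (space M) {X i -` B \<inter> space M | i B. i \<in> {1..n} \<and> B \<in> sets borel}"

text \<open>\<open>real_cond_exp M F\<close> is a conditional expectation only if \<open>F\<close> is a subalgebra of \<open>M\<close>.\<close>

lemma subalgebra_obs_filtration:
  assumes "\<And>i. 1 \<le> i \<Longrightarrow> X i \<in> borel_measurable M"
  shows "subalgebra M (obs_filtration M X n)"
proof -
  have *: "{X i -` B \<inter> space M | i B. i \<in> {1..n} \<and> B \<in> sets borel} \<subseteq> sets M"
    using assms by (auto intro: measurable_sets)
  have "sigma_sets (space M) {X i -` B \<inter> space M | i B. i \<in> {1..n} \<and> B \<in> sets borel} \<subseteq> sets M"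
    using * by (rule sets.sigma_sets_subset)
  moreover have "{X i -` B \<inter> space M | i B. i \<in> {1..n} \<and> B \<in> sets borel} \<subseteq> Pow (space M)"
    by auto
  ultimately show ?thesis
    unfolding subalgebra_def obs_filtration_def
    by (simp add: space_measure_of sets_measure_of)
qed

definition cond_probability ::
  "'a measure \<Rightarrow> 'a measure \<Rightarrow> ('a \<Rightarrow> real) \<Rightarrow> real set \<Rightarrow> 'a \<Rightarrow> real" where
  "cond_probability M F Y A = real_cond_exp M F (indicat_real (Y -` A \<inter> space M))"

definition acid ::
  "'a measure \<Rightarrow> (nat \<Rightarrow> 'a measure) \<Rightarrow> (nat \<Rightarrow> 'a \<Rightarrow> real) \<Rightarrow> (nat \<Rightarrow> 'a \<Rightarrow> real) \<Rightarrow> bool" where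
  "acid M G X \<xi> \<longleftrightarrow>
     (\<forall>n. \<xi> n \<in> borel_measurable (G n)) \<and>
     (\<forall>n. \<forall>\<omega>\<in>space M. 0 \<le> \<xi> n \<omega>) \<and>
     (\<forall>A\<in>sets borel. \<forall>n. AE \<omega> in M.
        real_cond_exp M (G n) (cond_probability M (G (n + 1)) (X (n + 2)) A) \<omega>
          \<le> cond_probability M (G n) (X (n + 1)) A \<omega> + \<xi> n \<omega>)"

definition conv_in_distribution ::
  "'a measure \<Rightarrow> (nat \<Rightarrow> 'a \<Rightarrow> 'c::topological_space) \<Rightarrow> 'b measure \<Rightarrow> ('b \<Rightarrow> 'c) \<Rightarrow> bool" where
  "conv_in_distribution M Y N Z \<longleftrightarrow>
     (\<forall>f :: 'c \<Rightarrow> real. continuous_on UNIV f \<longrightarrow> bounded (range f) \<longrightarrow>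
        (\<lambda>n. \<integral>\<omega>. f (Y n \<omega>) \<partial>M) \<longlonglongrightarrow> (\<integral>\<omega>. f (Z \<omega>) \<partial>N))"

text \<open>Invariance of the law under permutations of finitely many coordinates.\<close>

definition exchangeable :: "'b measure \<Rightarrow> (nat \<Rightarrow> 'b \<Rightarrow> real) \<Rightarrow> bool" where
  "exchangeable N Z \<longleftrightarrow>
     (\<forall>k. Z k \<in> borel_measurable N) \<and>
     (\<forall>m \<pi>. \<pi> permutes {..<m} \<longrightarrow>
        distr N (\<Pi>\<^sub>M k\<in>UNIV. borel) (\<lambda>\<omega> k. Z (\<pi> k) \<omega>)
          = distr N (\<Pi>\<^sub>M k\<in>UNIV. borel) (\<lambda>\<omega> k. Z k \<omega>))"

text \<open>The type \<open>nat \<Rightarrow> real\<close> carries the product topology.  Coordinate \<open>k\<close> of the \<open>n\<close>-th shifted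
  sequence is \<open>X (n + k)\<close>, and the limit sequence is indexed from 0.  Since only the law of the
  limit matters, taking its sample space to be of type \<open>nat \<Rightarrow> real\<close> is no restriction.\<close>

definition asymptotically_exchangeable :: "'a measure \<Rightarrow> (nat \<Rightarrow> 'a \<Rightarrow> real) \<Rightarrow> bool" where
  "asymptotically_exchangeable M X \<longleftrightarrow>
     (\<exists>(N :: (nat \<Rightarrow> real) measure) (Z :: nat \<Rightarrow> (nat \<Rightarrow> real) \<Rightarrow> real).
        prob_space N \<and> exchangeable N Z \<and>
        conv_in_distribution M (\<lambda>n \<omega> k. X (n + k) \<omega>) N (\<lambda>\<omega> k. Z k \<omega>))"

end

theory Submission
  imports Defs "HOL-Real_Asymp.Real_Asymp"
begin

text \<open>
  For \<open>n \<ge> 1\<close> the recursion gives \<open>\<alpha>\<^sub>n = (\<mu>\<^sub>1 + \<dots> + \<mu>\<^sub>n) / n\<close>, so \<open>\<alpha>\<^sub>n\<close> integrates a bounded function \<open>g\<close> to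
  the average over \<open>i\<close> of the values at \<open>X\<^sub>i\<close> of \<open>g\<close> smoothed at bandwidth \<open>h\<^sub>i\<close>.  The process adds one
  atom at a time, so the conditional expectation of \<open>\<alpha>\<^sub>n\<^sub>+\<^sub>1(g)\<close> given the past is
  \<open>(n \<alpha>\<^sub>n(g) + \<alpha>\<^sub>n(g')) / (n + 1)\<close>, where \<open>g'\<close> is \<open>g\<close> smoothed at bandwidth \<open>h\<^sub>n\<^sub>+\<^sub>1\<close>
  (\<open>cond_exp_pmean_Suc\<close>).  For an indicator \<open>g\<close> of \<open>A\<close>, smoothing twice gives the mass that the
  convolved kernel assigns to \<open>A\<close>, so \<open>\<alpha>\<^sub>n(g') - \<alpha>\<^sub>n(g)\<close> is at most the average of the total variation
  distances in the hypothesis.  Dividing by \<open>n + 1\<close> gives the a.c.i.d. parameter.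

  The condition on the bandwidths gives \<open>\<xi>\<^sub>n = o(1 / (n log n))\<close>, which does not make \<open>\<xi>\<close> summable, so
  the convergence of \<open>\<alpha>\<^sub>n\<close> is not obtained from \<open>\<xi>\<close>.  The condition forces the bandwidths to
  decay, and this makes the drift small on regular functions.  With \<open>S\<^sub>n\<close> the sum of \<open>h\<^sub>i\<close> to the power \<open>-d\<close> over
  \<open>i \<le> n\<close>, it says that \<open>S\<^sub>n\<close> grows by a factor much larger than \<open>1 + 1 / n\<close> in each step, so \<open>S\<^sub>n\<close>
  outgrows powers of \<open>n\<close> and \<open>h\<^sub>n\<close> to the power \<open>d\<close> is \<open>O(1 / n\<^sup>2)\<close> (\<open>bandwidth_decay\<close>).
  The total variation hypothesis for \<open>i = 1\<close>, tested on trigonometric functions, bounds the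
  truncated second moment of the kernel at scale \<open>h\<^sub>n\<^sub>+\<^sub>1\<close> by a multiple of \<open>h\<^sub>n\<^sub>+\<^sub>1\<close> to the power \<open>d\<close>
  (\<open>truncated_second_moment_le_tv_dist\<close>).  Together these show that, for bounded Lipschitz \<open>g\<close>, the
  drift \<open>(\<alpha>\<^sub>n(g') - \<alpha>\<^sub>n(g)) / (n + 1)\<close> is bounded by a deterministic summable sequence.

  Since the increments of \<open>\<alpha>\<^sub>n(g)\<close> are \<open>O(1 / n)\<close>, the martingale part of \<open>\<alpha>\<^sub>n(g)\<close> is Cauchy in
  mean square, and with a summable drift \<open>\<alpha>\<^sub>n(g)\<close> is Cauchy in mean (\<open>pmean_L1_Cauchy\<close>).
  As \<open>\<alpha>\<close> hardly moves during \<open>k\<close> steps, the expectation of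
  \<open>g\<^sub>1(X\<^sub>n\<^sub>+\<^sub>1) \<cdots> g\<^sub>k(X\<^sub>n\<^sub>+\<^sub>k)\<close> differs from that of \<open>\<alpha>\<^sub>n(g\<^sub>1) \<cdots> \<alpha>\<^sub>n(g\<^sub>k)\<close> by \<open>O(k\<^sup>2 / n)\<close>
  (\<open>product_expectation_approx\<close>).  These product moments thus converge, and the limits
  are symmetric in the \<open>g\<^sub>j\<close>.  What remains is soft: the shifted sequences are tight, tight laws on
  the sequence space have convergent subsequences (\<open>tight_sequence_laws_subsequential_limit\<close>), and
  product moments of bounded Lipschitz functions determine a law on the sequence space
  (\<open>sequence_law_eqI\<close>), so there is only one possible limit and it is exchangeable.
\<close>

section \<open>Smoothing by a scaled kernel\<close>

definition kernel_law :: "(real \<Rightarrow> real) \<Rightarrow> real measure" where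
  "kernel_law K = density lborel (\<lambda>u. ennreal (K u))"

definition smooth :: "(real \<Rightarrow> real) \<Rightarrow> real \<Rightarrow> (real \<Rightarrow> real) \<Rightarrow> real \<Rightarrow> real" where
  "smooth K h g c = (\<integral>u. g (c + h * u) \<partial>kernel_law K)"

lemma kernel_measurable: "is_kernel K \<Longrightarrow> K \<in> borel_measurable borel"
  by (auto simp: is_kernel_def dest: borel_measurable_integrable)

lemma sets_kernel_law [measurable_cong, simp]: "sets (kernel_law K) = sets borel"
  by (simp add: kernel_law_def)

lemma space_kernel_law [simp]: "space (kernel_law K) = UNIV"
  by (simp add: kernel_law_def)

lemma prob_space_kernel_law:
  assumes K: "is_kernel K"
  shows "prob_space (kernel_law K)"
proof
  have [measurable]: "K \<in> borel_measurable borel" using K by (rule kernel_measurable)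
  have "emeasure (kernel_law K) (space (kernel_law K)) = (\<integral>\<^sup>+u. ennreal (K u) \<partial>lborel)"
    unfolding kernel_law_def by (subst emeasure_density) auto
  also have "\<dots> = 1"
    using K by (subst nn_integral_eq_integral) (auto simp: is_kernel_def)
  finally show "emeasure (kernel_law K) (space (kernel_law K)) = 1" .
qed

lemma nn_integral_scaled_kernel:
  assumes K: "is_kernel K" and h: "0 < h" and [measurable]: "u \<in> borel_measurable borel"
  shows "(\<integral>\<^sup>+x. ennreal (scaled_kernel K h c x) * u x \<partial>lborel) = (\<integral>\<^sup>+v. u (c + h * v) \<partial>kernel_law K)"
proof -
  have [measurable]: "K \<in> borel_measurable borel" using K by (rule kernel_measurable)
  have "(\<integral>\<^sup>+x. ennreal (scaled_kernel K h c x) * u x \<partial>lborel)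
      = ennreal h * (\<integral>\<^sup>+v. ennreal (scaled_kernel K h c (c + h * v)) * u (c + h * v) \<partial>lborel)"
    unfolding scaled_kernel_def using h
    by (subst nn_integral_real_affine[where c = h and t = c]) auto
  also have "\<dots> = (\<integral>\<^sup>+v. ennreal h * (ennreal (scaled_kernel K h c (c + h * v)) * u (c + h * v)) \<partial>lborel)"
    unfolding scaled_kernel_def by (subst nn_integral_cmult) auto
  also have "\<dots> = (\<integral>\<^sup>+v. ennreal (K v) * u (c + h * v) \<partial>lborel)"
  proof (rule nn_integral_cong)
    fix v
    have "ennreal h * ennreal (scaled_kernel K h c (c + h * v)) = ennreal (K v)"
      using h K by (subst ennreal_mult[symmetric]) (auto simp: scaled_kernel_def is_kernel_def)
    then show "ennreal h * (ennreal (scaled_kernel K h c (c + h * v)) * u (c + h * v)) = ennreal (K v) * u (c + h * v)"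
      by (simp add: mult.assoc[symmetric])
  qed
  also have "\<dots> = (\<integral>\<^sup>+v. u (c + h * v) \<partial>kernel_law K)"
    unfolding kernel_law_def by (subst nn_integral_density) auto
  finally show ?thesis .
qed

text \<open>In terms of the kernel as a law, \<open>\<mu>\<^sub>i\<close> is the law of \<open>c + h u\<close> with noise \<open>u\<close>, which is what
  turns densities into \<open>smooth\<close>.\<close>
lemma kernel_measure_eq_distr:
  assumes K: "is_kernel K" and h: "0 < h"
  shows "kernel_measure K h c = distr (kernel_law K) borel (\<lambda>v. c + h * v)"
proof (rule measure_eqI)
  have [measurable]: "K \<in> borel_measurable borel" using K by (rule kernel_measurable)
  show "sets (kernel_measure K h c) = sets (distr (kernel_law K) borel (\<lambda>v. c + h * v))"
    by (simp add: kernel_measure_def)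
  fix A assume "A \<in> sets (kernel_measure K h c)"
  then have A [measurable]: "A \<in> sets borel" by (simp add: kernel_measure_def)
  have "emeasure (kernel_measure K h c) A = (\<integral>\<^sup>+x. ennreal (scaled_kernel K h c x) * indicator A x \<partial>lborel)"
    unfolding kernel_measure_def scaled_kernel_def by (subst emeasure_density) auto
  also have "\<dots> = (\<integral>\<^sup>+v. indicator A (c + h * v) \<partial>kernel_law K)"
    using K h by (rule nn_integral_scaled_kernel) auto
  also have "\<dots> = (\<integral>\<^sup>+x. indicator A x \<partial>distr (kernel_law K) borel (\<lambda>v. c + h * v))"
    by (subst nn_integral_distr) auto
  finally show "emeasure (kernel_measure K h c) A = emeasure (distr (kernel_law K) borel (\<lambda>v. c + h * v)) A"
    by simp
qed

lemma kernel_conv_measurable: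
  assumes K: "is_kernel K"
  shows "kernel_conv K h' h c \<in> borel_measurable borel"
proof -
  have [measurable]: "K \<in> borel_measurable borel" using K by (rule kernel_measurable)
  show ?thesis
    unfolding kernel_conv_def scaled_kernel_def by measurable
qed

lemma kernel_conv_nonneg: "is_kernel K \<Longrightarrow> 0 < h \<Longrightarrow> 0 < h' \<Longrightarrow> 0 \<le> kernel_conv K h' h c x"
  unfolding kernel_conv_def scaled_kernel_def is_kernel_def by (intro integral_nonneg_AE) auto

text \<open>The convolved kernel adds two independent noises.  The density \<open>kernel_conv\<close> is a
  Bochner integral, which is zero where the integrand is not integrable; its nonnegative counterpart
  has total mass one, so this happens only on a null set.\<close>
lemma kernel_conv_measure_eq_distr:
  assumes K: "is_kernel K" and h: "0 < h" and h': "0 < h'"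
  shows "kernel_conv_measure K h' h c
           = distr (kernel_law K \<Otimes>\<^sub>M kernel_law K) borel (\<lambda>(u, v). c + h * u + h' * v)"
proof (rule measure_eqI)
  have [measurable]: "K \<in> borel_measurable borel" using K by (rule kernel_measurable)
  have Kn: "0 \<le> K u" for u using K by (simp add: is_kernel_def)
  interpret L: prob_space "kernel_law K" using K by (rule prob_space_kernel_law)
  let ?k = "\<lambda>x y. ennreal (scaled_kernel K h' y x) * ennreal (scaled_kernel K h c y)"
  have swap: "(\<integral>\<^sup>+x. (\<integral>\<^sup>+y. ?k x y \<partial>lborel) * indicator A x \<partial>lborel)
      = (\<integral>\<^sup>+u. \<integral>\<^sup>+v. indicator A (c + h * u + h' * v) \<partial>kernel_law K \<partial>kernel_law K)"
    if [measurable]: "A \<in> sets borel" for A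
  proof -
    have "(\<integral>\<^sup>+x. (\<integral>\<^sup>+y. ?k x y \<partial>lborel) * indicator A x \<partial>lborel)
        = (\<integral>\<^sup>+x. \<integral>\<^sup>+y. ?k x y * indicator A x \<partial>lborel \<partial>lborel)"
      unfolding scaled_kernel_def by (intro nn_integral_cong, subst nn_integral_multc) auto
    also have "\<dots> = (\<integral>\<^sup>+y. \<integral>\<^sup>+x. ?k x y * indicator A x \<partial>lborel \<partial>lborel)"
      unfolding scaled_kernel_def
      by (rule lborel_pair.Fubini'[symmetric]) measurable
    also have "\<dots> = (\<integral>\<^sup>+y. ennreal (scaled_kernel K h c y) * (\<integral>\<^sup>+x. ennreal (scaled_kernel K h' y x) * indicator A x \<partial>lborel) \<partial>lborel)"
      unfolding scaled_kernel_def
      by (intro nn_integral_cong, subst nn_integral_cmult[symmetric]) (auto simp: ac_simps)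
    also have "\<dots> = (\<integral>\<^sup>+y. ennreal (scaled_kernel K h c y) * (\<integral>\<^sup>+v. indicator A (y + h' * v) \<partial>kernel_law K) \<partial>lborel)"
      by (intro nn_integral_cong, subst nn_integral_scaled_kernel[OF K h']) auto
    also have "\<dots> = (\<integral>\<^sup>+u. \<integral>\<^sup>+v. indicator A (c + h * u + h' * v) \<partial>kernel_law K \<partial>kernel_law K)"
      by (rule nn_integral_scaled_kernel[OF K h]) measurable
    finally show ?thesis .
  qed
  have "(\<integral>\<^sup>+x. (\<integral>\<^sup>+y. ?k x y \<partial>lborel) \<partial>lborel) = 1"
    using swap[of UNIV] by (simp add: L.emeasure_space_1[simplified])
  then have "AE x in lborel. (\<integral>\<^sup>+y. ?k x y \<partial>lborel) \<noteq> \<infinity>"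
    unfolding scaled_kernel_def by (intro nn_integral_PInf_AE) auto
  then have conv: "AE x in lborel. ennreal (kernel_conv K h' h c x) = (\<integral>\<^sup>+y. ?k x y \<partial>lborel)"
  proof eventually_elim
    case (elim x)
    have eq: "(\<integral>\<^sup>+y. ?k x y \<partial>lborel) = (\<integral>\<^sup>+y. ennreal (scaled_kernel K h' y x * scaled_kernel K h c y) \<partial>lborel)"
      using h h' Kn by (intro nn_integral_cong ennreal_mult[symmetric]) (auto simp: scaled_kernel_def)
    have "integrable lborel (\<lambda>y. scaled_kernel K h' y x * scaled_kernel K h c y)"
      using elim h h' Kn unfolding eq
      by (intro integrableI_nonneg) (auto simp: scaled_kernel_def top.not_eq_extremum)
    then show ?case
      using h h' Kn unfolding eq kernel_conv_def
      by (intro nn_integral_eq_integral[symmetric]) (auto simp: scaled_kernel_def)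
  qed
  show "sets (kernel_conv_measure K h' h c)
      = sets (distr (kernel_law K \<Otimes>\<^sub>M kernel_law K) borel (\<lambda>(u, v). c + h * u + h' * v))"
    by (simp add: kernel_conv_measure_def)
  fix A assume "A \<in> sets (kernel_conv_measure K h' h c)"
  then have A [measurable]: "A \<in> sets borel" by (simp add: kernel_conv_measure_def)
  have [measurable]: "kernel_conv K h' h c \<in> borel_measurable borel"
    using K by (rule kernel_conv_measurable)
  have "emeasure (kernel_conv_measure K h' h c) A
      = (\<integral>\<^sup>+x. ennreal (kernel_conv K h' h c x) * indicator A x \<partial>lborel)"
    unfolding kernel_conv_measure_def by (subst emeasure_density) auto
  also have "\<dots> = (\<integral>\<^sup>+x. (\<integral>\<^sup>+y. ?k x y \<partial>lborel) * indicator A x \<partial>lborel)"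
    using conv by (intro nn_integral_cong_AE) (auto elim: eventually_mono)
  also have "\<dots> = (\<integral>\<^sup>+p. indicator A (c + h * fst p + h' * snd p) \<partial>(kernel_law K \<Otimes>\<^sub>M kernel_law K))"
    unfolding swap[OF A] by (subst L.nn_integral_fst[symmetric]) auto
  also have "\<dots> = (\<integral>\<^sup>+x. indicator A x \<partial>distr (kernel_law K \<Otimes>\<^sub>M kernel_law K) borel (\<lambda>(u, v). c + h * u + h' * v))"
    by (subst nn_integral_distr) (auto simp: case_prod_beta)
  finally show "emeasure (kernel_conv_measure K h' h c) A
      = emeasure (distr (kernel_law K \<Otimes>\<^sub>M kernel_law K) borel (\<lambda>(u, v). c + h * u + h' * v)) A"
    by simp
qed

lemma smooth_measurable [measurable]:
  assumes K: "is_kernel K" and [measurable]: "g \<in> borel_measurable borel"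
  shows "smooth K h g \<in> borel_measurable borel"
proof -
  interpret prob_space "kernel_law K" using K by (rule prob_space_kernel_law)
  show ?thesis unfolding smooth_def by measurable
qed

lemma integrable_kernel_law_bounded:
  assumes K: "is_kernel K" and g: "g \<in> borel_measurable borel" "\<And>x. \<bar>g x\<bar> \<le> (B::real)"
  shows "integrable (kernel_law K) (\<lambda>u. g (c + h * u))"
proof -
  note [measurable] = g(1)
  interpret prob_space "kernel_law K" using K by (rule prob_space_kernel_law)
  show ?thesis using g(2) by (intro integrable_const_bound[where B = B]) auto
qed

lemma smooth_bound:
  assumes K: "is_kernel K" and g: "g \<in> borel_measurable borel" "\<And>x. \<bar>g x\<bar> \<le> B"
  shows "\<bar>smooth K h g c\<bar> \<le> B"
proof -
  interpret prob_space "kernel_law K" using K by (rule prob_space_kernel_law)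
  have "\<bar>smooth K h g c\<bar> \<le> (\<integral>u. \<bar>g (c + h * u)\<bar> \<partial>kernel_law K)"
    unfolding smooth_def by (rule integral_abs_bound)
  also have "\<dots> \<le> (\<integral>u. B \<partial>kernel_law K)"
    using integrable_kernel_law_bounded[OF K g] g(2) by (intro integral_mono) auto
  finally show ?thesis by (simp add: prob_space[simplified])
qed

lemma smooth_const: "is_kernel K \<Longrightarrow> smooth K h (\<lambda>_. b) c = b"
  by (simp add: smooth_def prob_space.prob_space[OF prob_space_kernel_law, simplified])

lemma smooth_indicator:
  assumes K: "is_kernel K" and h: "0 < h" and [measurable]: "A \<in> sets borel"
  shows "smooth K h (indicat_real A) c = measure (kernel_measure K h c) A"
proof -
  have "measure (kernel_measure K h c) A = (\<integral>x. indicat_real A x \<partial>distr (kernel_law K) borel (\<lambda>v. c + h * v))"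
    unfolding kernel_measure_eq_distr[OF K h] by simp
  also have "\<dots> = smooth K h (indicat_real A) c"
    unfolding smooth_def by (subst integral_distr) auto
  finally show ?thesis by simp
qed

lemma integral_kernel_measure:
  assumes K: "is_kernel K" and h: "0 < h" and [measurable]: "g \<in> borel_measurable borel"
  shows "(\<integral>x. g x \<partial>kernel_measure K h c) = smooth K h g c"
  unfolding kernel_measure_eq_distr[OF K h] smooth_def by (subst integral_distr) auto

lemma integral_kernel_conv_measure:
  assumes K: "is_kernel K" and h: "0 < h" "0 < h'" and g: "g \<in> borel_measurable borel" "\<And>x. \<bar>g x\<bar> \<le> B"
  shows "(\<integral>x. g x \<partial>kernel_conv_measure K h' h c) = smooth K h (smooth K h' g) c"
proof -
  note [measurable] = g(1)
  interpret L: prob_space "kernel_law K" using K by (rule prob_space_kernel_law)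
  interpret LL: pair_prob_space "kernel_law K" "kernel_law K" ..
  have int: "integrable (kernel_law K \<Otimes>\<^sub>M kernel_law K) (\<lambda>(u, v). g (c + h * u + h' * v))"
    using g(2) by (intro LL.P.integrable_const_bound[where B = B]) auto
  have "(\<integral>x. g x \<partial>kernel_conv_measure K h' h c) = (\<integral>(u, v). g (c + h * u + h' * v) \<partial>(kernel_law K \<Otimes>\<^sub>M kernel_law K))"
    unfolding kernel_conv_measure_eq_distr[OF K h] by (subst integral_distr) (auto simp: case_prod_beta')
  also have "\<dots> = (\<integral>u. \<integral>v. g (c + h * u + h' * v) \<partial>kernel_law K \<partial>kernel_law K)"
    using LL.integral_fst'[OF int] by simp
  finally show ?thesis by (simp add: smooth_def)
qed

lemma prob_space_kernel_measure:
  assumes K: "is_kernel K" and h: "0 < h"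
  shows "prob_space (kernel_measure K h c)"
proof -
  interpret L: prob_space "kernel_law K" using K by (rule prob_space_kernel_law)
  show ?thesis unfolding kernel_measure_eq_distr[OF K h] by (intro L.prob_space_distr) auto
qed

lemma prob_space_kernel_conv_measure:
  assumes K: "is_kernel K" and h: "0 < h" "0 < h'"
  shows "prob_space (kernel_conv_measure K h' h c)"
proof -
  interpret L: prob_space "kernel_law K" using K by (rule prob_space_kernel_law)
  interpret LL: pair_prob_space "kernel_law K" "kernel_law K" ..
  show ?thesis unfolding kernel_conv_measure_eq_distr[OF K h] by (intro LL.P.prob_space_distr) auto
qed

lemma tv_dist_upper:
  assumes "prob_space \<mu>" "prob_space \<nu>" "A \<in> sets borel"
  shows "\<bar>measure \<mu> A - measure \<nu> A\<bar> \<le> tv_dist \<mu> \<nu>"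
  unfolding tv_dist_def
proof (rule cSUP_upper)
  show "A \<in> sets borel" by fact
  have "\<bar>measure \<mu> B - measure \<nu> B\<bar> \<le> 1" for B
    using prob_space.prob_le_1[OF assms(1), of B] prob_space.prob_le_1[OF assms(2), of B]
      measure_nonneg[of \<mu> B] measure_nonneg[of \<nu> B] by linarith
  then show "bdd_above ((\<lambda>A. \<bar>measure \<mu> A - measure \<nu> A\<bar>) ` sets borel)"
    by (auto intro!: bdd_aboveI)
qed

text \<open>The set where the first density is the larger one attains the total variation distance, and
  the L1 distance of the densities is twice that distance.\<close>
lemma integral_diff_le_tv_dist:
  fixes f g \<psi> :: "real \<Rightarrow> real"
  assumes f: "f \<in> borel_measurable borel" "\<And>x. 0 \<le> f x"
    and g: "g \<in> borel_measurable borel" "\<And>x. 0 \<le> g x"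
    and \<psi>: "\<psi> \<in> borel_measurable borel" "\<And>x. \<bar>\<psi> x\<bar> \<le> 1"
    and prob: "prob_space (density lborel f)" "prob_space (density lborel g)"
  shows "\<bar>(\<integral>x. \<psi> x \<partial>density lborel f) - (\<integral>x. \<psi> x \<partial>density lborel g)\<bar>
           \<le> 2 * tv_dist (density lborel f) (density lborel g)"
proof -
  note [measurable] = f(1) g(1) \<psi>(1)
  let ?\<mu> = "density lborel f" and ?\<nu> = "density lborel g"
  have int: "integrable lborel w" if [measurable]: "w \<in> borel_measurable borel"
    and w: "\<And>x. 0 \<le> w x" and p: "prob_space (density lborel w)" for w :: "real \<Rightarrow> real"
  proof -
    have "(\<integral>\<^sup>+x. ennreal (w x) \<partial>lborel) = 1"
      using prob_space.emeasure_space_1[OF p] by (simp add: emeasure_density)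
    then show ?thesis using w by (intro integrableI_nonneg) auto
  qed
  have intf [simp]: "integrable lborel f" and intg [simp]: "integrable lborel g"
    by (rule int[OF f prob(1)], rule int[OF g prob(2)])
  have ms: "measure (density lborel w) A = (\<integral>x. w x * indicat_real A x \<partial>lborel)"
    if [measurable]: "w \<in> borel_measurable borel" "A \<in> sets borel" and w: "\<And>x. 0 \<le> w x" for w A
  proof -
    have "measure (density lborel w) A = (\<integral>x. indicat_real A x \<partial>density lborel w)" by simp
    also have "\<dots> = (\<integral>x. w x * indicat_real A x \<partial>lborel)"
      using w by (subst integral_density) auto
    finally show ?thesis .
  qed
  define A where "A = {x. g x < f x}"
  have A [measurable]: "A \<in> sets borel" unfolding A_def by measurable
  have bd: "integrable lborel (\<lambda>x. w x * v x)"
    if "integrable lborel w" and [measurable]: "v \<in> borel_measurable borel"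
      and v: "\<And>x. \<bar>v x\<bar> \<le> 1" for w v :: "real \<Rightarrow> real"
    using v by (intro Bochner_Integration.integrable_bound[OF that(1)] ) 
       (use that(1) in \<open>auto simp: abs_mult intro!: mult_left_le borel_measurable_times dest: borel_measurable_integrable\<close>)
  have i1: "integrable lborel (\<lambda>x. f x * indicat_real A x)" "integrable lborel (\<lambda>x. g x * indicat_real A x)"
    "integrable lborel (\<lambda>x. f x * indicat_real (- A) x)" "integrable lborel (\<lambda>x. g x * indicat_real (- A) x)"
    "integrable lborel (\<lambda>x. f x * \<psi> x)" "integrable lborel (\<lambda>x. g x * \<psi> x)"
    using bd[OF intf, of "indicat_real A"] bd[OF intg, of "indicat_real A"] bd[OF intf, of "indicat_real (- A)"]
      bd[OF intg, of "indicat_real (- A)"] bd[OF intf \<psi>] bd[OF intg \<psi>] by (simp_all add: indicator_def)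
  have "\<bar>(\<integral>x. \<psi> x \<partial>?\<mu>) - (\<integral>x. \<psi> x \<partial>?\<nu>)\<bar> = \<bar>\<integral>x. f x * \<psi> x - g x * \<psi> x \<partial>lborel\<bar>"
    using f g i1 by (simp add: integral_density)
  also have "\<dots> \<le> (\<integral>x. \<bar>f x * \<psi> x - g x * \<psi> x\<bar> \<partial>lborel)"
    by (rule integral_abs_bound)
  also have "\<dots> \<le> (\<integral>x. (f x * indicat_real A x - g x * indicat_real A x)
                     + (g x * indicat_real (- A) x - f x * indicat_real (- A) x) \<partial>lborel)"
  proof (rule integral_mono)
    fix x
    have "\<bar>f x * \<psi> x - g x * \<psi> x\<bar> = \<bar>f x - g x\<bar> * \<bar>\<psi> x\<bar>"
      by (simp add: abs_mult[symmetric] algebra_simps)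
    also have "\<dots> \<le> \<bar>f x - g x\<bar>"
      using \<psi>(2)[of x] by (simp add: mult_left_le)
    also have "\<dots> = (f x * indicat_real A x - g x * indicat_real A x)
                     + (g x * indicat_real (- A) x - f x * indicat_real (- A) x)"
      by (auto simp: A_def indicator_def)
    finally show "\<bar>f x * \<psi> x - g x * \<psi> x\<bar> \<le> (f x * indicat_real A x - g x * indicat_real A x)
                     + (g x * indicat_real (- A) x - f x * indicat_real (- A) x)" .
  qed (use i1 in auto)
  also have "\<dots> = (measure ?\<mu> A - measure ?\<nu> A) + (measure ?\<nu> (- A) - measure ?\<mu> (- A))"
    using i1 f g by (simp add: ms)
  also have "\<dots> \<le> 2 * tv_dist ?\<mu> ?\<nu>"
    using tv_dist_upper[OF prob A] tv_dist_upper[OF prob, of "- A"] A by auto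
  finally show ?thesis .
qed

lemma smooth_smooth_diff_le_tv_dist:
  assumes K: "is_kernel K" and h: "0 < h" "0 < h'" and g: "g \<in> borel_measurable borel" "\<And>x. \<bar>g x\<bar> \<le> 1"
  shows "\<bar>smooth K h (smooth K h' g) c - smooth K h g c\<bar>
           \<le> 2 * tv_dist (kernel_conv_measure K h' h c) (kernel_measure K h c)"
proof -
  have [measurable]: "K \<in> borel_measurable borel" using K by (rule kernel_measurable)
  have Kn: "0 \<le> K u" for u using K by (simp add: is_kernel_def)
  have "\<bar>(\<integral>x. g x \<partial>kernel_conv_measure K h' h c) - (\<integral>x. g x \<partial>kernel_measure K h c)\<bar>
      \<le> 2 * tv_dist (kernel_conv_measure K h' h c) (kernel_measure K h c)"
    unfolding kernel_conv_measure_def kernel_measure_def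
  proof (rule integral_diff_le_tv_dist)
    show "prob_space (density lborel (\<lambda>x. ennreal (kernel_conv K h' h c x)))"
      using prob_space_kernel_conv_measure[OF K h] by (simp add: kernel_conv_measure_def)
    show "prob_space (density lborel (\<lambda>x. ennreal (scaled_kernel K h c x)))"
      using prob_space_kernel_measure[OF K h(1)] by (simp add: kernel_measure_def)
    show "scaled_kernel K h c \<in> borel_measurable borel"
      unfolding scaled_kernel_def by measurable
  qed (use g K h Kn in \<open>auto intro: kernel_conv_measurable kernel_conv_nonneg simp: scaled_kernel_def\<close>)
  then show ?thesis
    by (simp add: integral_kernel_conv_measure[OF K h g] integral_kernel_measure[OF K h(1) g(1)])
qed

section \<open>The tails of the kernel are controlled by total variation\<close>

text \<open>The average of \<open>1 - cos(s x)\<close> over \<open>0 \<le> s \<le> a\<close> is \<open>1 - sin(a x) / (a x)\<close>.  A single frequency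
  cannot detect large \<open>x\<close>, because \<open>cos(s x)\<close> returns to 1; the average over frequencies can.\<close>
lemma one_minus_sinc_lower_bound:
  fixes y :: real
  assumes "y \<noteq> 0"
  shows "min 1 (y\<^sup>2) / 8 \<le> 1 - sin y / y"
proof -
  have pos: "min 1 (y\<^sup>2) / 8 \<le> 1 - sin y / y" if y: "0 < y" for y :: real
  proof (cases "y \<le> 2")
    case True
    have "\<bar>sin y - (\<Sum>m<5. sin_coeff m * y ^ m)\<bar> \<le> inverse (fact 5) * \<bar>y\<bar> ^ 5"
      by (rule Maclaurin_sin_bound)
    moreover have "(\<Sum>m<5. sin_coeff m * y ^ m) = y - y ^ 3 / 6"
    proof -
      have "{..<5} = {0, 1, 2, 3, 4 :: nat}" by auto
      then show ?thesis by (simp add: sin_coeff_def fact_numeral)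
    qed
    ultimately have "sin y \<le> y - y ^ 3 / 6 + y ^ 5 / 120"
      using y abs_ge_self[of "sin y - (y - y ^ 3 / 6)"] by (simp add: fact_numeral)
    moreover have "y ^ 5 \<le> 4 * y ^ 3"
    proof -
      have "y ^ 2 \<le> 2 ^ 2" using y True by (intro power_mono) auto
      then have "y ^ 2 * y ^ 3 \<le> 4 * y ^ 3" using y by (intro mult_right_mono) auto
      then show ?thesis by (simp add: power_add[symmetric])
    qed
    moreover have "0 \<le> y ^ 3" using y by simp
    ultimately have "sin y \<le> y - y ^ 3 / 8" by linarith
    then have "sin y / y \<le> (y - y ^ 3 / 8) / y"
      using y by (intro divide_right_mono) auto
    also have "\<dots> = 1 - y\<^sup>2 / 8"
      using y by (simp add: field_simps power2_eq_square power3_eq_cube)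
    finally have "sin y / y \<le> 1 - y\<^sup>2 / 8" .
    moreover have "min 1 (y\<^sup>2) \<le> y\<^sup>2" by simp
    ultimately show ?thesis by linarith
  next
    case False
    then have "sin y * 2 \<le> y" using sin_le_one[of y] by linarith
    then have "sin y / y \<le> 1 / 2" using y by (simp add: field_simps)
    moreover have "min 1 (y\<^sup>2) \<le> 1" by simp
    ultimately show ?thesis by linarith
  qed
  show ?thesis
    using pos[of y] pos[of "- y"] assms by (cases "0 < y") auto
qed

lemma average_one_minus_cos:
  fixes x :: real
  assumes a: "0 < a"
  shows "ennreal (a * min 1 ((a * x)\<^sup>2) / 8) \<le> (\<integral>\<^sup>+s. ennreal (1 - cos (s * x)) * indicator {0..a} s \<partial>lborel)"
proof (cases "x = 0")
  case False
  have "(\<integral>\<^sup>+s. ennreal (1 - cos (s * x)) * indicator {0..a} s \<partial>lborel)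
      = ennreal ((a - sin (a * x) / x) - (0 - sin (0 * x) / x))"
    using False a
    by (intro nn_integral_FTC_Icc) (auto intro!: derivative_eq_intros simp: cos_le_one)
  also have "(a - sin (a * x) / x) - (0 - sin (0 * x) / x) = a * (1 - sin (a * x) / (a * x))"
    using False a by (simp add: field_simps)
  finally show ?thesis
    using one_minus_sinc_lower_bound[of "a * x"] False a
    by (auto intro!: ennreal_leI mult_left_mono simp flip: times_divide_eq_right)
qed simp

text \<open>The real and imaginary parts of the characteristic function of the kernel.\<close>
definition cos_transform :: "(real \<Rightarrow> real) \<Rightarrow> real \<Rightarrow> real" where
  "cos_transform K a = (\<integral>u. cos (a * u) \<partial>kernel_law K)"

definition sin_transform :: "(real \<Rightarrow> real) \<Rightarrow> real \<Rightarrow> real" where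
  "sin_transform K a = (\<integral>u. sin (a * u) \<partial>kernel_law K)"

lemma integrable_cos_sin_kernel_law:
  assumes K: "is_kernel K"
  shows "integrable (kernel_law K) (\<lambda>u. cos (a * u))" "integrable (kernel_law K) (\<lambda>u. sin (a * u))"
  using integrable_kernel_law_bounded[OF K, where g = cos and B = 1 and c = 0 and h = a]
    integrable_kernel_law_bounded[OF K, where g = sin and B = 1 and c = 0 and h = a]
  by auto

lemma smooth_cos:
  assumes K: "is_kernel K"
  shows "smooth K h (\<lambda>x. cos (s * (x - c))) z
    = cos (s * (z - c)) * cos_transform K (s * h) - sin (s * (z - c)) * sin_transform K (s * h)"
proof -
  have arg: "s * (z + h * u - c) = s * (z - c) + s * h * u" for u
    by (simp add: algebra_simps)
  have "smooth K h (\<lambda>x. cos (s * (x - c))) z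
    = (\<integral>u. cos (s * (z - c)) * cos (s * h * u) - sin (s * (z - c)) * sin (s * h * u) \<partial>kernel_law K)"
    unfolding smooth_def by (simp add: arg cos_add)
  also have "\<dots> = cos (s * (z - c)) * cos_transform K (s * h) - sin (s * (z - c)) * sin_transform K (s * h)"
    using integrable_cos_sin_kernel_law[OF K, of "s * h"]
    by (simp add: cos_transform_def sin_transform_def)
  finally show ?thesis .
qed

lemma smooth_sin:
  assumes K: "is_kernel K"
  shows "smooth K h (\<lambda>x. sin (s * (x - c))) z
    = sin (s * (z - c)) * cos_transform K (s * h) + cos (s * (z - c)) * sin_transform K (s * h)"
proof -
  have arg: "s * (z + h * u - c) = s * (z - c) + s * h * u" for u
    by (simp add: algebra_simps)
  have "smooth K h (\<lambda>x. sin (s * (x - c))) z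
    = (\<integral>u. sin (s * (z - c)) * cos (s * h * u) + cos (s * (z - c)) * sin (s * h * u) \<partial>kernel_law K)"
    unfolding smooth_def by (simp add: arg sin_add)
  also have "\<dots> = sin (s * (z - c)) * cos_transform K (s * h) + cos (s * (z - c)) * sin_transform K (s * h)"
    using integrable_cos_sin_kernel_law[OF K, of "s * h"]
    by (simp add: cos_transform_def sin_transform_def)
  finally show ?thesis .
qed

lemma smooth_lincomb:
  assumes K: "is_kernel K" and f: "f \<in> borel_measurable borel" "\<And>x. \<bar>f x\<bar> \<le> (B::real)"
    and g: "g \<in> borel_measurable borel" "\<And>x. \<bar>g x\<bar> \<le> B"
  shows "smooth K h (\<lambda>x. a * f x + b * g x) c = a * smooth K h f c + b * smooth K h g c"
  unfolding smooth_def
  using integrable_kernel_law_bounded[OF K f, of c h] integrable_kernel_law_bounded[OF K g, of c h]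
  by simp

lemma trig_transform_le_1:
  assumes K: "is_kernel K"
  shows "\<bar>cos_transform K a\<bar> \<le> 1" "\<bar>sin_transform K a\<bar> \<le> 1"
  using smooth_bound[OF K, of cos 1 a 0] smooth_bound[OF K, of sin 1 a 0]
  by (auto simp: smooth_def cos_transform_def sin_transform_def)

text \<open>With the characteristic function \<open>\<phi>\<close> of the kernel, \<open>|\<phi>(s h) (\<phi>(s h') - 1)|\<close> is the difference of the
  integrals of \<open>exp(i s (x - c))\<close> against the two measures, which their total variation distance bounds.  Multiplying by the conjugate of \<open>\<phi>(s h)\<close> and taking
  real parts gives the claim, stated here with real functions.\<close>
lemma cos_transform_deficit_le_tv_dist:
  assumes K: "is_kernel K" and h: "0 < h" "0 < h'"
  shows "((cos_transform K (s * h))\<^sup>2 + (sin_transform K (s * h))\<^sup>2) * (1 - cos_transform K (s * h'))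
     \<le> 4 * tv_dist (kernel_conv_measure K h' h c) (kernel_measure K h c)"
proof -
  define T where "T = tv_dist (kernel_conv_measure K h' h c) (kernel_measure K h c)"
  define p q where "p = cos_transform K (s * h)" and "q = sin_transform K (s * h)"
  define p' q' where "p' = cos_transform K (s * h')" and "q' = sin_transform K (s * h')"
  note bounds = trig_transform_le_1[OF K, of "s * h", folded p_def q_def]
  have "smooth K h (smooth K h' (\<lambda>x. cos (s * (x - c)))) c
      = smooth K h (\<lambda>z. p' * cos (s * (z - c)) + (- q') * sin (s * (z - c))) c"
    by (intro arg_cong2[where f = "smooth K h"] ext refl)
      (simp only: smooth_cos[OF K] p'_def q'_def, simp)
  also have "\<dots> = p' * p - q' * q"
    by (subst smooth_lincomb[OF K, where B = 1]) (auto simp: smooth_cos[OF K] smooth_sin[OF K] p_def q_def)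
  finally have "\<bar>p' * p - q' * q - p\<bar> \<le> 2 * T"
    using smooth_smooth_diff_le_tv_dist[OF K h, of "\<lambda>x. cos (s * (x - c))" c]
    by (simp add: smooth_cos[OF K, of h s c c] p_def T_def)
  then have c: "\<bar>p * (p' * p - q' * q - p)\<bar> \<le> 2 * T"
    using bounds(1) mult_mono[of "\<bar>p\<bar>" 1 "\<bar>p' * p - q' * q - p\<bar>" "2 * T"] by (simp add: abs_mult)
  have "smooth K h (smooth K h' (\<lambda>x. sin (s * (x - c)))) c
      = smooth K h (\<lambda>z. q' * cos (s * (z - c)) + p' * sin (s * (z - c))) c"
    by (intro arg_cong2[where f = "smooth K h"] ext refl)
      (simp only: smooth_sin[OF K] p'_def q'_def, simp)
  also have "\<dots> = q' * p + p' * q"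
    by (subst smooth_lincomb[OF K, where B = 1]) (auto simp: smooth_cos[OF K] smooth_sin[OF K] p_def q_def)
  finally have "\<bar>q' * p + p' * q - q\<bar> \<le> 2 * T"
    using smooth_smooth_diff_le_tv_dist[OF K h, of "\<lambda>x. sin (s * (x - c))" c]
    by (simp add: smooth_sin[OF K, of h s c c] q_def T_def)
  then have s: "\<bar>q * (q' * p + p' * q - q)\<bar> \<le> 2 * T"
    using bounds(2) mult_mono[of "\<bar>q\<bar>" 1 "\<bar>q' * p + p' * q - q\<bar>" "2 * T"] by (simp add: abs_mult)
  have "(p\<^sup>2 + q\<^sup>2) * (1 - p') = - (p * (p' * p - q' * q - p)) - q * (q' * p + p' * q - q)"
    by (simp add: algebra_simps power2_eq_square)
  then have "(p\<^sup>2 + q\<^sup>2) * (1 - p') \<le> 4 * T"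
    using c s by linarith
  then show ?thesis by (simp add: p_def q_def p'_def T_def)
qed

lemma cos_transform_near_0:
  assumes K: "is_kernel K"
  obtains a where "0 < a" "\<And>b. 0 \<le> b \<Longrightarrow> b \<le> a \<Longrightarrow> 1 / 2 \<le> cos_transform K b"
proof -
  interpret L: prob_space "kernel_law K" using K by (rule prob_space_kernel_law)
  interpret L: real_distribution "kernel_law K" by standard auto
  have "isCont (\<lambda>t. Re (char (kernel_law K) t)) 0"
    using L.isCont_char[of 0] by (rule isCont_Re)
  moreover have Re: "Re (char (kernel_law K) t) = cos_transform K t" for t
    unfolding char_def cos_transform_def
    by (subst integral_Re[symmetric]) (auto intro!: L.integrable_const_bound[where B = 1] simp: Re_exp norm_exp_i_times)
  ultimately have "isCont (cos_transform K) 0" by simp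
  then have "(cos_transform K \<longlongrightarrow> cos_transform K 0) (at 0)" by (simp add: isCont_def)
  moreover have c0: "cos_transform K 0 = 1" by (simp add: cos_transform_def L.prob_space[simplified])
  ultimately have "\<forall>\<^sub>F t in at 0. 1 / 2 < cos_transform K t"
    by (intro order_tendstoD(1)) auto
  then obtain d where d: "0 < d" "\<And>t. t \<noteq> 0 \<Longrightarrow> \<bar>t\<bar> < d \<Longrightarrow> 1 / 2 < cos_transform K t"
    by (auto simp: eventually_at dist_real_def)
  show ?thesis
  proof (rule that[of "d / 2"])
    show "1 / 2 \<le> cos_transform K b" if "0 \<le> b" "b \<le> d / 2" for b
      using d(2)[of b] that d(1) c0 by (cases "b = 0") auto
  qed (use d in auto)
qed

text \<open>For a fixed \<open>h\<close> the factor \<open>|\<phi>(s h)|\<^sup>2\<close> is at least 1/4 for all small \<open>s\<close>, so \<open>1 - Re \<phi>(s h')\<close> is bounded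
  by the total variation distance uniformly in these \<open>s\<close>.  Averaging over \<open>s\<close> turns this into a bound on the
  truncated second moment of \<open>h' u\<close>.\<close>
lemma truncated_second_moment_le_tv_dist:
  assumes K: "is_kernel K" and h: "0 < h"
  obtains B where "0 < B"
    "\<And>h' c. 0 < h' \<Longrightarrow> (\<integral>u. min 1 ((h' * u)\<^sup>2) \<partial>kernel_law K)
       \<le> B * tv_dist (kernel_conv_measure K h' h c) (kernel_measure K h c)"
proof -
  interpret L: prob_space "kernel_law K" using K by (rule prob_space_kernel_law)
  interpret P: pair_sigma_finite "kernel_law K" lborel ..
  obtain a0 where a0: "0 < a0" "\<And>b. 0 \<le> b \<Longrightarrow> b \<le> a0 \<Longrightarrow> 1 / 2 \<le> cos_transform K b"
    using cos_transform_near_0[OF K] by blast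
  define a where "a = a0 / h"
  have a: "0 < a" using a0 h by (simp add: a_def)
  define m where "m = min 1 (a\<^sup>2)"
  have m: "0 < m" using a by (simp add: m_def)
  show ?thesis
  proof (rule that[of "128 / m"])
    show "0 < 128 / m" using m by simp
    fix h' c :: real assume h': "0 < h'"
    define T where "T = tv_dist (kernel_conv_measure K h' h c) (kernel_measure K h c)"
    have T: "1 - cos_transform K (s * h') \<le> 16 * T" if "0 \<le> s" "s \<le> a" for s
    proof -
      have "s * h \<le> a0" using that h by (simp add: a_def field_simps)
      then have "1 / 2 \<le> cos_transform K (s * h)" using a0(2) that h by simp
      then have "(1 / 2)\<^sup>2 \<le> (cos_transform K (s * h))\<^sup>2" by (intro power_mono) auto
      then have "1 / 4 \<le> (cos_transform K (s * h))\<^sup>2 + (sin_transform K (s * h))\<^sup>2"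
        by (simp add: power2_eq_square add_increasing2)
      then have "1 / 4 * (1 - cos_transform K (s * h'))
          \<le> ((cos_transform K (s * h))\<^sup>2 + (sin_transform K (s * h))\<^sup>2) * (1 - cos_transform K (s * h'))"
        using trig_transform_le_1(1)[OF K, of "s * h'"] by (intro mult_right_mono) auto
      then show ?thesis
        using cos_transform_deficit_le_tv_dist[OF K h h', of s c] by (simp add: T_def)
    qed
    have "0 \<le> 1 - cos_transform K (0 * h')"
      using trig_transform_le_1(1)[OF K, of "0 * h'"] by simp
    then have T0: "0 \<le> T" using T[of 0] a by simp
    have "ennreal (\<integral>u. a * (m * min 1 ((h' * u)\<^sup>2)) / 8 \<partial>kernel_law K)
        = (\<integral>\<^sup>+u. ennreal (a * (m * min 1 ((h' * u)\<^sup>2)) / 8) \<partial>kernel_law K)"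
      using a m by (intro nn_integral_eq_integral[symmetric] L.integrable_const_bound[where B = "a * m / 8"])
        (auto simp: abs_mult min_def intro!: mult_left_le)
    also have "\<dots> \<le> (\<integral>\<^sup>+u. \<integral>\<^sup>+s. ennreal (1 - cos (s * (h' * u))) * indicator {0..a} s \<partial>lborel \<partial>kernel_law K)"
    proof (rule nn_integral_mono)
      fix u
      have "m * min 1 ((h' * u)\<^sup>2) \<le> min 1 ((a * (h' * u))\<^sup>2)"
      proof (rule min.boundedI)
        show "m * min 1 ((h' * u)\<^sup>2) \<le> 1" by (intro mult_le_one) (auto simp: m_def)
        have "m * min 1 ((h' * u)\<^sup>2) \<le> a\<^sup>2 * (h' * u)\<^sup>2"
          by (intro mult_mono) (auto simp: m_def)
        then show "m * min 1 ((h' * u)\<^sup>2) \<le> (a * (h' * u))\<^sup>2" by (simp add: power_mult_distrib)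
      qed
      then have "ennreal (a * (m * min 1 ((h' * u)\<^sup>2)) / 8) \<le> ennreal (a * min 1 ((a * (h' * u))\<^sup>2) / 8)"
        using a by (intro ennreal_leI) auto
      also have "\<dots> \<le> (\<integral>\<^sup>+s. ennreal (1 - cos (s * (h' * u))) * indicator {0..a} s \<partial>lborel)"
        by (rule average_one_minus_cos[OF a])
      finally show "ennreal (a * (m * min 1 ((h' * u)\<^sup>2)) / 8)
          \<le> (\<integral>\<^sup>+s. ennreal (1 - cos (s * (h' * u))) * indicator {0..a} s \<partial>lborel)" .
    qed
    also have "\<dots> = (\<integral>\<^sup>+s. \<integral>\<^sup>+u. ennreal (1 - cos (s * (h' * u))) * indicator {0..a} s \<partial>kernel_law K \<partial>lborel)"
      by (rule P.Fubini'[symmetric]) measurable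
    also have "\<dots> \<le> (\<integral>\<^sup>+s. ennreal (16 * T) * indicator {0..a} s \<partial>lborel)"
    proof (rule nn_integral_mono)
      fix s
      have "(\<integral>\<^sup>+u. ennreal (1 - cos (s * (h' * u))) \<partial>kernel_law K) \<le> ennreal (16 * T)" if "s \<in> {0..a}"
      proof -
        have "(\<integral>\<^sup>+u. ennreal (1 - cos (s * (h' * u))) \<partial>kernel_law K)
            = ennreal (\<integral>u. 1 - cos (s * (h' * u)) \<partial>kernel_law K)"
          using integrable_cos_sin_kernel_law(1)[OF K, of "s * h'"]
          by (intro nn_integral_eq_integral) (auto simp: ac_simps)
        also have "(\<integral>u. 1 - cos (s * (h' * u)) \<partial>kernel_law K) = 1 - cos_transform K (s * h')"
          using integrable_cos_sin_kernel_law(1)[OF K, of "s * h'"]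
          by (simp add: cos_transform_def L.prob_space[simplified] mult.assoc)
        finally show ?thesis using T that by (auto intro: ennreal_leI)
      qed
      then show "(\<integral>\<^sup>+u. ennreal (1 - cos (s * (h' * u))) * indicator {0..a} s \<partial>kernel_law K)
          \<le> ennreal (16 * T) * indicator {0..a} s"
        by (auto simp: indicator_def)
    qed
    also have "\<dots> = ennreal (16 * T * a)"
      using a T0 by (simp add: nn_integral_cmult ennreal_mult)
    finally have "(\<integral>u. a * (m * min 1 ((h' * u)\<^sup>2)) / 8 \<partial>kernel_law K) \<le> 16 * T * a"
      using T0 a by (simp add: ennreal_le_iff)
    then show "(\<integral>u. min 1 ((h' * u)\<^sup>2) \<partial>kernel_law K) \<le> 128 / m * tv_dist (kernel_conv_measure K h' h c) (kernel_measure K h c)"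
      using a m by (simp add: T_def field_simps)
  qed
qed

section \<open>Smoothing bounded Lipschitz functions\<close>

text \<open>Bound and Lipschitz constant are normalised to one.  Rescaling shows that this class still determines
  laws, and the drift bounds below then hold uniformly over it.\<close>
definition bounded_lipschitz :: "(real \<Rightarrow> real) set" where
  "bounded_lipschitz = {g. (\<forall>x. \<bar>g x\<bar> \<le> 1) \<and> (\<forall>x y. \<bar>g x - g y\<bar> \<le> \<bar>x - y\<bar>)}"

lemma bounded_lipschitz_bound: "g \<in> bounded_lipschitz \<Longrightarrow> \<bar>g x\<bar> \<le> 1"
  by (simp add: bounded_lipschitz_def)

lemma bounded_lipschitz_continuous:
  assumes "g \<in> bounded_lipschitz"
  shows "continuous_on UNIV g"
proof (rule continuous_onI)
  fix x e :: real assume "0 < e"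
  then show "\<exists>d>0. \<forall>x'\<in>UNIV. dist x' x < d \<longrightarrow> dist (g x') (g x) \<le> e"
    using assms unfolding bounded_lipschitz_def dist_real_def
    by (intro exI[of _ e]) (fastforce intro: order_trans less_imp_le)
qed

lemma bounded_lipschitz_measurable: "g \<in> bounded_lipschitz \<Longrightarrow> g \<in> borel_measurable borel"
  by (intro borel_measurable_continuous_onI bounded_lipschitz_continuous)

text \<open>A bound on \<open>min 1 x\<^sup>2\<close> controls \<open>min 2 |x|\<close> up to an additive \<open>\<eta>\<close> and a factor \<open>2 / \<eta>\<close>.  With \<open>\<eta>\<close> of
  order \<open>1 / n\<close> both terms contribute a summable drift.\<close>
lemma smooth_approx_bounded_lipschitz:
  assumes K: "is_kernel K" and h: "0 < h" and \<eta>: "0 < \<eta>" "\<eta> \<le> 1" and g: "g \<in> bounded_lipschitz"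
  shows "\<bar>smooth K h g c - g c\<bar> \<le> \<eta> + 2 / \<eta> * (\<integral>u. min 1 ((h * u)\<^sup>2) \<partial>kernel_law K)"
proof -
  interpret L: prob_space "kernel_law K" using K by (rule prob_space_kernel_law)
  have [measurable]: "g \<in> borel_measurable borel" using g by (rule bounded_lipschitz_measurable)
  have gb: "\<bar>g x\<bar> \<le> 1" and gl: "\<bar>g x - g y\<bar> \<le> \<bar>x - y\<bar>" for x y
    using g by (auto simp: bounded_lipschitz_def)
  have i: "integrable (kernel_law K) (\<lambda>u. min 1 ((h * u)\<^sup>2))"
    by (rule L.integrable_const_bound[where B = 1]) auto
  have ig: "integrable (kernel_law K) (\<lambda>u. g (c + h * u))"
    using gb by (intro integrable_kernel_law_bounded[OF K]) auto
  have pt: "\<bar>g (c + h * u) - g c\<bar> \<le> \<eta> + 2 / \<eta> * min 1 ((h * u)\<^sup>2)" for u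
  proof -
    define y where "y = \<bar>h * u\<bar>"
    have y: "0 \<le> y" "\<bar>g (c + h * u) - g c\<bar> \<le> y" using gl[of "c + h * u" c] by (auto simp: y_def)
    have b2: "\<bar>g (c + h * u) - g c\<bar> \<le> 2" using gb[of "c + h * u"] gb[of c] by linarith
    have sq: "(h * u)\<^sup>2 = y\<^sup>2" by (simp add: y_def)
    consider "y \<le> \<eta>" | "\<eta> < y" "y \<le> 1" | "1 < y" by linarith
    then show ?thesis
    proof cases
      case 1
      have "0 \<le> 2 / \<eta> * min 1 ((h * u)\<^sup>2)" using \<eta> by simp
      then show ?thesis using 1 y by linarith
    next
      case 2
      then have "\<eta> * y \<le> y\<^sup>2" using \<eta> by (simp add: power2_eq_square mult_right_mono)
      then have "y \<le> y\<^sup>2 / \<eta>" using \<eta> by (simp add: field_simps)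
      moreover have "y\<^sup>2 \<le> 1" using 2 y by (simp add: power_le_one)
      moreover have "0 \<le> y\<^sup>2 / \<eta>" using \<eta> by simp
      ultimately show ?thesis using y \<eta> by (simp add: sq min_def)
    next
      case 3
      then have "1 \<le> y\<^sup>2" by simp
      moreover have "2 \<le> 2 / \<eta>" using \<eta> by (simp add: field_simps)
      ultimately show ?thesis using b2 \<eta> by (simp add: sq min_absorb1)
    qed
  qed
  have "smooth K h g c - g c = (\<integral>u. g (c + h * u) - g c \<partial>kernel_law K)"
    using ig by (simp add: smooth_def L.prob_space[simplified])
  also have "\<bar>\<dots>\<bar> \<le> (\<integral>u. \<bar>g (c + h * u) - g c\<bar> \<partial>kernel_law K)"
    by (rule integral_abs_bound)
  also have "\<dots> \<le> (\<integral>u. \<eta> + 2 / \<eta> * min 1 ((h * u)\<^sup>2) \<partial>kernel_law K)"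
    using pt i ig by (intro integral_mono) auto
  also have "\<dots> = \<eta> + 2 / \<eta> * (\<integral>u. min 1 ((h * u)\<^sup>2) \<partial>kernel_law K)"
    using i by (simp add: L.prob_space[simplified])
  finally show ?thesis .
qed

section \<open>Decay of the bandwidths\<close>

text \<open>Write \<open>S n\<close> for the sum of the reciprocals.  The hypothesis says that \<open>b (n + 1) S n / (n + 1)\<close> tends to zero
  faster than \<open>1 / ln n\<close>, so it is eventually at most 1/4.  Since
  \<open>1 / b (n + 1) = S (n + 1) - S n\<close>, this is the growth rate \<open>S (n + 1) \<ge> (1 + 4 / (n + 1)) S n\<close>,
  so \<open>S n\<close> is eventually at least a multiple of \<open>n\<^sup>3\<close>.\<close>
lemma bandwidth_decay:
  fixes b :: "nat \<Rightarrow> real"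
  assumes pos: "\<And>n. 1 \<le> n \<Longrightarrow> 0 < b n"
    and o: "(\<lambda>n. b (n + 1) / (real n + 1) * (\<Sum>i=1..n. 1 / b i)) \<in> o(\<lambda>n. 1 / ln (real n))"
  obtains c n0 where "0 < c" "1 \<le> n0" "\<And>n. n0 \<le> n \<Longrightarrow> b (n + 1) \<le> c / (real n + 1)\<^sup>2"
proof -
  define S where "S n = (\<Sum>i=1..n. 1 / b i)" for n
  have S_Suc: "S (Suc n) = S n + 1 / b (Suc n)" for n by (simp add: S_def)
  have S_pos: "0 < S n" if "1 \<le> n" for n
    unfolding S_def using that pos by (intro sum_pos) auto
  have "\<forall>\<^sub>F n in sequentially. norm (b (n + 1) / (real n + 1) * S n) \<le> 1 / 4 * norm (1 / ln (real n))"
    using landau_o.smallD[OF o, of "1 / 4"] by (simp add: S_def)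
  moreover have "\<forall>\<^sub>F n in sequentially. 1 \<le> ln (real n)"
    by real_asymp
  ultimately have "\<forall>\<^sub>F n in sequentially. b (n + 1) / (real n + 1) * S n \<le> 1 / 4"
  proof eventually_elim
    case (elim n)
    have "1 / 4 * norm (1 / ln (real n)) \<le> 1 / 4" using elim(2) by simp
    then have "\<bar>b (n + 1) / (real n + 1) * S n\<bar> \<le> 1 / 4"
      using elim(1) unfolding real_norm_def by (rule order_trans[rotated])
    then show ?case by (rule order_trans[OF abs_ge_self])
  qed
  then obtain n1 where n1: "\<And>n. n1 \<le> n \<Longrightarrow> b (n + 1) / (real n + 1) * S n \<le> 1 / 4"
    by (auto simp: eventually_sequentially)
  define n0 where "n0 = max n1 3"
  have n0: "3 \<le> n0" "n1 \<le> n0" by (auto simp: n0_def)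
  \<comment> \<open>A cubic whose growth factor is exactly \<open>1 + 3 / n\<close>, below \<open>1 + 4 / (n + 1)\<close> from \<open>n = 3\<close> on.\<close>
  define T where "T n = real n * (real n + 1) * (real n + 2)" for n
  have T_pos: "0 < T n" if "1 \<le> n" for n using that by (simp add: T_def)
  define k where "k = S n0 / T n0"
  have k: "0 < k" using S_pos[of n0] T_pos[of n0] n0 by (simp add: k_def)
  have growth: "k * T n \<le> S n" if "n0 \<le> n" for n
    using that
  proof (induction n rule: dec_induct)
    case base
    then show ?case using T_pos[of n0] n0 by (simp add: k_def)
  next
    case (step n)
    have n: "3 \<le> n" using step n0 by simp
    have Sn: "0 < S n" using S_pos n by simp
    have "b (Suc n) * (4 * S n) \<le> real n + 1"
      using n1[of n] step n0 by (simp add: field_simps)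
    then have "4 * S n / (real n + 1) \<le> 1 / b (Suc n)"
      using pos[of "Suc n"] by (simp add: field_simps)
    then have "S n * (1 + 4 / (real n + 1)) \<le> S (Suc n)"
      by (simp add: S_Suc field_simps)
    moreover have "k * T (Suc n) \<le> S n * (1 + 4 / (real n + 1))"
    proof -
      have "T (Suc n) = T n * ((real n + 3) / real n)"
        using n by (simp add: T_def field_simps)
      moreover have "(real n + 3) / real n \<le> 1 + 4 / (real n + 1)"
        using n by (simp add: field_simps)
      ultimately have "k * T (Suc n) = (k * T n) * ((real n + 3) / real n)" by simp
      also have "\<dots> \<le> S n * ((real n + 3) / real n)"
        using step by (intro mult_right_mono) auto
      also have "\<dots> \<le> S n * (1 + 4 / (real n + 1))"
        using \<open>(real n + 3) / real n \<le> 1 + 4 / (real n + 1)\<close> Sn by (intro mult_left_mono) auto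
      finally show ?thesis .
    qed
    ultimately show ?case by simp
  qed
  show ?thesis
  proof (rule that[of "1 / k" n0])
    show "0 < 1 / k" "1 \<le> n0" using k n0 by auto
    fix n assume n: "n0 \<le> n"
    have n3: "3 \<le> n" using n n0 by simp
    have bn: "0 < b (n + 1)" using pos[of "n + 1"] by simp
    have "b (n + 1) * (k * T n) \<le> b (n + 1) * S n"
      using growth[OF n] bn by (intro mult_left_mono) auto
    also have "\<dots> \<le> (real n + 1) / 4"
      using n1[of n] n n0 by (simp add: field_simps)
    finally have "b (n + 1) * k * (4 * real n * (real n + 2)) * (real n + 1) \<le> 1 * (real n + 1)"
      by (simp add: T_def algebra_simps)
    then have "b (n + 1) * k * (4 * real n * (real n + 2)) \<le> 1"
      by (rule mult_right_le_imp_le) simp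
    moreover have "b (n + 1) * k * (real n + 1)\<^sup>2 \<le> b (n + 1) * k * (4 * real n * (real n + 2))"
    proof (rule mult_left_mono)
      have "(real n + 1) * (real n + 1) \<le> (4 * real n) * (real n + 2)"
        using n3 by (intro mult_mono) auto
      then show "(real n + 1)\<^sup>2 \<le> 4 * real n * (real n + 2)" by (simp add: power2_eq_square)
    qed (use bn k in auto)
    ultimately have "b (n + 1) * k * (real n + 1)\<^sup>2 \<le> 1" by linarith
    then show "b (n + 1) \<le> 1 / k / (real n + 1)\<^sup>2"
      using k by (simp add: field_simps)
  qed
qed

section \<open>Compactness for laws of random sequences\<close>

text \<open>
  Compactness comes from Helly's theorem on the real line.  A sequence of reals is coded into one
  real number in \<open>[0, 1]\<close>: squash every coordinate into \<open>(0, 1)\<close>, interleave the binary digits of all coordinates, and use the result as ternary digits 0 or 2 of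
  a point of the Cantor set.  This code is measurable but not continuous.  Its inverse, however,
  extends to continuous functions on the whole line: Schoenberg's space-filling curve reads the digits
  back by means of a continuous periodic function.  A weak limit of the coded laws therefore decodes to a
  weak limit in the product topology, and tightness is needed only to keep the coordinates
  away from the endpoints of \<open>(0, 1)\<close>.
\<close>
definition binary_digit :: "real \<Rightarrow> nat \<Rightarrow> real" where
  "binary_digit x m = of_int (\<lfloor>2 ^ Suc m * x\<rfloor> mod 2)"

lemma binary_digit_01: "binary_digit x m \<in> {0, 1}"
  unfolding binary_digit_def by (auto simp: of_int_eq_1_iff) 

lemma binary_digit_measurable [measurable]: "(\<lambda>x. binary_digit x m) \<in> borel_measurable borel"
  unfolding binary_digit_def by measurable

lemma binary_digit_sums:
  assumes "0 \<le> x" "x < 1"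
  shows "(\<lambda>m. binary_digit x m / 2 ^ Suc m) sums x"
proof -
  have part: "(\<Sum>m<n. binary_digit x m / 2 ^ Suc m) = of_int \<lfloor>2 ^ n * x\<rfloor> / 2 ^ n" for n
  proof (induction n)
    case 0
    then show ?case using assms by (simp add: floor_eq_iff)
  next
    case (Suc n)
    define y where "y = 2 ^ n * x"
    have "\<lfloor>2 * y\<rfloor> div 2 = \<lfloor>y\<rfloor>"
      using floor_divide_real_eq_div[of 2 "2 * y"] by simp
    then have "\<lfloor>2 * y\<rfloor> = 2 * \<lfloor>y\<rfloor> + \<lfloor>2 * y\<rfloor> mod 2"
      using div_mult_mod_eq[of "\<lfloor>2 * y\<rfloor>" 2] by linarith
    then have "real_of_int \<lfloor>2 * y\<rfloor> = 2 * of_int \<lfloor>y\<rfloor> + binary_digit x n"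
      by (simp add: binary_digit_def y_def mult.assoc)
    moreover have e: "\<lfloor>2 ^ Suc n * x\<rfloor> = \<lfloor>2 * y\<rfloor>" by (simp add: y_def mult.assoc)
    ultimately show ?case
      unfolding sum.lessThan_Suc Suc.IH y_def[symmetric] e by (simp add: field_simps)
  qed
  have "(\<lambda>n. of_int \<lfloor>2 ^ n * x\<rfloor> / 2 ^ n) \<longlonglongrightarrow> x"
  proof (rule real_tendsto_sandwich)
    show "(\<lambda>n. x - (1 / 2) ^ n) \<longlonglongrightarrow> x"
      by (rule tendsto_eq_intros LIMSEQ_power_zero refl | simp)+
    show "(\<lambda>n. x) \<longlonglongrightarrow> x" by simp
    show "\<forall>\<^sub>F n in sequentially. x - (1 / 2) ^ n \<le> of_int \<lfloor>2 ^ n * x\<rfloor> / 2 ^ n"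
    proof (intro always_eventually allI)
      fix n :: nat
      have "2 ^ n * x - 1 \<le> of_int \<lfloor>2 ^ n * x\<rfloor>" by linarith
      then have "(2 ^ n * x - 1) / 2 ^ n \<le> of_int \<lfloor>2 ^ n * x\<rfloor> / 2 ^ n"
        by (rule divide_right_mono) simp
      then show "x - (1 / 2) ^ n \<le> of_int \<lfloor>2 ^ n * x\<rfloor> / 2 ^ n"
        by (simp add: diff_divide_distrib power_divide)
    qed
    show "\<forall>\<^sub>F n in sequentially. of_int \<lfloor>2 ^ n * x\<rfloor> / 2 ^ n \<le> x"
      by (intro always_eventually allI) (simp add: field_simps)
  qed
  then show ?thesis unfolding sums_def part .
qed

definition cantor_code :: "(nat \<Rightarrow> real) \<Rightarrow> real" where
  "cantor_code a = (\<Sum>j. 2 * a j / 3 ^ Suc j)"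

lemma cantor_code_summable:
  assumes "\<And>j. a j \<in> {0, 1 :: real}"
  shows "summable (\<lambda>j. 2 * a j / 3 ^ Suc j)"
proof (rule summable_comparison_test)
  have "norm (2 * a j / 3 ^ Suc j) \<le> (1 / 3) ^ j" for j
    using assms[of j] by (auto simp: power_divide field_simps)
  then show "\<exists>N. \<forall>n\<ge>N. norm (2 * a n / 3 ^ Suc n) \<le> (1 / 3) ^ n" by blast
  show "summable (\<lambda>n. (1 / 3 :: real) ^ n)" by (rule summable_geometric) simp
qed

lemma cantor_code_bounds:
  assumes a: "\<And>j. a j \<in> {0, 1 :: real}"
  shows "0 \<le> cantor_code a" "cantor_code a \<le> 1"
proof -
  have nn: "0 \<le> 2 * a j / 3 ^ Suc j" "2 * a j / 3 ^ Suc j \<le> 2 / 3 * (1 / 3) ^ j" for j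
    using a[of j] by (auto simp: power_divide)
  show "0 \<le> cantor_code a"
    unfolding cantor_code_def using nn by (intro suminf_nonneg cantor_code_summable a)
  have "(\<lambda>j. 2 / 3 * (1 / 3) ^ j) sums (2 / 3 * (1 / (1 - 1 / 3 :: real)))"
    by (intro sums_mult geometric_sums) simp
  then have s: "(\<lambda>j. 2 / 3 * (1 / 3 :: real) ^ j) sums 1" by simp
  have "cantor_code a \<le> (\<Sum>j. 2 / 3 * (1 / 3) ^ j)"
    unfolding cantor_code_def using nn s by (intro suminf_le cantor_code_summable a) (auto simp: sums_iff)
  then show "cantor_code a \<le> 1" using s by (simp add: sums_iff)
qed

lemma cantor_code_shift:
  assumes a: "\<And>j. a j \<in> {0, 1 :: real}"
  shows "3 * cantor_code a = 2 * a 0 + cantor_code (\<lambda>j. a (Suc j))"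
proof -
  have "cantor_code a = (\<Sum>j. 2 * a (Suc j) / 3 ^ Suc (Suc j)) + 2 * a 0 / 3"
    using suminf_split_head[OF cantor_code_summable[of a], OF a] by (simp add: cantor_code_def)
  also have "(\<Sum>j. 2 * a (Suc j) / 3 ^ Suc (Suc j)) = (\<Sum>j. 2 * a (Suc j) / 3 ^ Suc j) / 3"
    using suminf_divide[OF cantor_code_summable[of "\<lambda>j. a (Suc j)"], of 3] a by simp
  finally show ?thesis by (simp add: cantor_code_def)
qed

text \<open>A continuous function of period 2 that vanishes on \<open>[0, 1/3]\<close> and is 1 on \<open>[2/3, 1]\<close>.  Multiplying a
  point of the Cantor set by \<open>3 ^ i\<close> shifts digit \<open>i\<close> to the front, up to an even integer.\<close>
definition digit_reader :: "real \<Rightarrow> real" where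
  "digit_reader t = max 0 (min 1 (1 / 2 - cos (pi * t)))"

lemma digit_reader_bounds: "0 \<le> digit_reader t" "digit_reader t \<le> 1"
  by (auto simp: digit_reader_def)

lemma digit_reader_periodic: "digit_reader (2 * of_int k + t) = digit_reader t"
proof -
  have "cos (pi * (2 * of_int k + t)) = cos (pi * t + 2 * pi * of_int k)"
    by (simp add: algebra_simps)
  also have "\<dots> = cos (pi * t)" by (simp add: cos_add cos_int_2pin sin_int_2pin)
  finally show ?thesis by (simp add: digit_reader_def)
qed

lemma digit_reader_0: "0 \<le> t \<Longrightarrow> t \<le> 1 / 3 \<Longrightarrow> digit_reader t = 0"
  using cos_monotone_0_pi_le[of "pi * t" "pi / 3"] by (simp add: digit_reader_def cos_60 field_simps)

lemma digit_reader_1: "2 / 3 \<le> t \<Longrightarrow> t \<le> 1 \<Longrightarrow> digit_reader t = 1"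
  using cos_monotone_0_pi_le[of "pi * (1 - t)" "pi / 3"] cos_pi_minus[of "pi * t"]
  by (simp add: digit_reader_def cos_60 field_simps)

lemma digit_reader_cantor_code:
  assumes "\<And>j. a j \<in> {0, 1 :: real}"
  shows "digit_reader (3 ^ i * cantor_code a) = a i"
  using assms
proof (induction i arbitrary: a)
  case 0
  have b: "0 \<le> cantor_code (\<lambda>j. a (Suc j))" "cantor_code (\<lambda>j. a (Suc j)) \<le> 1"
    using cantor_code_bounds[of "\<lambda>j. a (Suc j)"] 0 by auto
  have "3 * cantor_code a = 2 * a 0 + cantor_code (\<lambda>j. a (Suc j))"
    by (rule cantor_code_shift[OF 0])
  then show ?case
    using b 0[of 0] digit_reader_0[of "cantor_code a"] digit_reader_1[of "cantor_code a"] by auto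
next
  case (Suc i)
  from Suc.prems[of 0] obtain k :: int where k: "a 0 = of_int k"
    by (metis empty_iff insert_iff of_int_0 of_int_1)
  have "3 ^ Suc i * cantor_code a = 3 ^ i * (3 * cantor_code a)" by simp
  also have "\<dots> = 2 * of_int (3 ^ i * k) + 3 ^ i * cantor_code (\<lambda>j. a (Suc j))"
    by (subst cantor_code_shift[OF Suc.prems]) (simp_all add: k algebra_simps)
  finally have "digit_reader (3 ^ Suc i * cantor_code a)
      = digit_reader (3 ^ i * cantor_code (\<lambda>j. a (Suc j)))"
    by (simp only: digit_reader_periodic)
  then show ?case using Suc.IH[of "\<lambda>j. a (Suc j)"] Suc.prems by simp
qed

text \<open>Coordinate \<open>k\<close> of the curve: the digits at the positions \<open>(k, m)\<close> are the binary digits of the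
  \<open>k\<close>-th coordinate.\<close>
definition schoenberg :: "nat \<Rightarrow> real \<Rightarrow> real" where
  "schoenberg k t = (\<Sum>m. digit_reader (3 ^ prod_encode (k, m) * t) / 2 ^ Suc m)"

lemma schoenberg_continuous: "continuous_on UNIV (schoenberg k)"
proof -
  have b: "norm (digit_reader (3 ^ prod_encode (k, m) * t) / 2 ^ Suc m) \<le> (1 / 2) ^ m" for m t
    using digit_reader_bounds[of "3 ^ prod_encode (k, m) * t"] by (simp add: power_divide field_simps)
  have "uniform_limit UNIV (\<lambda>n t. \<Sum>m<n. digit_reader (3 ^ prod_encode (k, m) * t) / 2 ^ Suc m)
      (\<lambda>t. \<Sum>m. digit_reader (3 ^ prod_encode (k, m) * t) / 2 ^ Suc m) sequentially"
    using b by (intro Weierstrass_m_test[where M = "\<lambda>m. (1 / 2) ^ m"]) (auto intro: summable_geometric)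
  then have "continuous_on UNIV (\<lambda>t. \<Sum>m. digit_reader (3 ^ prod_encode (k, m) * t) / 2 ^ Suc m)"
    by (rule uniform_limit_theorem[rotated])
      (auto intro!: always_eventually continuous_intros simp: digit_reader_def)
  then show ?thesis by (simp add: schoenberg_def[abs_def])
qed

lemma schoenberg_bounds: "0 \<le> schoenberg k t" "schoenberg k t \<le> 1"
proof -
  let ?c = "\<lambda>m. digit_reader (3 ^ prod_encode (k, m) * t) / 2 ^ Suc m"
  have c: "0 \<le> ?c m" "?c m \<le> (1 / 2) ^ Suc m" for m
    using digit_reader_bounds[of "3 ^ prod_encode (k, m) * t"] by (auto simp: power_divide field_simps)
  have s: "(\<lambda>m. (1 / 2 :: real) ^ Suc m) sums 1" by (rule power_half_series)
  have sc: "summable ?c"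
  proof (rule summable_comparison_test)
    have "norm (?c m) \<le> (1 / 2) ^ Suc m" for m
      using c(1)[of m] c(2)[of m] by (simp only: real_norm_def abs_of_nonneg)
    then show "\<exists>N. \<forall>n\<ge>N. norm (?c n) \<le> (1 / 2) ^ Suc n" by blast
  qed (use s in \<open>rule sums_summable\<close>)
  show "0 \<le> schoenberg k t"
    unfolding schoenberg_def using c sc by (intro suminf_nonneg)
  have "schoenberg k t \<le> (\<Sum>m. (1 / 2) ^ Suc m)"
    unfolding schoenberg_def using c sc s by (intro suminf_le) (auto simp: sums_iff)
  then show "schoenberg k t \<le> 1" using s by (simp add: sums_iff)
qed

definition squash :: "real \<Rightarrow> real" where
  "squash x = 1 / 2 + arctan x / pi"

definition unsquash :: "real \<Rightarrow> real" where
  "unsquash y = tan (pi * (y - 1 / 2))"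

lemma unsquash_squash: "unsquash (squash x) = x"
  by (simp add: unsquash_def squash_def tan_arctan)

lemma squash_bounds: "0 < squash x" "squash x < 1"
  using arctan_lbound[of x] arctan_ubound[of x] by (auto simp: squash_def field_simps)

lemma isCont_unsquash: "0 < y \<Longrightarrow> y < 1 \<Longrightarrow> isCont unsquash y"
proof -
  assume y: "0 < y" "y < 1"
  have "0 < cos (pi * (y - 1 / 2))"
    using y by (intro cos_gt_zero_pi) (auto simp: field_simps)
  then show ?thesis
    unfolding unsquash_def[abs_def] by (intro isCont_tan' continuous_intros) auto
qed

definition sequence_code :: "(nat \<Rightarrow> real) \<Rightarrow> real" where
  "sequence_code x = cantor_code (\<lambda>j. case prod_decode j of (k, m) \<Rightarrow> binary_digit (squash (x k)) m)"

definition sequence_coord :: "nat \<Rightarrow> real \<Rightarrow> real" where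
  "sequence_coord k t = unsquash (schoenberg k t)"

lemma sequence_code_digits: "(case prod_decode j of (k, m) \<Rightarrow> binary_digit (squash (x k)) m) \<in> {0, 1}"
  using binary_digit_01 by (auto split: prod.split)

lemma schoenberg_sequence_code: "schoenberg k (sequence_code x) = squash (x k)"
proof -
  have "schoenberg k (sequence_code x) = (\<Sum>m. binary_digit (squash (x k)) m / 2 ^ Suc m)"
    unfolding schoenberg_def sequence_code_def
    by (subst digit_reader_cantor_code[OF sequence_code_digits]) simp
  also have "\<dots> = squash (x k)"
    using binary_digit_sums[of "squash (x k)"] squash_bounds[of "x k"] by (simp add: sums_iff)
  finally show ?thesis .
qed

lemma sequence_coord_code: "sequence_coord k (sequence_code x) = x k"
  by (simp add: sequence_coord_def schoenberg_sequence_code unsquash_squash)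

lemma sequence_coord_measurable [measurable]: "sequence_coord k \<in> borel_measurable borel"
proof -
  have [measurable]: "schoenberg k \<in> borel_measurable borel"
    by (intro borel_measurable_continuous_onI schoenberg_continuous)
  show ?thesis
    unfolding sequence_coord_def[abs_def] unsquash_def tan_def by measurable
qed

lemma isCont_sequence_coord:
  assumes "0 < schoenberg k t" "schoenberg k t < 1"
  shows "isCont (sequence_coord k) t"
proof -
  have "isCont (schoenberg k) t"
    using schoenberg_continuous[of k] by (simp add: continuous_on_eq_continuous_at)
  then show ?thesis
    unfolding sequence_coord_def[abs_def]
    by (intro isCont_o2[where f = "schoenberg k" and g = unsquash]) (auto intro: isCont_unsquash assms)
qed

lemma tendsto_coordinatewise:
  fixes f :: "'b \<Rightarrow> 'i \<Rightarrow> 'c::topological_space"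
  assumes "\<And>i. ((\<lambda>s. f s i) \<longlongrightarrow> l i) F"
  shows "(f \<longlongrightarrow> l) F"
proof -
  have "limitin (product_topology (\<lambda>_. euclidean) UNIV) f l F"
    using assms by (auto simp: limitin_componentwise)
  then show ?thesis
    by (simp add: euclidean_product_topology)
qed

text \<open>Prokhorov's theorem for laws on the sequence space, for the full product topology.  The decoding
  \<open>Z\<close> is continuous at every point where all Schoenberg coordinates lie strictly between 0 and 1;
  tightness makes this happen almost surely under the limit, so the mapping theorem for almost everywhere
  continuous functions applies.\<close>
theorem tight_sequence_laws_subsequential_limit:
  fixes Y :: "nat \<Rightarrow> 'a \<Rightarrow> nat \<Rightarrow> real"
  assumes M: "prob_space M"
    and Y [measurable]: "\<And>n k. (\<lambda>\<omega>. Y n \<omega> k) \<in> borel_measurable M"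
    and tight: "\<And>k e. 0 < e \<Longrightarrow> \<exists>R. \<forall>\<^sub>F n in sequentially. measure M {\<omega> \<in> space M. R < \<bar>Y n \<omega> k\<bar>} \<le> e"
  obtains r Q where "strict_mono r" "prob_space Q" "sets Q = sets (borel :: (nat \<Rightarrow> real) measure)"
    "\<And>f :: (nat \<Rightarrow> real) \<Rightarrow> real. continuous_on UNIV f \<Longrightarrow> bounded (range f)
        \<Longrightarrow> (\<lambda>n. \<integral>\<omega>. f (Y (r n) \<omega>) \<partial>M) \<longlonglongrightarrow> (\<integral>x. f x \<partial>Q)"
proof -
  interpret M: prob_space M by fact
  define T where "T n \<omega> = sequence_code (Y n \<omega>)" for n \<omega>
  have T_meas [measurable]: "T n \<in> borel_measurable M" for n
    unfolding T_def[abs_def] sequence_code_def cantor_code_def squash_def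
    by (intro borel_measurable_suminf) (auto simp: split_beta)
  have T01: "0 \<le> T n \<omega>" "T n \<omega> \<le> 1" for n \<omega>
    unfolding T_def sequence_code_def by (intro cantor_code_bounds sequence_code_digits)+
  define \<mu> where "\<mu> n = distr M borel (T n)" for n
  have rd: "real_distribution (\<mu> n)" for n
    unfolding \<mu>_def by (intro M.real_distribution_distr) simp
  have "tight \<mu>"
    unfolding tight_def
  proof (intro conjI allI impI rd)
    fix e :: real assume "0 < e"
    have "measure (\<mu> n) {- 1<..1} = 1" for n
    proof -
      have "T n -` {- 1<..1} \<inter> space M = space M"
        using T01[of n] by (force intro: less_le_trans[OF less_minus_one_simps(1)])
      then show ?thesis unfolding \<mu>_def by (subst measure_distr) (auto simp: M.prob_space)
    qed
    then show "\<exists>a b. a < b \<and> (\<forall>n. 1 - e < measure (\<mu> n) {a<..b})"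
      using \<open>0 < e\<close> by (intro exI[of _ "- 1"] exI[of _ 1]) simp
  qed
  then obtain r N where r: "strict_mono r" and N: "real_distribution N" and "weak_conv_m (\<mu> \<circ> id \<circ> r) N"
    using tight_imp_convergent_subsubsequence[of \<mu> id] by (auto simp: strict_mono_def)
  then have weak: "weak_conv_m (\<lambda>n. \<mu> (r n)) N" by (simp add: comp_def)
  interpret N: real_distribution N by fact
  have sch [measurable]: "schoenberg k \<in> borel_measurable borel" for k
    by (intro borel_measurable_continuous_onI schoenberg_continuous)
  have end_null: "emeasure N {t. \<not> (0 < schoenberg k t \<and> schoenberg k t < 1)} = 0" for k
  proof -
    let ?A = "{t. \<not> (0 < schoenberg k t \<and> schoenberg k t < 1)}"
    have "measure N ?A \<le> e" if e: "0 < e" for e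
    proof -
      obtain R0 where R0: "\<forall>\<^sub>F n in sequentially. measure M {\<omega> \<in> space M. R0 < \<bar>Y n \<omega> k\<bar>} \<le> e"
        using tight[OF e] by blast
      define R where "R = max R0 0"
      define b where "b = arctan R / pi"
      have b: "0 \<le> b" "b < 1 / 2"
        using arctan_ubound[of R] by (auto simp: b_def R_def field_simps)
      \<comment> \<open>A continuous function on \<open>[0, 1]\<close> that is 1 at both endpoints and vanishes on the image of \<open>[-R, R]\<close>.\<close>
      define G where "G y = max 0 (min 1 ((\<bar>y - 1 / 2\<bar> - b) / (1 / 2 - b)))" for y
      have G_cont: "continuous_on UNIV (\<lambda>t. G (schoenberg k t))"
        unfolding G_def using b by (intro continuous_intros schoenberg_continuous) auto
      have G_meas [measurable]: "G \<in> borel_measurable borel" unfolding G_def[abs_def] by measurable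
      have lim: "(\<lambda>n. \<integral>t. G (schoenberg k t) \<partial>\<mu> (r n)) \<longlonglongrightarrow> (\<integral>t. G (schoenberg k t) \<partial>N)"
      proof (rule weak_conv_imp_integral_bdd_continuous_conv[where B = 1])
        show "isCont (\<lambda>t. G (schoenberg k t)) x" for x
          using G_cont by (simp add: continuous_on_eq_continuous_at)
      qed (use rd N weak in \<open>auto simp: G_def\<close>)
      have "\<forall>\<^sub>F n in sequentially. (\<integral>t. G (schoenberg k t) \<partial>\<mu> (r n)) \<le> e"
        using eventually_subseq[OF r R0]
      proof eventually_elim
        case (elim n)
        have "(\<integral>t. G (schoenberg k t) \<partial>\<mu> (r n)) = (\<integral>\<omega>. G (squash (Y (r n) \<omega> k)) \<partial>M)"
          unfolding \<mu>_def by (subst integral_distr) (auto simp: T_def schoenberg_sequence_code)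
        also have "\<dots> \<le> (\<integral>\<omega>. indicator {\<omega> \<in> space M. R0 < \<bar>Y (r n) \<omega> k\<bar>} \<omega> \<partial>M)"
        proof (rule integral_mono)
          have [measurable]: "squash \<in> borel_measurable borel" unfolding squash_def[abs_def] by measurable
          show "integrable M (\<lambda>\<omega>. G (squash (Y (r n) \<omega> k)))"
            by (rule M.integrable_const_bound[where B = 1]) (auto simp: G_def)
          show "integrable M (indicat_real {\<omega> \<in> space M. R0 < \<bar>Y (r n) \<omega> k\<bar>})"
            by (rule M.integrable_const_bound[where B = 1]) auto
          fix \<omega> assume \<omega>: "\<omega> \<in> space M"
          show "G (squash (Y (r n) \<omega> k)) \<le> indicat_real {\<omega> \<in> space M. R0 < \<bar>Y (r n) \<omega> k\<bar>} \<omega>"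
          proof (cases "R0 < \<bar>Y (r n) \<omega> k\<bar>")
            case False
            then have "\<bar>Y (r n) \<omega> k\<bar> \<le> R" by (simp add: R_def)
            then have "arctan (Y (r n) \<omega> k) \<le> arctan R" "arctan (- Y (r n) \<omega> k) \<le> arctan R"
              by (auto intro!: arctan_monotone')
            then have "\<bar>arctan (Y (r n) \<omega> k)\<bar> \<le> arctan R" by (simp add: arctan_minus)
            then have "\<bar>squash (Y (r n) \<omega> k) - 1 / 2\<bar> \<le> b"
              by (simp add: squash_def b_def abs_divide divide_right_mono)
            then show ?thesis using b by (simp add: G_def divide_nonpos_pos)
          qed (use \<omega> in \<open>simp add: G_def\<close>)
        qed
        also have "\<dots> \<le> e" using elim by simp
        finally show ?case .
      qed
      with lim have le: "(\<integral>t. G (schoenberg k t) \<partial>N) \<le> e"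
        by (intro tendsto_upperbound) auto
      have "measure N ?A = (\<integral>t. indicat_real ?A t \<partial>N)" by simp
      also have "\<dots> \<le> (\<integral>t. G (schoenberg k t) \<partial>N)"
      proof (rule integral_mono)
        show "integrable N (indicat_real ?A)"
          by (rule N.integrable_const_bound[where B = 1]) auto
        show "integrable N (\<lambda>t. G (schoenberg k t))"
          by (rule N.integrable_const_bound[where B = 1]) (auto simp: G_def)
        fix t
        have "G (schoenberg k t) = 1" if "t \<in> ?A"
        proof -
          have "schoenberg k t = 0 \<or> schoenberg k t = 1"
            using that schoenberg_bounds[of k t] by auto
          then show ?thesis using b by (auto simp: G_def)
        qed
        then show "indicat_real ?A t \<le> G (schoenberg k t)" by (auto simp: indicator_def G_def)
      qed
      finally show ?thesis using le by simp
    qed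
    then have "measure N ?A \<le> 0" by (rule field_le_epsilon) simp
    then show ?thesis by (simp add: N.emeasure_eq_measure antisym)
  qed
  define Z where "Z t k = sequence_coord k t" for t k
  have Z_meas [measurable]: "Z \<in> measurable borel borel"
    by (rule measurable_coordinatewise_then_product) (simp add: Z_def)
  define Q where "Q = distr N borel Z"
  show ?thesis
  proof (rule that[OF r, of Q])
    show "prob_space Q" unfolding Q_def by (rule N.prob_space_distr) simp
    show "sets Q = sets borel" by (simp add: Q_def)
    fix f :: "(nat \<Rightarrow> real) \<Rightarrow> real"
    assume f: "continuous_on UNIV f" and bdd: "bounded (range f)"
    then obtain B where B: "\<And>x. \<bar>f x\<bar> \<le> B" by (auto simp: bounded_iff)
    have f_meas [measurable]: "f \<in> borel_measurable borel" using f by (rule borel_measurable_continuous_onI)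
    have "(\<lambda>n. \<integral>t. f (Z t) \<partial>\<mu> (r n)) \<longlonglongrightarrow> (\<integral>t. f (Z t) \<partial>N)"
    proof (rule weak_conv_imp_bdd_ae_continuous_conv[where B = B])
      let ?E = "\<Union>k. {t. \<not> (0 < schoenberg k t \<and> schoenberg k t < 1)}"
      have "isCont (\<lambda>t. f (Z t)) t" if "t \<notin> ?E" for t
      proof -
        have "((\<lambda>s. Z s k) \<longlongrightarrow> Z t k) (at t)" for k
          using isCont_sequence_coord[of k t] that by (auto simp: Z_def isCont_def)
        then have "(Z \<longlongrightarrow> Z t) (at t)" by (rule tendsto_coordinatewise)
        then have "((\<lambda>s. f (Z s)) \<longlongrightarrow> f (Z t)) (at t)"
          by (rule continuous_on_tendsto_compose[OF f]) auto
        then show ?thesis by (simp add: isCont_def)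
      qed
      then have "{t. \<not> isCont (\<lambda>t. f (Z t)) t} \<subseteq> ?E" by blast
      then have "emeasure N {t. \<not> isCont (\<lambda>t. f (Z t)) t} \<le> emeasure N ?E"
        by (rule emeasure_mono) auto
      also have "emeasure N ?E = 0"
        using end_null by (intro emeasure_UN_eq_0) auto
      finally show "emeasure N {t. \<not> isCont (\<lambda>t. f (Z t)) t} = 0" by simp
    qed (use rd N weak B in auto)
    moreover have "(\<integral>t. f (Z t) \<partial>\<mu> (r n)) = (\<integral>\<omega>. f (Y (r n) \<omega>) \<partial>M)" for n
    proof -
      have "Z (T (r n) \<omega>) = Y (r n) \<omega>" for \<omega>
        by (rule ext) (simp add: Z_def T_def sequence_coord_code)
      then show ?thesis unfolding \<mu>_def by (subst integral_distr) auto
    qed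
    moreover have "(\<integral>t. f (Z t) \<partial>N) = (\<integral>x. f x \<partial>Q)"
      unfolding Q_def by (subst integral_distr) auto
    ultimately show "(\<lambda>n. \<integral>\<omega>. f (Y (r n) \<omega>) \<partial>M) \<longlonglongrightarrow> (\<integral>x. f x \<partial>Q)" by simp
  qed
qed

section \<open>Laws of sequences are determined by product moments\<close>

text \<open>Lipschitz approximations from above to the indicator of a lower half line.\<close>
definition ramp :: "nat \<Rightarrow> real \<Rightarrow> real \<Rightarrow> real" where
  "ramp m a t = max 0 (min 1 (1 - real (Suc m) * (t - a)))"

lemma ramp_scaled_bounded_lipschitz: "(\<lambda>t. ramp m a t / real (Suc m)) \<in> bounded_lipschitz"
proof -
  have "\<bar>ramp m a t / real (Suc m)\<bar> \<le> 1" for t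
    by (auto simp: ramp_def divide_simps)
  moreover have "\<bar>ramp m a s / real (Suc m) - ramp m a t / real (Suc m)\<bar> \<le> \<bar>s - t\<bar>" for s t
  proof -
    have "\<bar>ramp m a s - ramp m a t\<bar>
        \<le> \<bar>(1 - real (Suc m) * (s - a)) - (1 - real (Suc m) * (t - a))\<bar>"
      unfolding ramp_def by linarith
    also have "\<dots> = real (Suc m) * \<bar>s - t\<bar>"
    proof -
      have "(1 - real (Suc m) * (s - a)) - (1 - real (Suc m) * (t - a)) = real (Suc m) * (t - s)"
        by (simp add: algebra_simps)
      then show ?thesis by (simp only: abs_mult abs_of_nat abs_minus_commute[of t s])
    qed
    finally show ?thesis
      by (simp add: diff_divide_distrib[symmetric] abs_divide divide_le_eq mult.commute)
  qed
  ultimately show ?thesis by (auto simp: bounded_lipschitz_def)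
qed

lemma ramp_tendsto_indicator: "(\<lambda>m. ramp m a t) \<longlonglongrightarrow> indicat_real {..a} t"
proof (cases "t \<le> a")
  case True
  then have "ramp m a t = 1" for m
  proof -
    have "real (Suc m) * (t - a) \<le> 0" using True by (intro mult_nonneg_nonpos) auto
    then show ?thesis by (simp add: ramp_def)
  qed
  then show ?thesis using True by simp
next
  case False
  then obtain N where N: "1 / (t - a) < real N" using reals_Archimedean2 by blast
  have "ramp m a t = 0" if "N \<le> m" for m
  proof -
    have "1 / (t - a) \<le> real (Suc m)" using N that by linarith
    then have "1 \<le> real (Suc m) * (t - a)" using False by (simp only: pos_divide_le_eq)
    then show ?thesis by (simp add: ramp_def)
  qed
  then have "\<forall>\<^sub>F m in sequentially. ramp m a t = indicat_real {..a} t"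
    using False by (auto simp: eventually_sequentially)
  then show ?thesis by (rule tendsto_eventually)
qed

lemma coordinate_measurable [measurable]: "(\<lambda>x :: nat \<Rightarrow> real. x j) \<in> borel_measurable borel"
  by (intro borel_measurable_continuous_onI continuous_on_product_coordinates)

lemma sets_borel_sequences_eq_sigma_lower_orthants:
  "sets (borel :: (nat \<Rightarrow> real) measure) = sigma_sets UNIV {{x. \<forall>j<k. x j \<le> a j} | k (a :: nat \<Rightarrow> real). True}"
  (is "_ = sigma_sets UNIV ?E")
proof
  have "{x. \<forall>j<k. x j \<le> a j} \<in> sets borel" for k and a :: "nat \<Rightarrow> real"
    by measurable
  then have "?E \<subseteq> sets (borel :: (nat \<Rightarrow> real) measure)" by blast
  from sets.sigma_sets_subset[OF this]
  show "sigma_sets UNIV ?E \<subseteq> sets (borel :: (nat \<Rightarrow> real) measure)" by simp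
next
  let ?S = "sigma UNIV ?E"
  have sets_S: "sets ?S = sigma_sets UNIV ?E" by (rule sets_measure_of) simp
  have "(\<lambda>x. x i) \<in> borel_measurable ?S" for i
  proof (subst borel_measurable_iff_le, intro allI)
    fix c :: real
    have "{x \<in> space ?S. x i \<le> c} = (\<Union>m::nat. {x. \<forall>j<Suc i. x j \<le> (if j = i then c else real m)})"
    proof (intro set_eqI iffI)
      fix x :: "nat \<Rightarrow> real" assume x: "x \<in> {x \<in> space ?S. x i \<le> c}"
      obtain m where m: "Max (x ` {..i}) \<le> real m" using real_arch_simple by blast
      have "x j \<le> real m" if "j \<le> i" for j
      proof -
        have "x j \<le> Max (x ` {..i})" using that by (intro Max_ge) auto
        then show ?thesis using m by (rule order_trans)
      qed
      then have "x \<in> {x. \<forall>j<Suc i. x j \<le> (if j = i then c else real m)}"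
        using x by (simp add: less_Suc_eq_le)
      then show "x \<in> (\<Union>m::nat. {x. \<forall>j<Suc i. x j \<le> (if j = i then c else real m)})" by blast
    qed (auto simp: space_measure_of_conv)
    also have "\<dots> \<in> sets ?S"
      unfolding sets_S
    proof (intro sigma_sets.Union sigma_sets.Basic)
      fix m :: nat
      show "{x. \<forall>j<Suc i. x j \<le> (if j = i then c else real m)} \<in> ?E"
        by (intro CollectI exI[of _ "Suc i"] exI[of _ "\<lambda>j. if j = i then c else real m"]) simp
    qed
    finally show "{x \<in> space ?S. x i \<le> c} \<in> sets ?S" .
  qed
  then have "(\<lambda>x. x) \<in> measurable ?S (borel :: (nat \<Rightarrow> real) measure)"
    by (rule measurable_coordinatewise_then_product)
  then have "A \<in> sets ?S" if "A \<in> sets (borel :: (nat \<Rightarrow> real) measure)" for A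
    using measurable_sets[of "\<lambda>x. x" ?S borel A] that by (simp add: space_measure_of_conv)
  then show "sets (borel :: (nat \<Rightarrow> real) measure) \<subseteq> sigma_sets UNIV ?E"
    unfolding sets_S by blast
qed

text \<open>Scaled ramps are bounded Lipschitz functions, so product moments determine the measure of
  every finite-dimensional lower orthant, and these sets form an intersection-stable generator.\<close>
lemma sequence_law_eqI:
  fixes P Q :: "(nat \<Rightarrow> real) measure"
  assumes P: "prob_space P" "sets P = sets borel" and Q: "prob_space Q" "sets Q = sets borel"
    and eq: "\<And>k g. (\<And>j :: nat. g j \<in> bounded_lipschitz)
      \<Longrightarrow> (\<integral>x. (\<Prod>j<k. g j (x j)) \<partial>P) = (\<integral>x. (\<Prod>j<k. g j (x j)) \<partial>Q)"
  shows "P = Q"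
proof (rule measure_eqI_generator_eq)
  let ?E = "{{x. \<forall>j<k. x j \<le> a j} | k (a :: nat \<Rightarrow> real). True}"
  show "Int_stable ?E"
  proof (rule Int_stableI)
    fix A B assume "A \<in> ?E" "B \<in> ?E"
    then obtain k a l b where AB: "A = {x. \<forall>j<k. x j \<le> a j}" "B = {x. \<forall>j<l. x j \<le> b j}" by blast
    have "A \<inter> B = {x. \<forall>j<max k l. x j \<le> (if j < k then if j < l then min (a j) (b j) else a j else b j)}"
      (is "_ = ?C")
    proof (intro set_eqI iffI)
      fix x assume x: "x \<in> ?C"
      have "x j \<le> a j" if "j < k" for j
      proof -
        have "j < max k l" using that by simp
        then have "x j \<le> (if j < k then if j < l then min (a j) (b j) else a j else b j)" using x by blast
        then show ?thesis using that by (simp split: if_splits)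
      qed
      moreover have "x j \<le> b j" if "j < l" for j
      proof -
        have "j < max k l" using that by simp
        then have "x j \<le> (if j < k then if j < l then min (a j) (b j) else a j else b j)" using x by blast
        then show ?thesis using that by (simp split: if_splits)
      qed
      ultimately show "x \<in> A \<inter> B" by (simp add: AB)
    qed (simp add: AB less_max_iff_disj)
    then show "A \<inter> B \<in> ?E"
      by (intro CollectI exI[of _ "max k l"] exI) auto
  qed
  have lim: "(\<lambda>m. real (Suc m) ^ k * (\<integral>x. (\<Prod>j<k. ramp m (a j) (x j) / real (Suc m)) \<partial>R))
      \<longlonglongrightarrow> measure R {x. \<forall>j<k. x j \<le> a j}"
    if R: "prob_space R" "sets R = sets borel" for R k and a :: "nat \<Rightarrow> real"
  proof -
    interpret R: prob_space R by fact
    note [measurable_cong] = R(2)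
    have spR: "space R = UNIV" using sets_eq_imp_space_eq[OF R(2)] by simp
    have [measurable]: "(\<lambda>t. ramp m c t) \<in> borel_measurable borel" for m c
      unfolding ramp_def by measurable
    have "(\<lambda>m. \<integral>x. (\<Prod>j<k. ramp m (a j) (x j)) \<partial>R) \<longlonglongrightarrow> (\<integral>x. (\<Prod>j<k. indicat_real {..a j} (x j)) \<partial>R)"
    proof (rule integral_dominated_convergence[where w = "\<lambda>_. 1"])
      show "AE x in R. (\<lambda>m. \<Prod>j<k. ramp m (a j) (x j)) \<longlonglongrightarrow> (\<Prod>j<k. indicat_real {..a j} (x j))"
        by (intro AE_I2 tendsto_prod ramp_tendsto_indicator)
      show "AE x in R. norm (\<Prod>j<k. ramp m (a j) (x j)) \<le> 1" for m
        by (intro AE_I2) (auto simp: abs_prod ramp_def intro!: prod_le_1)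
    qed auto
    moreover have "real (Suc m) ^ k * (\<integral>x. (\<Prod>j<k. ramp m (a j) (x j) / real (Suc m)) \<partial>R)
        = (\<integral>x. (\<Prod>j<k. ramp m (a j) (x j)) \<partial>R)" for m
      by (subst integral_mult_right_zero[symmetric]) (simp add: prod_dividef)
    moreover have "(\<integral>x. (\<Prod>j<k. indicat_real {..a j} (x j)) \<partial>R) = measure R {x. \<forall>j<k. x j \<le> a j}"
    proof -
      have "(\<integral>x. (\<Prod>j<k. indicat_real {..a j} (x j)) \<partial>R) = (\<integral>x. indicat_real {x. \<forall>j<k. x j \<le> a j} x \<partial>R)"
      proof (rule Bochner_Integration.integral_cong[OF refl])
        fix x
        show "(\<Prod>j<k. indicat_real {..a j} (x j)) = indicat_real {x. \<forall>j<k. x j \<le> a j} x"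
          by (auto simp: indicator_def)
      qed
      then show ?thesis by (simp add: spR)
    qed
    ultimately show ?thesis by simp
  qed
  show "emeasure P A = emeasure Q A" if A: "A \<in> ?E" for A
  proof -
    obtain k a where A: "A = {x. \<forall>j<k. x j \<le> a j}" using A by blast
    have "measure P A = measure Q A"
      unfolding A
      using lim[OF P, of k a] lim[OF Q, of k a]
        eq[of "\<lambda>j t. ramp m (a j) t / real (Suc m)" k for m, OF ramp_scaled_bounded_lipschitz]
      by (auto intro: LIMSEQ_unique)
    then show ?thesis
      by (simp add: finite_measure.emeasure_eq_measure[OF prob_space.finite_measure[OF P(1)]]
          finite_measure.emeasure_eq_measure[OF prob_space.finite_measure[OF Q(1)]])
  qed
  show "sets P = sigma_sets UNIV ?E" "sets Q = sigma_sets UNIV ?E"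
    by (simp_all only: P(2) Q(2) sets_borel_sequences_eq_sigma_lower_orthants)
  show "range (\<lambda>_ :: nat. UNIV) \<subseteq> ?E" by (auto intro!: exI[of _ 0])
  show "emeasure P UNIV \<noteq> \<infinity>" for i :: nat
    by (simp add: finite_measure.emeasure_eq_measure[OF prob_space.finite_measure[OF P(1)]])
qed auto

section \<open>The predictive means of the kernel process\<close>

text \<open>The integral of \<open>g\<close> against \<open>\<alpha>\<^sub>n\<close>, written as an average over the past observations so that it makes sense
  for all functions at once.\<close>
definition predictive_mean ::
  "(real \<Rightarrow> real) \<Rightarrow> (nat \<Rightarrow> real) \<Rightarrow> (nat \<Rightarrow> 'a \<Rightarrow> real) \<Rightarrow> nat \<Rightarrow> (real \<Rightarrow> real) \<Rightarrow> 'a \<Rightarrow> real" where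
  "predictive_mean K h X n g \<omega> = (\<Sum>i=1..n. smooth K (h i) g (X i \<omega>)) / real n"

locale kernel_process = prob_space M for M :: "'a measure" +
  fixes X :: "nat \<Rightarrow> 'a \<Rightarrow> real" and K :: "real \<Rightarrow> real" and h :: "nat \<Rightarrow> real"
  assumes X_measurable: "\<And>n. 1 \<le> n \<Longrightarrow> X n \<in> borel_measurable M"
    and kernel: "is_kernel K"
    and predictive: "\<And>n A. 1 \<le> n \<Longrightarrow> A \<in> sets borel \<Longrightarrow>
      AE \<omega> in M. cond_probability M (obs_filtration M X n) (X (n + 1)) A \<omega>
        = predictive_mean K h X n (indicat_real A) \<omega>"
begin

abbreviation G :: "nat \<Rightarrow> 'a measure" where "G \<equiv> obs_filtration M X"
abbreviation pmean :: "nat \<Rightarrow> (real \<Rightarrow> real) \<Rightarrow> 'a \<Rightarrow> real" where "pmean \<equiv> predictive_mean K h X"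

lemma G_subalgebra: "subalgebra M (G n)"
  using X_measurable by (rule subalgebra_obs_filtration)

lemma G_sigma_finite: "sigma_finite_subalgebra M (G n)"
  by (intro finite_measure_subalgebra_is_sigma_finite finite_measure_subalgebra.intro
      finite_measure_subalgebra_axioms.intro G_subalgebra) unfold_locales

lemma space_G [simp]: "space (G n) = space M"
  using G_subalgebra by (simp add: subalgebra_def)

lemma G_measurable_M: "f \<in> measurable (G n) N \<Longrightarrow> f \<in> measurable M N"
  by (rule measurable_from_subalg[OF G_subalgebra])

lemma sets_G: "sets (G n) = sigma_sets (space M) {X i -` B \<inter> space M | i B. i \<in> {1..n} \<and> B \<in> sets borel}"
  unfolding obs_filtration_def by (rule sets_measure_of) auto

lemma G_mono: "n \<le> m \<Longrightarrow> f \<in> measurable (G n) N \<Longrightarrow> f \<in> measurable (G m) N"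
proof (rule measurable_from_subalg[rotated])
  assume "n \<le> m"
  then have "{1..n} \<subseteq> {1..m}" by simp
  then show "subalgebra (G m) (G n)"
    unfolding subalgebra_def sets_G space_G
    by (intro conjI refl sigma_sets_mono') blast
qed

lemma X_Suc_measurable [measurable]: "X (Suc n) \<in> borel_measurable M"
  by (rule X_measurable) simp

lemma X_measurable_G:
  assumes "1 \<le> i" "i \<le> n"
  shows "X i \<in> borel_measurable (G n)"
proof (rule measurableI)
  fix B :: "real set" assume "B \<in> sets borel"
  then show "X i -` B \<inter> space (G n) \<in> sets (G n)"
    unfolding sets_G space_G using assms by (intro sigma_sets.Basic) auto
qed simp

lemma smooth_X_measurable_G:
  assumes [measurable]: "g \<in> borel_measurable borel" and "1 \<le> i" "i \<le> n"
  shows "(\<lambda>\<omega>. smooth K b g (X i \<omega>)) \<in> borel_measurable (G n)"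
proof -
  note [measurable] = smooth_measurable[OF kernel] X_measurable_G[OF assms(2,3)]
  show ?thesis by measurable
qed

lemma pmean_measurable_G:
  assumes "g \<in> borel_measurable borel"
  shows "pmean n g \<in> borel_measurable (G n)"
  unfolding predictive_mean_def[abs_def]
  using smooth_X_measurable_G[OF assms] by (intro borel_measurable_divide borel_measurable_sum) auto

lemma pmean_measurable: "g \<in> borel_measurable borel \<Longrightarrow> pmean n g \<in> borel_measurable M"
  by (rule G_measurable_M[OF pmean_measurable_G])

lemma pmean_bound:
  assumes n: "1 \<le> n" and g: "g \<in> borel_measurable borel" "\<And>x. \<bar>g x\<bar> \<le> B"
  shows "\<bar>pmean n g \<omega>\<bar> \<le> B"
proof -
  have "\<bar>\<Sum>i=1..n. smooth K (h i) g (X i \<omega>)\<bar> \<le> (\<Sum>i=1..n. \<bar>smooth K (h i) g (X i \<omega>)\<bar>)"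
    by (rule sum_abs)
  also have "\<dots> \<le> (\<Sum>i=1..n. B)"
    by (intro sum_mono smooth_bound[OF kernel g])
  finally show ?thesis
    using n by (simp add: predictive_mean_def abs_divide divide_le_eq mult.commute)
qed

lemma pmean_lincomb:
  assumes "f \<in> borel_measurable borel" "\<And>x. \<bar>f x\<bar> \<le> B" "g \<in> borel_measurable borel" "\<And>x. \<bar>g x\<bar> \<le> B"
  shows "pmean n (\<lambda>x. a * f x + b * g x) \<omega> = a * pmean n f \<omega> + b * pmean n g \<omega>"
  unfolding predictive_mean_def smooth_lincomb[OF kernel assms]
  by (simp add: sum.distrib sum_distrib_left[symmetric] add_divide_distrib)

lemma pmean_const: "1 \<le> n \<Longrightarrow> pmean n (\<lambda>_. b) \<omega> = b"
  by (simp add: predictive_mean_def smooth_const[OF kernel])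

lemma pmean_Suc:
  "1 \<le> n \<Longrightarrow> pmean (n + 1) g \<omega> = (real n * pmean n g \<omega> + smooth K (h (n + 1)) g (X (n + 1) \<omega>)) / (real n + 1)"
  by (simp add: predictive_mean_def add.commute)

lemma integrable_bounded:
  assumes "f \<in> borel_measurable M" "\<And>\<omega>. \<omega> \<in> space M \<Longrightarrow> \<bar>f \<omega>\<bar> \<le> (B :: real)"
  shows "integrable M f"
  using assms by (intro integrable_const_bound[where B = B] AE_I2) auto

lemma abs_expectation_le:
  assumes "f \<in> borel_measurable M" "\<And>\<omega>. \<omega> \<in> space M \<Longrightarrow> \<bar>f \<omega>\<bar> \<le> (B :: real)"
  shows "\<bar>expectation f\<bar> \<le> B"
proof -
  have "\<bar>expectation f\<bar> \<le> (\<integral>\<omega>. \<bar>f \<omega>\<bar> \<partial>M)" by (rule integral_abs_bound)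
  also have "\<dots> \<le> (\<integral>\<omega>. B \<partial>M)"
    using integrable_bounded[OF assms] assms(2) by (intro integral_mono) auto
  finally show ?thesis by (simp add: prob_space)
qed

lemma integrable_mult_bounded:
  assumes "f \<in> borel_measurable M" "g \<in> borel_measurable M"
    "\<And>\<omega>. \<omega> \<in> space M \<Longrightarrow> \<bar>f \<omega>\<bar> \<le> (a :: real)" "\<And>\<omega>. \<omega> \<in> space M \<Longrightarrow> \<bar>g \<omega>\<bar> \<le> (b :: real)"
  shows "integrable M (\<lambda>\<omega>. f \<omega> * g \<omega>)"
proof (rule integrable_bounded[where B = "a * b"])
  show "\<bar>f \<omega> * g \<omega>\<bar> \<le> a * b" if "\<omega> \<in> space M" for \<omega>
    unfolding abs_mult using assms(3,4)[OF that] by (intro mult_mono) auto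
qed (use assms(1,2) in measurable)

text \<open>The hypothesis on the predictive distributions speaks about sets.  It extends to bounded
  functions by approximation with simple functions.  The statement with a past-measurable weight \<open>Y\<close> is the form in
  which conditional expectations are used below.\<close>
lemma predictive_expectation_nonneg:
  assumes n: "1 \<le> n" and Y: "Y \<in> borel_measurable (G n)" "\<And>\<omega>. \<bar>Y \<omega>\<bar> \<le> c"
    and g: "g \<in> borel_measurable borel" "\<And>x. 0 \<le> g x" "\<And>x. g x \<le> B"
  shows "(\<integral>\<omega>. Y \<omega> * g (X (n + 1) \<omega>) \<partial>M) = (\<integral>\<omega>. Y \<omega> * pmean n g \<omega> \<partial>M)"
proof -
  interpret G: sigma_finite_subalgebra M "G n" by (rule G_sigma_finite)
  have [measurable]: "Y \<in> borel_measurable M" using Y(1) by (rule G_measurable_M)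
  have "\<forall>B. (\<forall>x. g x \<le> B) \<longrightarrow> (\<integral>\<omega>. Y \<omega> * g (X (n + 1) \<omega>) \<partial>M) = (\<integral>\<omega>. Y \<omega> * pmean n g \<omega> \<partial>M)"
    using g(1,2)
  proof (induction g rule: borel_measurable_induct_real)
    case (set A)
    then have [measurable]: "A \<in> sets borel" by simp
    let ?I = "indicat_real (X (n + 1) -` A \<inter> space M)"
    have "(\<integral>\<omega>. Y \<omega> * indicator A (X (n + 1) \<omega>) \<partial>M) = (\<integral>\<omega>. Y \<omega> * ?I \<omega> \<partial>M)"
      by (intro Bochner_Integration.integral_cong) (auto simp: indicator_def)
    also have "\<dots> = (\<integral>\<omega>. Y \<omega> * real_cond_exp M (G n) ?I \<omega> \<partial>M)"
      using Y by (intro G.real_cond_exp_intg(2)[symmetric] integrable_mult_bounded[where a = c and b = 1]) auto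
    also have "\<dots> = (\<integral>\<omega>. Y \<omega> * pmean n (indicat_real A) \<omega> \<partial>M)"
    proof (rule integral_cong_AE)
      show "AE \<omega> in M. Y \<omega> * real_cond_exp M (G n) ?I \<omega> = Y \<omega> * pmean n (indicat_real A) \<omega>"
        using predictive[OF n, of A] unfolding cond_probability_def by auto
    qed (use pmean_measurable in \<open>auto intro: borel_measurable_cond_exp2\<close>)
    finally show ?case by simp
  next
    case (mult u c)
    show ?case
    proof (intro allI impI)
      fix B assume B: "\<forall>x. c * u x \<le> B"
      have "(\<integral>\<omega>. Y \<omega> * u (X (n + 1) \<omega>) \<partial>M) = (\<integral>\<omega>. Y \<omega> * pmean n u \<omega> \<partial>M)" if "c \<noteq> 0"
      proof -
        have "\<forall>x. u x \<le> B / c" using B that mult.hyps(1) by (simp add: field_simps)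
        then show ?thesis using mult.IH by blast
      qed
      moreover have "pmean n (\<lambda>x. c * u x) \<omega> = c * pmean n u \<omega>" for \<omega>
        by (simp add: predictive_mean_def smooth_def sum_distrib_left)
      ultimately show "(\<integral>\<omega>. Y \<omega> * (c * u (X (n + 1) \<omega>)) \<partial>M) = (\<integral>\<omega>. Y \<omega> * pmean n (\<lambda>x. c * u x) \<omega> \<partial>M)"
        by (cases "c = 0") (simp_all add: mult.left_commute[of _ c])
    qed
  next
    case (add u v)
    show ?case
    proof (intro allI impI)
      fix B assume B: "\<forall>x. v x + u x \<le> B"
      have uB: "\<bar>u x\<bar> \<le> B" and vB: "\<bar>v x\<bar> \<le> B" for x
        using B[rule_format, of x] add.hyps(2)[of x] add.hyps(4)[of x] by auto
      note [measurable] = add.hyps(1,3) pmean_measurable[OF add.hyps(1)] pmean_measurable[OF add.hyps(3)]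
      have int: "integrable M (\<lambda>\<omega>. Y \<omega> * w (X (n + 1) \<omega>))" "integrable M (\<lambda>\<omega>. Y \<omega> * pmean n w \<omega>)"
        if w: "w \<in> borel_measurable borel" "\<And>x. \<bar>w x\<bar> \<le> B" for w
        using Y w pmean_bound[OF n w] pmean_measurable[OF w(1)]
        by (auto intro!: integrable_mult_bounded[where a = c and b = B])
      have "pmean n (\<lambda>x. v x + u x) \<omega> = pmean n v \<omega> + pmean n u \<omega>" for \<omega>
        using pmean_lincomb[OF add.hyps(3) vB add.hyps(1) uB, of n 1 1] by simp
      moreover have "u x \<le> B" "v x \<le> B" for x using uB[of x] vB[of x] by (auto simp: abs_le_iff)
      note IH = add.IH(1)[rule_format, OF this(1)] add.IH(2)[rule_format, OF this(2)]
      ultimately show "(\<integral>\<omega>. Y \<omega> * (v (X (n + 1) \<omega>) + u (X (n + 1) \<omega>)) \<partial>M)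
          = (\<integral>\<omega>. Y \<omega> * pmean n (\<lambda>x. v x + u x) \<omega> \<partial>M)"
        using IH int[OF add.hyps(1) uB] int[OF add.hyps(3) vB] by (simp add: distrib_left)
    qed
  next
    case (seq U)
    show ?case
    proof (intro allI impI)
      fix B assume B: "\<forall>x. g x \<le> B"
      have le: "U i x \<le> g x" for i x
        using seq.hyps(3,4) by (intro incseq_le) (auto simp: incseq_def le_fun_def)
      have bd: "\<bar>U i x\<bar> \<le> B" for i x
        using le[of i x] B seq.hyps(2)[of i x] by (auto intro: order_trans)
      have gB: "\<bar>g x\<bar> \<le> B" for x using B g(2) by simp
      note [measurable] = seq.hyps(1) g(1) pmean_measurable[OF seq.hyps(1)] pmean_measurable[OF g(1)]
      have sm: "(\<lambda>i. smooth K b (U i) x) \<longlonglongrightarrow> smooth K b g x" for b x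
      proof -
        interpret L: prob_space "kernel_law K" using kernel by (rule prob_space_kernel_law)
        show ?thesis
          unfolding smooth_def using bd seq.hyps(4)
            integrable_kernel_law_bounded[OF kernel seq.hyps(1) bd] integrable_kernel_law_bounded[OF kernel g(1) gB]
          by (intro integral_dominated_convergence[where w = "\<lambda>_. B"]) auto
      qed
      have pm: "(\<lambda>i. pmean n (U i) \<omega>) \<longlonglongrightarrow> pmean n g \<omega>" for \<omega>
        unfolding predictive_mean_def using n by (intro tendsto_divide tendsto_sum sm) auto
      have cB: "0 \<le> c" using Y(2) abs_ge_zero order_trans by blast
      have "(\<lambda>i. \<integral>\<omega>. Y \<omega> * U i (X (n + 1) \<omega>) \<partial>M) \<longlonglongrightarrow> (\<integral>\<omega>. Y \<omega> * g (X (n + 1) \<omega>) \<partial>M)"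
        using seq.hyps(4) Y(2) bd cB
        by (intro integral_dominated_convergence[where w = "\<lambda>_. c * B"])
          (auto intro!: tendsto_intros mult_mono simp: abs_mult)
      moreover have "(\<lambda>i. \<integral>\<omega>. Y \<omega> * pmean n (U i) \<omega> \<partial>M) \<longlonglongrightarrow> (\<integral>\<omega>. Y \<omega> * pmean n g \<omega> \<partial>M)"
        using Y(2) pmean_bound[OF n seq.hyps(1) bd] cB
        by (intro integral_dominated_convergence[where w = "\<lambda>_. c * B"])
          (auto intro!: tendsto_intros pm mult_mono simp: abs_mult)
      moreover have "(\<integral>\<omega>. Y \<omega> * U i (X (n + 1) \<omega>) \<partial>M) = (\<integral>\<omega>. Y \<omega> * pmean n (U i) \<omega> \<partial>M)" for i
        using seq.IH[of i] bd[of i] by (auto simp: abs_le_iff)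
      ultimately show "(\<integral>\<omega>. Y \<omega> * g (X (n + 1) \<omega>) \<partial>M) = (\<integral>\<omega>. Y \<omega> * pmean n g \<omega> \<partial>M)"
        by (simp add: LIMSEQ_unique)
    qed
  qed
  then show ?thesis using g(3) by blast
qed

lemma predictive_expectation:
  assumes n: "1 \<le> n" and Y: "Y \<in> borel_measurable (G n)" "\<And>\<omega>. \<bar>Y \<omega>\<bar> \<le> c"
    and g: "g \<in> borel_measurable borel" "\<And>x. \<bar>g x\<bar> \<le> B"
  shows "(\<integral>\<omega>. Y \<omega> * g (X (n + 1) \<omega>) \<partial>M) = (\<integral>\<omega>. Y \<omega> * pmean n g \<omega> \<partial>M)"
proof -
  have Y_M [measurable]: "Y \<in> borel_measurable M" using Y(1) by (rule G_measurable_M)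
  note [measurable] = g(1) pmean_measurable[OF g(1)]
  have gB: "- B \<le> g x" "g x \<le> B" for x using g(2)[of x] by auto
  have B: "0 \<le> B" using gB[of 0] by linarith
  have int: "integrable M (\<lambda>\<omega>. Y \<omega> * g (X (n + 1) \<omega>))" "integrable M (\<lambda>\<omega>. Y \<omega> * pmean n g \<omega>)"
    using Y g pmean_bound[OF n g] by (auto intro!: integrable_mult_bounded[where a = c and b = B])
  have intY: "integrable M (\<lambda>\<omega>. Y \<omega> * B)" using Y B by (intro integrable_mult_bounded[where a = c and b = B]) auto
  have "(\<integral>\<omega>. Y \<omega> * (g (X (n + 1) \<omega>) + B) \<partial>M) = (\<integral>\<omega>. Y \<omega> * pmean n (\<lambda>x. g x + B) \<omega> \<partial>M)"
  proof (rule predictive_expectation_nonneg[OF n Y])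
    show "0 \<le> g x + B" "g x + B \<le> 2 * B" for x using gB[of x] by linarith+
  qed simp_all
  moreover have "pmean n (\<lambda>x. g x + B) \<omega> = pmean n g \<omega> + B" for \<omega>
    using pmean_lincomb[OF g, of "\<lambda>_. B" n 1 1] B pmean_const[OF n] by simp
  ultimately show ?thesis using int intY by (simp add: distrib_left)
qed

text \<open>The kernel added at time \<open>n + 1\<close> carries the fraction \<open>1 / (n + 1)\<close> of the mass and is centred at a point
  drawn from \<open>\<alpha>\<^sub>n\<close>, so on average it contributes the predictive mean of the smoothed function.\<close>
lemma cond_exp_pmean_Suc:
  assumes n: "1 \<le> n" and g: "g \<in> borel_measurable borel" "\<And>x. \<bar>g x\<bar> \<le> B"
  shows "AE \<omega> in M. real_cond_exp M (G n) (pmean (n + 1) g) \<omega>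
           = (real n * pmean n g \<omega> + pmean n (smooth K (h (n + 1)) g) \<omega>) / (real n + 1)"
proof -
  interpret G: sigma_finite_subalgebra M "G n" by (rule G_sigma_finite)
  let ?s = "smooth K (h (n + 1)) g"
  have s: "?s \<in> borel_measurable borel" "\<And>x. \<bar>?s x\<bar> \<le> B"
    using smooth_measurable[OF kernel g(1)] smooth_bound[OF kernel g] by auto
  note [measurable] = s(1)[simplified] pmean_measurable[OF g(1)] pmean_measurable[OF s(1), simplified]
  show ?thesis
  proof (rule G.real_cond_exp_charact)
    fix A assume A: "A \<in> sets (G n)"
    then have [measurable]: "A \<in> sets M" using G_subalgebra by (auto simp: subalgebra_def)
    have i: "integrable M (\<lambda>\<omega>. indicat_real A \<omega> * pmean n g \<omega>)"
      "integrable M (\<lambda>\<omega>. indicat_real A \<omega> * ?s (X (n + 1) \<omega>))"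
      "integrable M (\<lambda>\<omega>. indicat_real A \<omega> * pmean n ?s \<omega>)"
      using s(2) pmean_bound[OF n g] pmean_bound[OF n s]
      by (auto intro!: integrable_mult_bounded[where a = 1 and b = B])
    have "(\<integral>\<omega>\<in>A. pmean (n + 1) g \<omega> \<partial>M)
        = (\<integral>\<omega>. (real n * (indicat_real A \<omega> * pmean n g \<omega>) + indicat_real A \<omega> * ?s (X (n + 1) \<omega>)) / (real n + 1) \<partial>M)"
      unfolding set_lebesgue_integral_def
      by (intro Bochner_Integration.integral_cong refl) (simp add: pmean_Suc[OF n, simplified] algebra_simps)
    also have "\<dots> = (real n * (\<integral>\<omega>. indicat_real A \<omega> * pmean n g \<omega> \<partial>M)
        + (\<integral>\<omega>. indicat_real A \<omega> * ?s (X (n + 1) \<omega>) \<partial>M)) / (real n + 1)"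
      using i by simp
    also have "(\<integral>\<omega>. indicat_real A \<omega> * ?s (X (n + 1) \<omega>) \<partial>M) = (\<integral>\<omega>. indicat_real A \<omega> * pmean n ?s \<omega> \<partial>M)"
      using A by (intro predictive_expectation[OF n _ _ s, where c = 1]) auto
    also have "(real n * (\<integral>\<omega>. indicat_real A \<omega> * pmean n g \<omega> \<partial>M)
        + (\<integral>\<omega>. indicat_real A \<omega> * pmean n ?s \<omega> \<partial>M)) / (real n + 1)
        = (\<integral>\<omega>. (real n * (indicat_real A \<omega> * pmean n g \<omega>) + indicat_real A \<omega> * pmean n ?s \<omega>) / (real n + 1) \<partial>M)"
      using i by simp
    also have "\<dots> = (\<integral>\<omega>\<in>A. (real n * pmean n g \<omega> + pmean n ?s \<omega>) / (real n + 1) \<partial>M)"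
      unfolding set_lebesgue_integral_def
      by (intro Bochner_Integration.integral_cong refl) (simp add: algebra_simps)
    finally show "(\<integral>\<omega>\<in>A. pmean (n + 1) g \<omega> \<partial>M)
        = (\<integral>\<omega>\<in>A. (real n * pmean n g \<omega> + pmean n ?s \<omega>) / (real n + 1) \<partial>M)" .
  next
    show "integrable M (pmean (n + 1) g)"
      by (rule integrable_bounded[OF pmean_measurable[OF g(1)] pmean_bound[OF _ g]]) simp
    have "integrable M (pmean n g)" "integrable M (pmean n ?s)"
      using integrable_bounded[OF pmean_measurable[OF g(1)] pmean_bound[OF n g]]
        integrable_bounded[OF pmean_measurable[OF s(1)] pmean_bound[OF n s]] by auto
    then show "integrable M (\<lambda>\<omega>. (real n * pmean n g \<omega> + pmean n ?s \<omega>) / (real n + 1))" by simp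
    note [measurable] = pmean_measurable_G[OF g(1), of n] pmean_measurable_G[OF s(1), of n]
    show "(\<lambda>\<omega>. (real n * pmean n g \<omega> + pmean n ?s \<omega>) / (real n + 1)) \<in> borel_measurable (G n)"
      by measurable
  qed
qed

text \<open>Passing from \<open>\<alpha>\<^sub>n\<close> to \<open>\<alpha>\<^sub>n\<^sub>+\<^sub>1\<close> replaces a fraction \<open>1 / (n + 1)\<close> of the mass, whatever the observations
  are.\<close>
lemma pmean_increment:
  assumes n: "1 \<le> n" and g: "g \<in> borel_measurable borel" "\<And>x. \<bar>g x\<bar> \<le> 1"
  shows "\<bar>pmean (n + 1) g \<omega> - pmean n g \<omega>\<bar> \<le> 2 / (real n + 1)"
proof -
  have "pmean (n + 1) g \<omega> - pmean n g \<omega> = (smooth K (h (n + 1)) g (X (n + 1) \<omega>) - pmean n g \<omega>) / (real n + 1)"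
    unfolding pmean_Suc[OF n] by (simp add: field_simps)
  moreover have "\<bar>smooth K (h (n + 1)) g (X (n + 1) \<omega>) - pmean n g \<omega>\<bar> \<le> 2"
    using smooth_bound[OF kernel g, of "h (n + 1)" "X (n + 1) \<omega>"] pmean_bound[OF n g, of \<omega>] by linarith
  ultimately show ?thesis by (simp add: abs_divide divide_right_mono)
qed

lemma pmean_shift:
  assumes n: "1 \<le> n" and g: "g \<in> borel_measurable borel" "\<And>x. \<bar>g x\<bar> \<le> 1"
  shows "\<bar>pmean (n + k) g \<omega> - pmean n g \<omega>\<bar> \<le> 2 * real k / (real n + 1)"
proof (induction k)
  case (Suc k)
  have "\<bar>pmean (n + k + 1) g \<omega> - pmean (n + k) g \<omega>\<bar> \<le> 2 / (real (n + k) + 1)"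
    using n by (intro pmean_increment g) simp
  also have "\<dots> \<le> 2 / (real n + 1)" by (intro divide_left_mono) auto
  finally have "\<bar>pmean (n + Suc k) g \<omega> - pmean n g \<omega>\<bar> \<le> 2 / (real n + 1) + 2 * real k / (real n + 1)"
    using Suc by simp
  also have "\<dots> = 2 * real (Suc k) / (real n + 1)" by (simp add: add_divide_distrib[symmetric])
  finally show ?case .
qed simp

text \<open>Given the past at time \<open>n\<close>, the next \<open>k\<close> observations are nearly independent with law \<open>\<alpha>\<^sub>n\<close>: each of
  them has the predictive law of a slightly later time, and that law is within \<open>O(k / n)\<close> of \<open>\<alpha>\<^sub>n\<close>.  The
  induction removes the last observation and moves its predictive mean at time \<open>n\<close> into the weight \<open>Q\<close>.\<close>
lemma product_expectation_approx:
  assumes n: "1 \<le> n" and g: "\<And>j. g j \<in> borel_measurable borel" "\<And>j x. \<bar>g j x\<bar> \<le> 1"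
    and Q: "Q \<in> borel_measurable (G n)" "\<And>\<omega>. \<bar>Q \<omega>\<bar> \<le> 1"
  shows "\<bar>(\<integral>\<omega>. Q \<omega> * (\<Prod>j<k. g j (X (n + 1 + j) \<omega>)) \<partial>M) - (\<integral>\<omega>. Q \<omega> * (\<Prod>j<k. pmean n (g j) \<omega>) \<partial>M)\<bar>
    \<le> 2 * (real k)\<^sup>2 / (real n + 1)"
  using Q
proof (induction k arbitrary: Q)
  case (Suc k)
  have Xm [measurable]: "X (n + 1 + j) \<in> borel_measurable M" for j by (rule X_measurable) simp
  note [measurable] = g(1) pmean_measurable[OF g(1)] G_measurable_M[OF Suc.prems(1)]
  define Y where "Y \<omega> = Q \<omega> * (\<Prod>j<k. g j (X (n + 1 + j) \<omega>))" for \<omega>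
  define Q' where "Q' \<omega> = Q \<omega> * pmean n (g k) \<omega>" for \<omega>
  have Yb: "\<bar>Y \<omega>\<bar> \<le> 1" for \<omega>
    unfolding Y_def abs_mult abs_prod using Suc.prems(2) g(2) by (intro mult_le_one prod_le_1 prod_nonneg) auto
  have Y_G: "Y \<in> borel_measurable (G (n + k))"
    unfolding Y_def
  proof (intro borel_measurable_times borel_measurable_prod)
    show "Q \<in> borel_measurable (G (n + k))" by (rule G_mono[OF _ Suc.prems(1)]) simp
    show "(\<lambda>\<omega>. g j (X (n + 1 + j) \<omega>)) \<in> borel_measurable (G (n + k))" if "j \<in> {..<k}" for j
      using that by (intro measurable_compose[OF X_measurable_G g(1)]) auto
  qed
  have [measurable]: "Y \<in> borel_measurable M" using Y_G by (rule G_measurable_M)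
  have nk: "1 \<le> n + k" using n by simp
  have "(\<integral>\<omega>. Q \<omega> * (\<Prod>j<Suc k. g j (X (n + 1 + j) \<omega>)) \<partial>M) = (\<integral>\<omega>. Y \<omega> * g k (X (n + k + 1) \<omega>) \<partial>M)"
    by (simp add: Y_def ac_simps)
  also have "\<dots> = (\<integral>\<omega>. Y \<omega> * pmean (n + k) (g k) \<omega> \<partial>M)"
    by (rule predictive_expectation[OF nk Y_G Yb g])
  finally have 1: "(\<integral>\<omega>. Q \<omega> * (\<Prod>j<Suc k. g j (X (n + 1 + j) \<omega>)) \<partial>M) = (\<integral>\<omega>. Y \<omega> * pmean (n + k) (g k) \<omega> \<partial>M)" .
  have i: "integrable M (\<lambda>\<omega>. Y \<omega> * pmean m (g k) \<omega>)" if "1 \<le> m" for m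
    using Yb pmean_bound[OF that g] by (intro integrable_mult_bounded[where a = 1 and b = 1]) auto
  have "\<bar>(\<integral>\<omega>. Y \<omega> * pmean (n + k) (g k) \<omega> \<partial>M) - (\<integral>\<omega>. Y \<omega> * pmean n (g k) \<omega> \<partial>M)\<bar>
      = \<bar>\<integral>\<omega>. Y \<omega> * (pmean (n + k) (g k) \<omega> - pmean n (g k) \<omega>) \<partial>M\<bar>"
    using i[OF n] i[OF nk] by (simp add: right_diff_distrib)
  also have "\<dots> \<le> 1 * (2 * real k / (real n + 1))"
  proof (rule abs_expectation_le)
    show "\<bar>Y \<omega> * (pmean (n + k) (g k) \<omega> - pmean n (g k) \<omega>)\<bar> \<le> 1 * (2 * real k / (real n + 1))" for \<omega>
      unfolding abs_mult using Yb[of \<omega>] pmean_shift[OF n g, of k k \<omega>] by (intro mult_mono) auto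
  qed measurable
  finally have 2: "\<bar>(\<integral>\<omega>. Y \<omega> * pmean (n + k) (g k) \<omega> \<partial>M) - (\<integral>\<omega>. Y \<omega> * pmean n (g k) \<omega> \<partial>M)\<bar>
      \<le> 2 * real k / (real n + 1)" by simp
  have Q': "Q' \<in> borel_measurable (G n)" "\<bar>Q' \<omega>\<bar> \<le> 1" for \<omega>
  proof -
    show "Q' \<in> borel_measurable (G n)"
      unfolding Q'_def using Suc.prems(1) pmean_measurable_G[OF g(1)] by (intro borel_measurable_times)
    show "\<bar>Q' \<omega>\<bar> \<le> 1"
      unfolding Q'_def abs_mult using Suc.prems(2) pmean_bound[OF n g] by (intro mult_le_one) auto
  qed
  have 3: "\<bar>(\<integral>\<omega>. Q' \<omega> * (\<Prod>j<k. g j (X (n + 1 + j) \<omega>)) \<partial>M) - (\<integral>\<omega>. Q' \<omega> * (\<Prod>j<k. pmean n (g j) \<omega>) \<partial>M)\<bar>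
    \<le> 2 * (real k)\<^sup>2 / (real n + 1)"
    by (rule Suc.IH[OF Q'])
  have e1: "(\<integral>\<omega>. Q' \<omega> * (\<Prod>j<k. g j (X (n + 1 + j) \<omega>)) \<partial>M) = (\<integral>\<omega>. Y \<omega> * pmean n (g k) \<omega> \<partial>M)"
    by (simp add: Y_def Q'_def ac_simps)
  have e2: "(\<integral>\<omega>. Q' \<omega> * (\<Prod>j<k. pmean n (g j) \<omega>) \<partial>M) = (\<integral>\<omega>. Q \<omega> * (\<Prod>j<Suc k. pmean n (g j) \<omega>) \<partial>M)"
    by (simp add: Q'_def ac_simps)
  have "2 * real k / (real n + 1) + 2 * (real k)\<^sup>2 / (real n + 1) \<le> 2 * (real (Suc k))\<^sup>2 / (real n + 1)"
    unfolding add_divide_distrib[symmetric]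
    by (rule divide_right_mono) (auto simp: power2_eq_square algebra_simps)
  then show ?case using 1 2 3 unfolding e1 e2 by linarith
qed simp

end

section \<open>Convergence of the predictive means\<close>

lemma bounded_lipschitz_const: "\<bar>c\<bar> \<le> 1 \<Longrightarrow> (\<lambda>_. c) \<in> bounded_lipschitz"
  by (simp add: bounded_lipschitz_def)

text \<open>A bounded Lipschitz function that detects mass beyond \<open>R + 1\<close>, used for tightness.\<close>
definition tail_test :: "real \<Rightarrow> real \<Rightarrow> real" where
  "tail_test R x = max 0 (min 1 (\<bar>x\<bar> - R))"

lemma tail_test_bounded_lipschitz: "tail_test R \<in> bounded_lipschitz"
proof -
  have "\<bar>tail_test R x\<bar> \<le> 1" "\<bar>tail_test R x - tail_test R y\<bar> \<le> \<bar>x - y\<bar>" for x y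
    unfolding tail_test_def by linarith+
  then show ?thesis by (simp add: bounded_lipschitz_def)
qed

text \<open>The only quantitative input to the limit theorem: smoothing at the next bandwidth changes bounded
  Lipschitz functions by a deterministic amount that is summable after division by \<open>n + 1\<close>.\<close>
locale kernel_process_drift = kernel_process +
  fixes b :: "nat \<Rightarrow> real"
  assumes b_summable: "summable b"
    and smooth_drift: "\<And>n g c. 1 \<le> n \<Longrightarrow> g \<in> bounded_lipschitz
      \<Longrightarrow> \<bar>smooth K (h (n + 1)) g c - g c\<bar> / (real n + 1) \<le> b n"
begin

text \<open>The Doob decomposition of the increments of the predictive mean into a martingale difference and
  a predictable part.\<close>
definition innovation :: "(real \<Rightarrow> real) \<Rightarrow> nat \<Rightarrow> 'a \<Rightarrow> real" where
  "innovation g j \<omega> = (smooth K (h (j + 1)) g (X (j + 1) \<omega>) - pmean j (smooth K (h (j + 1)) g) \<omega>) / (real j + 1)"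

definition drift :: "(real \<Rightarrow> real) \<Rightarrow> nat \<Rightarrow> 'a \<Rightarrow> real" where
  "drift g j \<omega> = (pmean j (smooth K (h (j + 1)) g) \<omega> - pmean j g \<omega>) / (real j + 1)"

lemma pmean_Suc_decomp:
  "1 \<le> j \<Longrightarrow> pmean (Suc j) g \<omega> = pmean j g \<omega> + (innovation g j \<omega> + drift g j \<omega>)"
proof -
  assume j: "1 \<le> j"
  have "innovation g j \<omega> + drift g j \<omega> = (smooth K (h (j + 1)) g (X (j + 1) \<omega>) - pmean j g \<omega>) / (real j + 1)"
    by (simp add: innovation_def drift_def add_divide_distrib[symmetric])
  moreover have "(real j * p + s) / (real j + 1) = p + (s - p) / (real j + 1)" for p s
    by (simp add: field_simps)
  ultimately show ?thesis using pmean_Suc[OF j, of g \<omega>] by simp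
qed

lemma pmean_telescope:
  assumes "1 \<le> n" "n \<le> m"
  shows "pmean m g \<omega> - pmean n g \<omega> = (\<Sum>j=n..<m. innovation g j \<omega>) + (\<Sum>j=n..<m. drift g j \<omega>)"
  using assms(2,1)
proof (induction m rule: dec_induct)
  case (step m)
  then show ?case by (simp add: pmean_Suc_decomp)
qed simp

context
  fixes g :: "real \<Rightarrow> real"
  assumes g: "g \<in> bounded_lipschitz"
begin

lemma g_meas: "g \<in> borel_measurable borel" and g_bound: "\<bar>g x\<bar> \<le> 1"
  using g by (rule bounded_lipschitz_measurable, rule bounded_lipschitz_bound)

lemma smooth_g_meas: "smooth K (h (j + 1)) g \<in> borel_measurable borel"
  and smooth_g_bound: "\<bar>smooth K (h (j + 1)) g x\<bar> \<le> 1"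
  using smooth_measurable[OF kernel g_meas] smooth_bound[OF kernel g_meas g_bound] by auto

lemma innovation_measurable_G: "innovation g j \<in> borel_measurable (G (j + 1))"
proof -
  have [measurable]: "X (j + 1) \<in> borel_measurable (G (j + 1))" by (rule X_measurable_G) auto
  have [measurable]: "pmean j (smooth K (h (j + 1)) g) \<in> borel_measurable (G (j + 1))"
    by (rule G_mono[OF _ pmean_measurable_G[OF smooth_g_meas]]) simp
  note [measurable] = smooth_g_meas
  show ?thesis unfolding innovation_def by measurable
qed

lemma innovation_measurable: "innovation g j \<in> borel_measurable M"
  by (rule G_measurable_M[OF innovation_measurable_G])

lemma innovation_bound: "1 \<le> j \<Longrightarrow> \<bar>innovation g j \<omega>\<bar> \<le> 2 / (real j + 1)"
proof -
  assume j: "1 \<le> j"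
  have "\<bar>smooth K (h (j + 1)) g (X (j + 1) \<omega>) - pmean j (smooth K (h (j + 1)) g) \<omega>\<bar> \<le> 2"
    using smooth_g_bound[of j "X (j + 1) \<omega>"] pmean_bound[OF j smooth_g_meas smooth_g_bound, of j \<omega>] by linarith
  then show ?thesis unfolding innovation_def by (simp add: abs_divide divide_right_mono)
qed

lemma drift_measurable: "drift g j \<in> borel_measurable M"
  unfolding drift_def
  using pmean_measurable[OF smooth_g_meas] pmean_measurable[OF g_meas] by measurable

lemma drift_bound:
  assumes j: "1 \<le> j"
  shows "\<bar>drift g j \<omega>\<bar> \<le> b j"
proof -
  let ?d = "\<lambda>x. 1 * smooth K (h (j + 1)) g x + (- 1) * g x"
  have "pmean j ?d \<omega> = pmean j (smooth K (h (j + 1)) g) \<omega> - pmean j g \<omega>"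
    by (subst pmean_lincomb[OF smooth_g_meas smooth_g_bound g_meas g_bound]) simp
  moreover have "\<bar>pmean j ?d \<omega>\<bar> \<le> b j * (real j + 1)"
  proof (rule pmean_bound[OF j])
    show "?d \<in> borel_measurable borel"
      using smooth_g_meas g_meas by measurable
    show "\<bar>?d x\<bar> \<le> b j * (real j + 1)" for x
      using smooth_drift[OF j g, of x] by (simp add: divide_le_eq)
  qed
  ultimately show ?thesis
    unfolding drift_def by (simp add: abs_divide divide_le_eq)
qed

lemma innovation_orthogonal:
  assumes j: "1 \<le> j" and Y: "Y \<in> borel_measurable (G j)" "\<And>\<omega>. \<bar>Y \<omega>\<bar> \<le> c"
  shows "(\<integral>\<omega>. Y \<omega> * innovation g j \<omega> \<partial>M) = 0"
proof -
  let ?s = "smooth K (h (j + 1)) g"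
  note [measurable] = G_measurable_M[OF Y(1)] smooth_g_meas[of j, simplified]
    pmean_measurable[OF smooth_g_meas, of j j, simplified]
  have i: "integrable M (\<lambda>\<omega>. Y \<omega> * ?s (X (j + 1) \<omega>))" "integrable M (\<lambda>\<omega>. Y \<omega> * pmean j ?s \<omega>)"
    using Y smooth_g_bound[of j] pmean_bound[OF j smooth_g_meas smooth_g_bound, of j]
    by (auto intro!: integrable_mult_bounded[where a = c and b = 1])
  have "(\<integral>\<omega>. Y \<omega> * innovation g j \<omega> \<partial>M)
      = (\<integral>\<omega>. (Y \<omega> * ?s (X (j + 1) \<omega>) - Y \<omega> * pmean j ?s \<omega>) / (real j + 1) \<partial>M)"
    unfolding innovation_def by (simp add: algebra_simps)
  also have "\<dots> = ((\<integral>\<omega>. Y \<omega> * ?s (X (j + 1) \<omega>) \<partial>M) - (\<integral>\<omega>. Y \<omega> * pmean j ?s \<omega> \<partial>M)) / (real j + 1)"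
    using i by simp
  also have "\<dots> = 0"
    using predictive_expectation[OF j Y smooth_g_meas smooth_g_bound] by simp
  finally show ?thesis .
qed

text \<open>Martingale differences are orthogonal, and each of them is bounded by \<open>2 / (j + 1)\<close>.\<close>
lemma innovation_sum_second_moment:
  assumes "1 \<le> n" "n \<le> m"
  shows "(\<integral>\<omega>. (\<Sum>j=n..<m. innovation g j \<omega>)\<^sup>2 \<partial>M) \<le> (\<Sum>j=n..<m. 4 / (real j + 1)\<^sup>2)"
  using assms(2,1)
proof (induction m rule: dec_induct)
  case (step m)
  have m: "1 \<le> m" using step by simp
  define T where "T \<omega> = (\<Sum>j=n..<m. innovation g j \<omega>)" for \<omega>
  define c where "c = (\<Sum>j=n..<m. 2 / (real j + 1))"
  have T_G: "T \<in> borel_measurable (G m)"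
    unfolding T_def
    by (intro borel_measurable_sum G_mono[OF _ innovation_measurable_G]) auto
  note [measurable] = G_measurable_M[OF T_G] innovation_measurable
  have Tb: "\<bar>T \<omega>\<bar> \<le> c" for \<omega>
    unfolding T_def c_def using step by (intro order_trans[OF sum_abs] sum_mono innovation_bound) auto
  have i: "integrable M (\<lambda>\<omega>. T \<omega> * T \<omega>)" "integrable M (\<lambda>\<omega>. T \<omega> * innovation g m \<omega>)"
    "integrable M (\<lambda>\<omega>. innovation g m \<omega> * innovation g m \<omega>)"
    using Tb innovation_bound[OF m]
      integrable_mult_bounded[of T T c c] integrable_mult_bounded[of T "innovation g m" c "2 / (real m + 1)"]
      integrable_mult_bounded[of "innovation g m" "innovation g m" "2 / (real m + 1)" "2 / (real m + 1)"]
    by auto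
  have "(\<integral>\<omega>. innovation g m \<omega> * innovation g m \<omega> \<partial>M) \<le> 4 / (real m + 1)\<^sup>2"
  proof -
    have "\<bar>\<integral>\<omega>. innovation g m \<omega> * innovation g m \<omega> \<partial>M\<bar> \<le> (2 / (real m + 1)) * (2 / (real m + 1))"
    proof (rule abs_expectation_le)
      show "\<bar>innovation g m \<omega> * innovation g m \<omega>\<bar> \<le> (2 / (real m + 1)) * (2 / (real m + 1))" for \<omega>
        unfolding abs_mult using innovation_bound[OF m, of \<omega>] by (intro mult_mono) auto
    qed measurable
    then show ?thesis by (simp add: power2_eq_square)
  qed
  moreover have "(\<integral>\<omega>. (\<Sum>j=n..<Suc m. innovation g j \<omega>)\<^sup>2 \<partial>M)
      = (\<integral>\<omega>. T \<omega> * T \<omega> + 2 * (T \<omega> * innovation g m \<omega>) + innovation g m \<omega> * innovation g m \<omega> \<partial>M)"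
    using step by (intro Bochner_Integration.integral_cong refl) (simp add: T_def power2_eq_square algebra_simps)
  moreover have "\<dots> = (\<integral>\<omega>. T \<omega> * T \<omega> \<partial>M) + (\<integral>\<omega>. innovation g m \<omega> * innovation g m \<omega> \<partial>M)"
    using i innovation_orthogonal[OF m T_G Tb] by simp
  ultimately show ?case
    using step by (simp add: T_def power2_eq_square)
qed simp

text \<open>The inequality \<open>|x| \<le> \<eta> + x\<^sup>2 / \<eta>\<close> passes from the second moment of the martingale part to its first moment.\<close>
lemma pmean_L1_increment:
  assumes n: "1 \<le> n" "n \<le> m" and \<eta>: "0 < \<eta>"
  shows "(\<integral>\<omega>. \<bar>pmean m g \<omega> - pmean n g \<omega>\<bar> \<partial>M)
    \<le> \<eta> + (\<Sum>j=n..<m. 4 / (real j + 1)\<^sup>2) / \<eta> + (\<Sum>j=n..<m. b j)"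
proof -
  define T where "T \<omega> = (\<Sum>j=n..<m. innovation g j \<omega>)" for \<omega>
  have [measurable]: "T \<in> borel_measurable M"
    unfolding T_def by (intro borel_measurable_sum innovation_measurable)
  note [measurable] = pmean_measurable[OF g_meas]
  define c where "c = (\<Sum>j=n..<m. 2 / (real j + 1))"
  have Tb: "\<bar>T \<omega>\<bar> \<le> c" for \<omega>
    unfolding T_def c_def using n by (intro order_trans[OF sum_abs] sum_mono innovation_bound) auto
  have i: "integrable M (\<lambda>\<omega>. (T \<omega>)\<^sup>2)"
    using integrable_mult_bounded[of T T c c] Tb by (simp add: power2_eq_square)
  have m: "1 \<le> m" using n by simp
  have pt: "\<bar>pmean m g \<omega> - pmean n g \<omega>\<bar> \<le> \<eta> + (T \<omega>)\<^sup>2 / \<eta> + (\<Sum>j=n..<m. b j)" for \<omega>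
  proof -
    have "\<bar>\<Sum>j=n..<m. drift g j \<omega>\<bar> \<le> (\<Sum>j=n..<m. b j)"
      using n by (intro order_trans[OF sum_abs] sum_mono drift_bound) auto
    moreover have "\<bar>T \<omega>\<bar> \<le> \<eta> + (T \<omega>)\<^sup>2 / \<eta>"
    proof (cases "\<bar>T \<omega>\<bar> \<le> \<eta>")
      case True
      then show ?thesis using \<eta> by (simp add: add_increasing2)
    next
      case False
      then have "\<eta> * \<bar>T \<omega>\<bar> \<le> \<bar>T \<omega>\<bar> * \<bar>T \<omega>\<bar>" by (intro mult_right_mono) auto
      also have "\<dots> = (T \<omega>)\<^sup>2" by (simp add: power2_eq_square abs_mult_self_eq)
      finally have "\<bar>T \<omega>\<bar> \<le> (T \<omega>)\<^sup>2 / \<eta>" using \<eta> by (simp add: field_simps)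
      then show ?thesis using \<eta> by simp
    qed
    ultimately show ?thesis
      unfolding pmean_telescope[OF n] T_def[symmetric] by linarith
  qed
  have "(\<integral>\<omega>. \<bar>pmean m g \<omega> - pmean n g \<omega>\<bar> \<partial>M) \<le> (\<integral>\<omega>. \<eta> + (T \<omega>)\<^sup>2 / \<eta> + (\<Sum>j=n..<m. b j) \<partial>M)"
  proof (rule integral_mono[OF _ _ pt])
    have "\<bar>\<bar>pmean m g \<omega> - pmean n g \<omega>\<bar>\<bar> \<le> 2" for \<omega>
      using pmean_bound[OF m g_meas g_bound, of \<omega>] pmean_bound[OF n(1) g_meas g_bound, of \<omega>] by linarith
    then show "integrable M (\<lambda>\<omega>. \<bar>pmean m g \<omega> - pmean n g \<omega>\<bar>)"
      by (intro integrable_bounded) auto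
  qed (use i in auto)
  also have "\<dots> = \<eta> + (\<integral>\<omega>. (T \<omega>)\<^sup>2 \<partial>M) / \<eta> + (\<Sum>j=n..<m. b j)"
    using i by (simp add: prob_space)
  also have "\<dots> \<le> \<eta> + (\<Sum>j=n..<m. 4 / (real j + 1)\<^sup>2) / \<eta> + (\<Sum>j=n..<m. b j)"
    using innovation_sum_second_moment[OF n] \<eta> by (simp add: T_def divide_right_mono)
  finally show ?thesis .
qed

lemma pmean_L1_Cauchy:
  assumes e: "0 < e"
  shows "\<exists>N\<ge>1. \<forall>n m. N \<le> n \<longrightarrow> n \<le> m \<longrightarrow> (\<integral>\<omega>. \<bar>pmean m g \<omega> - pmean n g \<omega>\<bar> \<partial>M) \<le> e"
proof -
  have "summable (\<lambda>j. inverse ((real (Suc j)) ^ 2))"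
    using inverse_power_summable[of 2, where 'a = real] by (subst summable_Suc_iff) (simp_all add: numeral_2_eq_2)
  then have "summable (\<lambda>j. 4 * inverse ((real (Suc j)) ^ 2))" by (rule summable_mult)
  then have s: "summable (\<lambda>j. 4 / (real j + 1)\<^sup>2)" by (simp add: divide_inverse add.commute)
  have e9: "0 < e\<^sup>2 / 9" "0 < e / 3" using e by auto
  obtain N1 where N1: "\<And>n m. N1 \<le> n \<Longrightarrow> norm (\<Sum>j=n..<m. 4 / (real j + 1)\<^sup>2) < e\<^sup>2 / 9"
    using s e9(1) unfolding summable_Cauchy by blast
  obtain N2 where N2: "\<And>n m. N2 \<le> n \<Longrightarrow> norm (\<Sum>j=n..<m. b j) < e / 3"
    using b_summable e9(2) unfolding summable_Cauchy by blast
  show ?thesis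
  proof (intro exI[of _ "max 1 (max N1 N2)"] conjI allI impI)
    fix n m assume n: "max 1 (max N1 N2) \<le> n" "n \<le> m"
    have "(\<integral>\<omega>. \<bar>pmean m g \<omega> - pmean n g \<omega>\<bar> \<partial>M)
        \<le> e / 3 + (\<Sum>j=n..<m. 4 / (real j + 1)\<^sup>2) / (e / 3) + (\<Sum>j=n..<m. b j)"
      using n e by (intro pmean_L1_increment) auto
    moreover have "(\<Sum>j=n..<m. 4 / (real j + 1)\<^sup>2) / (e / 3) \<le> e / 3"
    proof -
      have "(\<Sum>j=n..<m. 4 / (real j + 1)\<^sup>2) / (e / 3) \<le> (e\<^sup>2 / 9) / (e / 3)"
        using N1[of n m] n e by (intro divide_right_mono) auto
      also have "(e\<^sup>2 / 9) / (e / 3) = e / 3" using e by (simp add: power2_eq_square)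
      finally show ?thesis .
    qed
    moreover have "(\<Sum>j=n..<m. b j) \<le> e / 3" using N2[of n m] n by auto
    ultimately show "(\<integral>\<omega>. \<bar>pmean m g \<omega> - pmean n g \<omega>\<bar> \<partial>M) \<le> e" by linarith
  qed simp
qed

lemma pmean_expectation_increment:
  assumes n: "1 \<le> n" "n \<le> m"
  shows "expectation (pmean m g) \<le> expectation (pmean n g) + (\<Sum>j=n..<m. b j)"
proof -
  have m: "1 \<le> m" using n by simp
  have int: "integrable M (pmean k g)" if "1 \<le> k" for k
    using integrable_bounded[OF pmean_measurable[OF g_meas] pmean_bound[OF that g_meas g_bound]] by simp
  have intI: "integrable M (innovation g j)" if "1 \<le> j" for j
    using integrable_bounded[OF innovation_measurable innovation_bound[OF that]] by simp
  have intD: "integrable M (drift g j)" if "1 \<le> j" for j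
    using integrable_bounded[OF drift_measurable drift_bound[OF that]] by simp
  have "expectation (pmean m g) - expectation (pmean n g) = (\<integral>\<omega>. pmean m g \<omega> - pmean n g \<omega> \<partial>M)"
    using int[OF m] int[OF n(1)] by simp
  also have "\<dots> = (\<Sum>j=n..<m. expectation (innovation g j)) + (\<Sum>j=n..<m. expectation (drift g j))"
    unfolding pmean_telescope[OF n] using n intI intD
    by (subst Bochner_Integration.integral_add) (auto intro!: Bochner_Integration.integrable_sum Bochner_Integration.integral_sum)
  also have "(\<Sum>j=n..<m. expectation (innovation g j)) = 0"
    using n innovation_orthogonal[of _ "\<lambda>_. 1" 1] by (intro sum.neutral) auto
  also have "(\<Sum>j=n..<m. expectation (drift g j)) \<le> (\<Sum>j=n..<m. b j)"
  proof (rule sum_mono)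
    fix j assume "j \<in> {n..<m}"
    then have "1 \<le> j" using n by simp
    then show "expectation (drift g j) \<le> b j"
      using abs_expectation_le[OF drift_measurable drift_bound, of j] by auto
  qed
  finally show ?thesis by simp
qed

end

text \<open>A product of factors bounded by one changes by no more than the sum of the changes of its factors.\<close>
lemma product_expectation_convergent:
  assumes g: "\<And>j :: nat. g j \<in> bounded_lipschitz"
  shows "convergent (\<lambda>n. \<integral>\<omega>. (\<Prod>j<k. pmean n (g j) \<omega>) \<partial>M)"
proof -
  note gm = bounded_lipschitz_measurable[OF g] and gb = bounded_lipschitz_bound[OF g]
  note [measurable] = pmean_measurable[OF gm]
  define E where "E n = (\<integral>\<omega>. (\<Prod>j<k. pmean n (g j) \<omega>) \<partial>M)" for n
  have pb: "\<bar>pmean n (g j) \<omega>\<bar> \<le> 1" if "1 \<le> n" for n j \<omega>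
    by (rule pmean_bound[OF that gm gb])
  have "Cauchy E"
  proof (rule metric_CauchyI)
    fix e :: real assume e: "0 < e"
    define e' where "e' = e / (2 * (real k + 1))"
    have e': "0 < e'" using e by (simp add: e'_def)
    have "\<forall>j. \<exists>N\<ge>1. \<forall>n m. N \<le> n \<longrightarrow> n \<le> m \<longrightarrow> (\<integral>\<omega>. \<bar>pmean m (g j) \<omega> - pmean n (g j) \<omega>\<bar> \<partial>M) \<le> e'"
      using pmean_L1_Cauchy[OF g e'] by blast
    then obtain N where N: "\<And>j. 1 \<le> N j"
      "\<And>j n m. N j \<le> n \<Longrightarrow> n \<le> m \<Longrightarrow> (\<integral>\<omega>. \<bar>pmean m (g j) \<omega> - pmean n (g j) \<omega>\<bar> \<partial>M) \<le> e'"
      by metis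
    define N0 where "N0 = Max (insert 1 (N ` {..<k}))"
    have N0: "1 \<le> N0" "\<And>j. j < k \<Longrightarrow> N j \<le> N0" by (auto simp: N0_def)
    have le: "\<bar>E m - E n\<bar> < e" if nm: "N0 \<le> n" "n \<le> m" for n m
    proof -
      have n1: "1 \<le> n" "1 \<le> m" using nm N0(1) by auto
      have diffb: "\<bar>\<bar>pmean m (g j) \<omega> - pmean n (g j) \<omega>\<bar>\<bar> \<le> 2" for j \<omega>
        using pb[OF n1(1), of j \<omega>] pb[OF n1(2), of j \<omega>] by linarith
      have ip: "integrable M (\<lambda>\<omega>. \<Prod>j<k. pmean l (g j) \<omega>)" if "1 \<le> l" for l
        using pb[OF that] by (intro integrable_bounded[where B = 1]) (auto simp: abs_prod intro!: prod_le_1)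
      have ia: "integrable M (\<lambda>\<omega>. \<bar>pmean m (g j) \<omega> - pmean n (g j) \<omega>\<bar>)" for j
        by (rule integrable_bounded[OF _ diffb]) measurable
      have "\<bar>E m - E n\<bar> = \<bar>\<integral>\<omega>. (\<Prod>j<k. pmean m (g j) \<omega>) - (\<Prod>j<k. pmean n (g j) \<omega>) \<partial>M\<bar>"
        using ip n1 by (simp add: E_def)
      also have "\<dots> \<le> (\<integral>\<omega>. \<bar>(\<Prod>j<k. pmean m (g j) \<omega>) - (\<Prod>j<k. pmean n (g j) \<omega>)\<bar> \<partial>M)"
        by (rule integral_abs_bound)
      also have "\<dots> \<le> (\<integral>\<omega>. (\<Sum>j<k. \<bar>pmean m (g j) \<omega> - pmean n (g j) \<omega>\<bar>) \<partial>M)"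
      proof (rule integral_mono)
        fix \<omega>
        show "\<bar>(\<Prod>j<k. pmean m (g j) \<omega>) - (\<Prod>j<k. pmean n (g j) \<omega>)\<bar> \<le> (\<Sum>j<k. \<bar>pmean m (g j) \<omega> - pmean n (g j) \<omega>\<bar>)"
          using norm_prod_diff[of "{..<k}" "\<lambda>j. pmean m (g j) \<omega>" "\<lambda>j. pmean n (g j) \<omega>"] pb n1 by simp
      qed (use ip n1 ia in auto)
      also have "\<dots> = (\<Sum>j<k. \<integral>\<omega>. \<bar>pmean m (g j) \<omega> - pmean n (g j) \<omega>\<bar> \<partial>M)"
        using ia by (simp add: Bochner_Integration.integral_sum)
      also have "\<dots> \<le> (\<Sum>j<k. e')"
        using nm by (intro sum_mono N(2) order_trans[OF N0(2)]) auto
      also have "\<dots> = e * (real k / (2 * (real k + 1)))" by (simp add: e'_def)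
      also have "\<dots> < e * 1" using e by (intro mult_strict_left_mono) (auto simp: field_simps)
      finally show ?thesis by simp
    qed
    show "\<exists>N. \<forall>m\<ge>N. \<forall>n\<ge>N. dist (E m) (E n) < e"
    proof (intro exI[of _ N0] allI impI)
      fix m n assume "N0 \<le> m" "N0 \<le> n"
      then show "dist (E m) (E n) < e"
        using le[of n m] le[of m n] by (cases "n \<le> m") (auto simp: dist_real_def abs_minus_commute)
    qed
  qed
  then show ?thesis by (simp add: Cauchy_convergent_iff E_def[abs_def])
qed

definition limit_moment :: "nat \<Rightarrow> (nat \<Rightarrow> real \<Rightarrow> real) \<Rightarrow> real" where
  "limit_moment k g = lim (\<lambda>n. \<integral>\<omega>. (\<Prod>j<k. pmean n (g j) \<omega>) \<partial>M)"

lemma limit_moment_tendsto: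
  assumes g: "\<And>j :: nat. g j \<in> bounded_lipschitz"
  shows "(\<lambda>n. \<integral>\<omega>. (\<Prod>j<k. g j (X (n + 1 + j) \<omega>)) \<partial>M) \<longlonglongrightarrow> limit_moment k g"
proof -
  note gm = bounded_lipschitz_measurable[OF g] and gb = bounded_lipschitz_bound[OF g]
  have "(\<lambda>n. \<integral>\<omega>. (\<Prod>j<k. pmean n (g j) \<omega>) \<partial>M) \<longlonglongrightarrow> limit_moment k g"
    using product_expectation_convergent[OF g] by (simp add: limit_moment_def convergent_LIMSEQ_iff)
  moreover have "(\<lambda>n. (\<integral>\<omega>. (\<Prod>j<k. g j (X (n + 1 + j) \<omega>)) \<partial>M) - (\<integral>\<omega>. (\<Prod>j<k. pmean n (g j) \<omega>) \<partial>M)) \<longlonglongrightarrow> 0"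
  proof (rule Lim_null_comparison)
    show "\<forall>\<^sub>F n in sequentially. norm ((\<integral>\<omega>. (\<Prod>j<k. g j (X (n + 1 + j) \<omega>)) \<partial>M) - (\<integral>\<omega>. (\<Prod>j<k. pmean n (g j) \<omega>) \<partial>M))
        \<le> 2 * (real k)\<^sup>2 / (real n + 1)"
      using eventually_ge_at_top[of 1]
    proof eventually_elim
      case (elim n)
      then show ?case
        using product_expectation_approx[OF elim gm gb, where Q = "\<lambda>_. 1" and k = k] by simp
    qed
    show "(\<lambda>n. 2 * (real k)\<^sup>2 / (real n + 1)) \<longlonglongrightarrow> 0" by real_asymp
  qed
  ultimately show ?thesis using tendsto_add by fastforce
qed

lemma limit_moment_permute:
  assumes "\<pi> permutes {..<k}"
  shows "limit_moment k (\<lambda>j. g (\<pi> j)) = limit_moment k g"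
proof -
  have "(\<Prod>j<k. pmean n (g (\<pi> j)) \<omega>) = (\<Prod>j<k. pmean n (g j) \<omega>)" for n \<omega>
    using prod.permute[OF assms, of "\<lambda>j. pmean n (g j) \<omega>"] by (simp add: comp_def)
  then show ?thesis by (simp add: limit_moment_def)
qed

text \<open>The mean of the tail test under \<open>\<alpha>\<^sub>m\<close> can increase after time \<open>n0\<close> by at most the remaining drift.  So it
  suffices to choose \<open>n0\<close> with small remaining drift and then \<open>R\<close> for the single law at time \<open>n0\<close>.\<close>
lemma uniform_tail_bound:
  assumes e: "0 < e"
  shows "\<exists>R. \<forall>\<^sub>F n in sequentially. measure M {\<omega> \<in> space M. R < \<bar>X (n + 1) \<omega>\<bar>} \<le> e"
proof -
  have e2: "0 < e / 2" using e by simp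
  obtain N where N: "\<And>n m. N \<le> n \<Longrightarrow> norm (\<Sum>j=n..<m. b j) < e / 2"
    using b_summable e2 unfolding summable_Cauchy by blast
  define n0 where "n0 = max 1 N"
  have n0: "1 \<le> n0" "N \<le> n0" by (auto simp: n0_def)
  have [measurable]: "tail_test R \<in> borel_measurable borel" for R
    by (rule bounded_lipschitz_measurable[OF tail_test_bounded_lipschitz])
  have eq: "(\<integral>\<omega>. tail_test R (X (n + 1) \<omega>) \<partial>M) = expectation (pmean n (tail_test R))" if "1 \<le> n" for n R
    using predictive_expectation[OF that, of "\<lambda>_. 1" 1 "tail_test R" 1]
      bounded_lipschitz_bound[OF tail_test_bounded_lipschitz] by simp
  have "(\<lambda>r. \<integral>\<omega>. tail_test (real r) (X (n0 + 1) \<omega>) \<partial>M) \<longlonglongrightarrow> (\<integral>\<omega>. 0 \<partial>M)"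
  proof (rule integral_dominated_convergence[where w = "\<lambda>_. 1"])
    show "AE \<omega> in M. (\<lambda>r. tail_test (real r) (X (n0 + 1) \<omega>)) \<longlonglongrightarrow> 0"
    proof (rule AE_I2)
      fix \<omega>
      obtain r0 where r0: "\<bar>X (n0 + 1) \<omega>\<bar> \<le> real r0" using real_arch_simple by blast
      have "\<forall>\<^sub>F r in sequentially. tail_test (real r) (X (n0 + 1) \<omega>) = 0"
        using eventually_ge_at_top[of r0]
      proof eventually_elim
        case (elim r)
        then have "\<bar>X (n0 + 1) \<omega>\<bar> \<le> real r" using r0 by linarith
        then show ?case by (simp add: tail_test_def)
      qed
      then show "(\<lambda>r. tail_test (real r) (X (n0 + 1) \<omega>)) \<longlonglongrightarrow> 0" by (rule tendsto_eventually)
    qed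
    show "AE \<omega> in M. norm (tail_test (real r) (X (n0 + 1) \<omega>)) \<le> 1" for r
      using bounded_lipschitz_bound[OF tail_test_bounded_lipschitz] by simp
  qed simp_all
  then have "\<forall>\<^sub>F r in sequentially. (\<integral>\<omega>. tail_test (real r) (X (n0 + 1) \<omega>) \<partial>M) < e / 2"
    using e2 by (intro order_tendstoD(2)) auto
  then obtain r where r: "(\<integral>\<omega>. tail_test (real r) (X (n0 + 1) \<omega>) \<partial>M) < e / 2"
    by (auto dest: eventually_happens)
  show ?thesis
  proof (intro exI[of _ "real r + 1"] eventually_mono[OF eventually_ge_at_top[of n0]])
    fix m assume m: "n0 \<le> m"
    have "measure M {\<omega> \<in> space M. real r + 1 < \<bar>X (m + 1) \<omega>\<bar>}
        = (\<integral>\<omega>. indicator {\<omega> \<in> space M. real r + 1 < \<bar>X (m + 1) \<omega>\<bar>} \<omega> \<partial>M)" by simp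
    also have "\<dots> \<le> (\<integral>\<omega>. tail_test (real r) (X (m + 1) \<omega>) \<partial>M)"
    proof (rule integral_mono)
      show "integrable M (indicat_real {\<omega> \<in> space M. real r + 1 < \<bar>X (m + 1) \<omega>\<bar>})"
        by (rule integrable_bounded[where B = 1]) auto
      show "integrable M (\<lambda>\<omega>. tail_test (real r) (X (m + 1) \<omega>))"
        using bounded_lipschitz_bound[OF tail_test_bounded_lipschitz] by (intro integrable_bounded[where B = 1]) auto
    qed (auto simp: tail_test_def indicator_def)
    also have "\<dots> = expectation (pmean m (tail_test r))" using m n0 by (intro eq) auto
    also have "\<dots> \<le> expectation (pmean n0 (tail_test r)) + (\<Sum>j=n0..<m. b j)"
      by (rule pmean_expectation_increment[OF tail_test_bounded_lipschitz n0(1) m])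
    also have "\<dots> \<le> e / 2 + e / 2"
      using r N[OF n0(2), of m] unfolding eq[OF n0(1)] by (intro add_mono) auto
    finally show "measure M {\<omega> \<in> space M. real r + 1 < \<bar>X (m + 1) \<omega>\<bar>} \<le> e" by simp
  qed
qed

text \<open>Every subsequence has a further subsequence converging in law, and the product moments of each such
  limit are the limits found above.  Hence all subsequential limits agree, the whole sequence
  converges, and the symmetry of the product moments makes the limit exchangeable.\<close>
theorem process_asymptotically_exchangeable: "asymptotically_exchangeable M X"
proof -
  define Y where "Y n \<omega> k = X (n + 1 + k) \<omega>" for n \<omega> k
  have Y_meas [measurable]: "(\<lambda>\<omega>. Y n \<omega> k) \<in> borel_measurable M" for n k
    unfolding Y_def by (rule X_measurable) simp
  have Y_tight: "\<exists>R. \<forall>\<^sub>F n in sequentially. measure M {\<omega> \<in> space M. R < \<bar>Y n \<omega> k\<bar>} \<le> e" if e: "0 < e" for k e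
  proof -
    obtain R where R: "\<forall>\<^sub>F n in sequentially. measure M {\<omega> \<in> space M. R < \<bar>X (n + 1) \<omega>\<bar>} \<le> e"
      using uniform_tail_bound[OF e] by blast
    have "\<forall>\<^sub>F n in sequentially. measure M {\<omega> \<in> space M. R < \<bar>X ((n + k) + 1) \<omega>\<bar>} \<le> e"
      using R sequentially_offset[of "\<lambda>n. measure M {\<omega> \<in> space M. R < \<bar>X (n + 1) \<omega>\<bar>} \<le> e" k] by simp
    then show ?thesis by (auto simp: Y_def ac_simps)
  qed
  have moments: "(\<integral>x. (\<Prod>j<k. g j (x j)) \<partial>Q) = limit_moment k g"
    if r: "strict_mono r" and conv: "\<And>f :: (nat \<Rightarrow> real) \<Rightarrow> real. continuous_on UNIV f \<Longrightarrow> bounded (range f)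
        \<Longrightarrow> (\<lambda>n. \<integral>\<omega>. f (Y (r n) \<omega>) \<partial>M) \<longlonglongrightarrow> (\<integral>x. f x \<partial>Q)"
      and g: "\<And>j :: nat. g j \<in> bounded_lipschitz" for r Q k and g :: "nat \<Rightarrow> real \<Rightarrow> real"
  proof -
    have "(\<lambda>n. \<integral>\<omega>. (\<Prod>j<k. g j (Y (r n) \<omega> j)) \<partial>M) \<longlonglongrightarrow> (\<integral>x. (\<Prod>j<k. g j (x j)) \<partial>Q)"
    proof (rule conv)
      show "continuous_on UNIV (\<lambda>x :: nat \<Rightarrow> real. \<Prod>j<k. g j (x j))"
        by (intro continuous_on_prod continuous_on_compose2[OF bounded_lipschitz_continuous[OF g]]
            continuous_on_product_coordinates) auto
      have "\<bar>\<Prod>j<k. g j (x j)\<bar> \<le> 1" for x :: "nat \<Rightarrow> real"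
        unfolding abs_prod using bounded_lipschitz_bound[OF g] by (intro prod_le_1) auto
      then show "bounded (range (\<lambda>x :: nat \<Rightarrow> real. \<Prod>j<k. g j (x j)))"
        by (auto simp: bounded_iff)
    qed
    moreover have "(\<lambda>n. \<integral>\<omega>. (\<Prod>j<k. g j (Y (r n) \<omega> j)) \<partial>M) \<longlonglongrightarrow> limit_moment k g"
      using LIMSEQ_subseq_LIMSEQ[OF limit_moment_tendsto[OF g] r] by (simp add: comp_def Y_def)
    ultimately show ?thesis by (rule LIMSEQ_unique)
  qed
  obtain r Q where r: "strict_mono r" and Q: "prob_space Q" "sets Q = sets (borel :: (nat \<Rightarrow> real) measure)"
    and conv: "\<And>f :: (nat \<Rightarrow> real) \<Rightarrow> real. continuous_on UNIV f \<Longrightarrow> bounded (range f)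
        \<Longrightarrow> (\<lambda>n. \<integral>\<omega>. f (Y (r n) \<omega>) \<partial>M) \<longlonglongrightarrow> (\<integral>x. f x \<partial>Q)"
    by (rule tight_sequence_laws_subsequential_limit[where Y = Y, OF prob_space_axioms Y_meas Y_tight]) (assumption, rule that)
  have full: "(\<lambda>n. \<integral>\<omega>. f (Y n \<omega>) \<partial>M) \<longlonglongrightarrow> (\<integral>x. f x \<partial>Q)"
    if f: "continuous_on UNIV f" "bounded (range f)" for f :: "(nat \<Rightarrow> real) \<Rightarrow> real"
  proof (rule ccontr)
    assume "\<not> (\<lambda>n. \<integral>\<omega>. f (Y n \<omega>) \<partial>M) \<longlonglongrightarrow> (\<integral>x. f x \<partial>Q)"
    then obtain e where e: "0 < e"
      and inf: "\<And>N. \<exists>n\<ge>N. e \<le> dist (\<integral>\<omega>. f (Y n \<omega>) \<partial>M) (\<integral>x. f x \<partial>Q)"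
      unfolding lim_sequentially by (auto simp: not_less)
    define S where "S = {n. e \<le> dist (\<integral>\<omega>. f (Y n \<omega>) \<partial>M) (\<integral>x. f x \<partial>Q)}"
    have "infinite S"
      using inf unfolding infinite_nat_iff_unbounded_le S_def by simp
    from infinite_enumerate[OF this] obtain s :: "nat \<Rightarrow> nat" where s: "strict_mono s" and "\<forall>n. s n \<in> S"
      by blast
    then have far: "e \<le> dist (\<integral>\<omega>. f (Y (s n) \<omega>) \<partial>M) (\<integral>x. f x \<partial>Q)" for n
      by (simp add: S_def)
    have tight_s: "\<exists>R. \<forall>\<^sub>F n in sequentially. measure M {\<omega> \<in> space M. R < \<bar>Y (s n) \<omega> k\<bar>} \<le> d" if d: "0 < d" for k d
    proof -
      obtain R where "\<forall>\<^sub>F n in sequentially. measure M {\<omega> \<in> space M. R < \<bar>Y n \<omega> k\<bar>} \<le> d"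
        using Y_tight[OF d, of k] by blast
      from eventually_subseq[OF s this] show ?thesis by blast
    qed
    obtain t Q' where t: "strict_mono t" and Q': "prob_space Q'" "sets Q' = sets (borel :: (nat \<Rightarrow> real) measure)"
      and conv': "\<And>f :: (nat \<Rightarrow> real) \<Rightarrow> real. continuous_on UNIV f \<Longrightarrow> bounded (range f)
        \<Longrightarrow> (\<lambda>n. \<integral>\<omega>. f (Y (s (t n)) \<omega>) \<partial>M) \<longlonglongrightarrow> (\<integral>x. f x \<partial>Q')"
      by (rule tight_sequence_laws_subsequential_limit[where Y = "\<lambda>n. Y (s n)", OF prob_space_axioms Y_meas tight_s]) (assumption, rule that)
    have st: "strict_mono (\<lambda>n. s (t n))" using s t by (simp add: strict_mono_def)
    have "Q' = Q"
      by (rule sequence_law_eqI[OF Q' Q]) (simp add: moments[OF st conv'] moments[OF r conv])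
    then have "(\<lambda>n. \<integral>\<omega>. f (Y (s (t n)) \<omega>) \<partial>M) \<longlonglongrightarrow> (\<integral>x. f x \<partial>Q)" using conv'[OF f] by simp
    then obtain n where "dist (\<integral>\<omega>. f (Y (s (t n)) \<omega>) \<partial>M) (\<integral>x. f x \<partial>Q) < e"
      using e unfolding lim_sequentially by blast
    then show False using far[of "t n"] by simp
  qed
  note [measurable_cong] = Q(2)
  interpret Q: prob_space Q by (rule Q(1))
  have exch: "distr Q (\<Pi>\<^sub>M k\<in>UNIV. borel) (\<lambda>x k. x (\<pi> k)) = distr Q (\<Pi>\<^sub>M k\<in>UNIV. borel) (\<lambda>x k. x k)"
    if \<pi>: "\<pi> permutes {..<m}" for \<pi> :: "nat \<Rightarrow> nat" and m
  proof -
    let ?PM = "\<Pi>\<^sub>M k\<in>(UNIV :: nat set). (borel :: real measure)"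
    have meas [measurable]: "(\<lambda>x k. x (\<rho> k)) \<in> measurable Q ?PM" for \<rho> :: "nat \<Rightarrow> nat"
      by (rule measurable_PiM_single') (auto simp: space_PiM)
    show ?thesis
    proof (rule sequence_law_eqI)
      show "prob_space (distr Q ?PM (\<lambda>x k. x (\<pi> k)))" "prob_space (distr Q ?PM (\<lambda>x k. x k))"
        using meas[of \<pi>] meas[of id] by (auto intro: Q.prob_space_distr)
      show "sets (distr Q ?PM (\<lambda>x k. x (\<pi> k))) = sets borel" "sets (distr Q ?PM (\<lambda>x k. x k)) = sets borel"
        by (simp_all add: sets_PiM_equal_borel)
      fix k and g :: "nat \<Rightarrow> real \<Rightarrow> real" assume g: "\<And>j. g j \<in> bounded_lipschitz"
      note [measurable] = bounded_lipschitz_measurable[OF g]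
      \<comment> \<open>Constant factors pad the product to a range of indices that \<open>\<pi>\<close> maps to itself.\<close>
      define g' where "g' j = (if j < k then g j else (\<lambda>_. 1))" for j
      have g': "g' j \<in> bounded_lipschitz" for j
        using g bounded_lipschitz_const[of 1] by (simp add: g'_def)
      define l where "l = max k m"
      have pad: "(\<Prod>j<k. g j (y j)) = (\<Prod>j<l. g' j (y j))" for y :: "nat \<Rightarrow> real"
        by (rule prod.mono_neutral_cong_left) (auto simp: l_def g'_def)
      have \<pi>l: "\<pi> permutes {..<l}" using \<pi> by (rule permutes_subset) (auto simp: l_def)
      have gm: "(\<lambda>y. \<Prod>j<k. g j (y j)) \<in> borel_measurable ?PM" by measurable
      have "(\<Prod>j<l. g' j (x (\<pi> j))) = (\<Prod>j<l. g' (inv \<pi> j) (x j))" for x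
        using prod.permute[OF \<pi>l, of "\<lambda>j. g' (inv \<pi> j) (x j)"] by (simp add: comp_def permutes_inverses(2)[OF \<pi>])
      then have "(\<integral>y. (\<Prod>j<k. g j (y j)) \<partial>distr Q ?PM (\<lambda>x k. x (\<pi> k))) = (\<integral>x. (\<Prod>j<l. g' (inv \<pi> j) (x j)) \<partial>Q)"
        by (subst integral_distr[OF meas gm]) (simp add: pad)
      also have "\<dots> = limit_moment l (\<lambda>j. g' (inv \<pi> j))" by (rule moments[OF r conv g'])
      also have "\<dots> = limit_moment l g'"
        by (rule limit_moment_permute[OF permutes_inv[OF \<pi>l]])
      also have "\<dots> = (\<integral>x. (\<Prod>j<l. g' j (x j)) \<partial>Q)" by (rule moments[OF r conv g', symmetric])
      also have "\<dots> = (\<integral>y. (\<Prod>j<k. g j (y j)) \<partial>distr Q ?PM (\<lambda>x k. x k))"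
        by (subst integral_distr[OF meas[of "\<lambda>k. k"] gm]) (simp add: pad)
      finally show "(\<integral>y. (\<Prod>j<k. g j (y j)) \<partial>distr Q ?PM (\<lambda>x k. x (\<pi> k)))
          = (\<integral>y. (\<Prod>j<k. g j (y j)) \<partial>distr Q ?PM (\<lambda>x k. x k))" .
    qed
  qed
  have "exchangeable Q (\<lambda>k x. x k)"
    unfolding exchangeable_def using exch by auto
  moreover have "conv_in_distribution M (\<lambda>n \<omega> k. X (n + k) \<omega>) Q (\<lambda>x k. x k)"
    unfolding conv_in_distribution_def
  proof (intro allI impI)
    fix f :: "(nat \<Rightarrow> real) \<Rightarrow> real" assume "continuous_on UNIV f" "bounded (range f)"
    from full[OF this] have "(\<lambda>n. \<integral>\<omega>. f (\<lambda>k. X (Suc n + k) \<omega>) \<partial>M) \<longlonglongrightarrow> (\<integral>x. f x \<partial>Q)"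
      by (simp add: Y_def[abs_def])
    then show "(\<lambda>n. \<integral>\<omega>. f (\<lambda>k. X (n + k) \<omega>) \<partial>M) \<longlonglongrightarrow> (\<integral>x. f (\<lambda>k. x k) \<partial>Q)"
      by (subst (asm) filterlim_sequentially_Suc[where f = "\<lambda>n. \<integral>\<omega>. f (\<lambda>k. X (n + k) \<omega>) \<partial>M"]) simp
  qed
  ultimately show ?thesis
    unfolding asymptotically_exchangeable_def using Q(1) by blast
qed

end

section \<open>The recursion of the predictive distributions\<close>

lemma set_integral_kernel:
  assumes K: "is_kernel K" and h: "0 < h" and [measurable]: "A \<in> sets borel"
  shows "(LBINT x:A. K ((x - c) / h)) = h * smooth K h (indicat_real A) c"
proof -
  have [measurable]: "K \<in> borel_measurable borel" using K by (rule kernel_measurable)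
  have Kn: "0 \<le> K u" for u using K by (simp add: is_kernel_def)
  have "(LBINT x:A. K ((x - c) / h)) = \<bar>h\<bar> *\<^sub>R (\<integral>u. indicat_real A (c + h * u) *\<^sub>R K ((c + h * u - c) / h) \<partial>lborel)"
    unfolding set_lebesgue_integral_def using h by (intro lborel_integral_real_affine) simp
  also have "\<dots> = h * (\<integral>u. K u * indicat_real A (c + h * u) \<partial>lborel)"
    using h by (simp add: mult.commute)
  also have "(\<integral>u. K u * indicat_real A (c + h * u) \<partial>lborel) = smooth K h (indicat_real A) c"
    unfolding smooth_def kernel_law_def using Kn by (subst integral_density) auto
  finally show ?thesis .
qed

text \<open>At \<open>n = 1\<close> the factor \<open>n - 1\<close> removes the initial distribution, so every later predictive distribution is the
  plain average of the kernels around the observations.\<close>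
lemma recursion_predictive_mean:
  assumes K: "is_kernel K" and h: "\<And>n. 1 \<le> n \<Longrightarrow> 0 < h n" and A: "A \<in> sets borel"
    and rec: "\<And>n. 1 \<le> n \<Longrightarrow> p n = (real n - 1) / real n * p (n - 1)
              + 1 / (real n * h n) * (LBINT x:A. K ((x - X n \<omega>) / h n))"
    and n: "1 \<le> n"
  shows "p n = predictive_mean K h X n (indicat_real A) \<omega>"
  using n
proof (induction n rule: dec_induct)
  case base
  show ?case
    using rec[of 1] h[of 1] by (simp add: set_integral_kernel[OF K _ A] predictive_mean_def)
next
  case (step n)
  have "p (Suc n) = real n / real (Suc n) * p n + 1 / real (Suc n) * smooth K (h (Suc n)) (indicat_real A) (X (Suc n) \<omega>)"
    using rec[of "Suc n"] h[of "Suc n"] by (simp add: set_integral_kernel[OF K _ A])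
  then show ?case
    using step by (simp add: predictive_mean_def add_divide_distrib)
qed

text \<open>The drift bound for sets, which gives the a.c.i.d. property.\<close>
lemma smooth_smooth_indicator_le_tv_dist:
  assumes K: "is_kernel K" and h: "0 < h" "0 < h'" and A [measurable]: "A \<in> sets borel"
  shows "smooth K h (smooth K h' (indicat_real A)) c
    \<le> smooth K h (indicat_real A) c + tv_dist (kernel_conv_measure K h' h c) (kernel_measure K h c)"
proof -
  have sp: "space (kernel_conv_measure K h' h c) = UNIV"
    by (simp add: kernel_conv_measure_def)
  have "smooth K h (smooth K h' (indicat_real A)) c = measure (kernel_conv_measure K h' h c) A"
    using integral_kernel_conv_measure[OF K h, of "indicat_real A" 1 c] by (simp add: indicator_def sp flip: indicator_def)
  then show ?thesis
    using tv_dist_upper[OF prob_space_kernel_conv_measure[OF K h] prob_space_kernel_measure[OF K h(1)] A, of c c]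
    by (simp add: smooth_indicator[OF K h(1) A])
qed

theorem proposition4:
  fixes M :: "'a measure"
    and X :: "nat \<Rightarrow> 'a \<Rightarrow> real"
    and \<alpha> :: "nat \<Rightarrow> 'a \<Rightarrow> real measure"
    and \<alpha>0 :: "real measure"
    and K :: "real \<Rightarrow> real"
    and h :: "nat \<Rightarrow> real"
    and d C :: real
  assumes M: "prob_space M"
    and X: "\<And>n. 1 \<le> n \<Longrightarrow> X n \<in> borel_measurable M"
    and K: "is_kernel K"
    and h: "\<And>n. 1 \<le> n \<Longrightarrow> 0 < h n"
    and \<alpha>0: "prob_space \<alpha>0" "sets \<alpha>0 = sets borel"
    and \<alpha>_prob: "\<And>n \<omega>. \<omega> \<in> space M \<Longrightarrow> prob_space (\<alpha> n \<omega>) \<and> sets (\<alpha> n \<omega>) = sets borel"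
    and \<alpha>_init: "\<And>\<omega>. \<omega> \<in> space M \<Longrightarrow> \<alpha> 0 \<omega> = \<alpha>0"
    and \<alpha>_rec: "\<And>n \<omega> A. 1 \<le> n \<Longrightarrow> \<omega> \<in> space M \<Longrightarrow> A \<in> sets borel \<Longrightarrow>
          measure (\<alpha> n \<omega>) A
            = (real n - 1) / real n * measure (\<alpha> (n - 1) \<omega>) A
              + 1 / (real n * h n) * (LBINT x:A. K ((x - X n \<omega>) / h n))"
    and predictive: "\<And>n A. A \<in> sets borel \<Longrightarrow>
          AE \<omega> in M. cond_probability M (obs_filtration M X n) (X (n + 1)) A \<omega>
                       = measure (\<alpha> n \<omega>) A"
    and d: "0 < d"
    and C: "0 < C"
    and tv: "\<And>n i. 1 \<le> i \<Longrightarrow> i \<le> n \<Longrightarrow>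
          AE \<omega> in M. tv_dist (kernel_conv_measure K (h (n + 1)) (h i) (X i \<omega>))
                             (kernel_measure K (h i) (X i \<omega>))
                       \<le> C * (h (n + 1) powr d / h i powr d)"
  shows "acid M (obs_filtration M X) X
           (\<lambda>n \<omega>. if n = 0 then 1
                  else 1 / (real n + 1) *
                       (\<Sum>i=1..n. 1 / real n * C * (h (n + 1) powr d / h i powr d)))
       \<and> ((\<lambda>n. h (n + 1) powr d / (real n + 1) * (\<Sum>i=1..n. 1 / h i powr d))
             \<in> o(\<lambda>n. 1 / ln (real n))
           \<longrightarrow> asymptotically_exchangeable M X)"
proof -
  interpret prob_space M by (rule M)
  have pred: "AE \<omega> in M. cond_probability M (obs_filtration M X n) (X (n + 1)) A \<omega>
        = predictive_mean K h X n (indicat_real A) \<omega>"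
    if n: "1 \<le> n" and A: "A \<in> sets borel" for n A
    using predictive[OF A, of n] AE_space
  proof eventually_elim
    case (elim \<omega>)
    have "measure (\<alpha> n \<omega>) A = predictive_mean K h X n (indicat_real A) \<omega>"
      by (rule recursion_predictive_mean[where p = "\<lambda>n. measure (\<alpha> n \<omega>) A" and X = X and \<omega> = \<omega> and A = A and h = h, OF K h A \<alpha>_rec[OF _ elim(2) A] n])
    then show ?case using elim(1) by simp
  qed
  interpret kernel_process M X K h
    by unfold_locales (fact X K pred)+
  define \<xi> where "\<xi> n = 1 / (real n + 1) * (\<Sum>i=1..n. 1 / real n * C * (h (n + 1) powr d / h i powr d))" for n
  have \<xi>_nonneg: "0 \<le> \<xi> n" for n
    unfolding \<xi>_def using C by (intro mult_nonneg_nonneg sum_nonneg) auto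
  have cond_exp_next: "AE \<omega> in M. real_cond_exp M (G n) (cond_probability M (G (n + 1)) (X (n + 2)) A) \<omega>
      = real_cond_exp M (G n) (pmean (n + 1) (indicat_real A)) \<omega>" if A: "A \<in> sets borel" for n A
  proof -
    interpret Gn: sigma_finite_subalgebra M "G n" by (rule G_sigma_finite)
    have [measurable]: "pmean (Suc n) (indicat_real A) \<in> borel_measurable M"
      using A by (intro pmean_measurable) auto
    show ?thesis
      using pred[of "n + 1" A] A
      by (intro Gn.real_cond_exp_cong) (auto simp: cond_probability_def intro: borel_measurable_cond_exp2)
  qed
  \<comment> \<open>At time 0 the parameter is 1, and the bound is that of two probabilities.\<close>
  have acid_0: "AE \<omega> in M. real_cond_exp M (G 0) (cond_probability M (G (0 + 1)) (X (0 + 2)) A) \<omega>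
      \<le> cond_probability M (G 0) (X (0 + 1)) A \<omega> + 1" if A [measurable]: "A \<in> sets borel" for A
  proof -
    interpret G0: sigma_finite_subalgebra M "G 0" by (rule G_sigma_finite)
    have p1: "pmean 1 (indicat_real A) \<in> borel_measurable M" "\<bar>pmean 1 (indicat_real A) \<omega>\<bar> \<le> 1" for \<omega>
      by (auto intro!: pmean_measurable pmean_bound simp: indicator_def)
    have "AE \<omega> in M. real_cond_exp M (G 0) (pmean 1 (indicat_real A)) \<omega> \<le> real_cond_exp M (G 0) (\<lambda>_. 1) \<omega>"
      using p1 by (intro G0.real_cond_exp_mono integrable_bounded[OF p1]) (auto simp: abs_le_iff)
    moreover have "AE \<omega> in M. real_cond_exp M (G 0) (\<lambda>_. 1 :: real) \<omega> = 1"
      by (intro G0.real_cond_exp_F_meas) auto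
    moreover have "AE \<omega> in M. 0 \<le> cond_probability M (G 0) (X 1) A \<omega>"
      unfolding cond_probability_def by (intro G0.real_cond_exp_pos) auto
    moreover note cond_exp_next[OF A, of 0]
    ultimately show ?thesis by eventually_elim simp
  qed
  have acid_Suc: "AE \<omega> in M. real_cond_exp M (G n) (cond_probability M (G (n + 1)) (X (n + 2)) A) \<omega>
      \<le> cond_probability M (G n) (X (n + 1)) A \<omega> + \<xi> n" if A: "A \<in> sets borel" and n: "1 \<le> n" for A n
  proof -
    let ?p = "pmean n (indicat_real A)" and ?q = "pmean n (smooth K (h (n + 1)) (indicat_real A))"
    define \<rho> where "\<rho> i = C * (h (n + 1) powr d / h i powr d)" for i
    have "AE \<omega> in M. \<forall>i\<in>{1..n}. tv_dist (kernel_conv_measure K (h (n + 1)) (h i) (X i \<omega>))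
                             (kernel_measure K (h i) (X i \<omega>)) \<le> \<rho> i"
      unfolding \<rho>_def using tv by (intro AE_finite_allI) auto
    then have "AE \<omega> in M. ?q \<omega> \<le> ?p \<omega> + (\<Sum>i=1..n. \<rho> i) / real n"
    proof eventually_elim
      case (elim \<omega>)
      have "(\<Sum>i=1..n. smooth K (h i) (smooth K (h (n + 1)) (indicat_real A)) (X i \<omega>))
          \<le> (\<Sum>i=1..n. smooth K (h i) (indicat_real A) (X i \<omega>) + \<rho> i)"
      proof (rule sum_mono)
        fix i assume i: "i \<in> {1..n}"
        then have "0 < h i" "0 < h (n + 1)" using h by auto
        then show "smooth K (h i) (smooth K (h (n + 1)) (indicat_real A)) (X i \<omega>)
            \<le> smooth K (h i) (indicat_real A) (X i \<omega>) + \<rho> i"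
          using smooth_smooth_indicator_le_tv_dist[OF K _ _ A, of "h i" "h (n + 1)" "X i \<omega>"] elim[rule_format, OF i]
          by linarith
      qed
      then have "?q \<omega> \<le> (\<Sum>i=1..n. smooth K (h i) (indicat_real A) (X i \<omega>) + \<rho> i) / real n"
        unfolding predictive_mean_def by (rule divide_right_mono) simp
      then show ?case by (simp add: predictive_mean_def sum.distrib add_divide_distrib)
    qed
    moreover have "AE \<omega> in M. real_cond_exp M (G n) (pmean (n + 1) (indicat_real A)) \<omega>
           = (real n * ?p \<omega> + ?q \<omega>) / (real n + 1)"
      using A by (intro cond_exp_pmean_Suc[OF n, where B = 1]) (auto simp: indicator_def)
    moreover note cond_exp_next[OF A, of n] pred[OF n A]
    ultimately show ?thesis
    proof eventually_elim
      case (elim \<omega>)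
      have split: "(real n * p + (p + s)) / (real n + 1) = p + s / (real n + 1)" for p s
        by (simp add: field_simps)
      have "(real n * ?p \<omega> + ?q \<omega>) / (real n + 1) \<le> (real n * ?p \<omega> + (?p \<omega> + (\<Sum>i=1..n. \<rho> i) / real n)) / (real n + 1)"
        using elim(1) by (intro divide_right_mono) auto
      also have "\<dots> = ?p \<omega> + (\<Sum>i=1..n. \<rho> i) / real n / (real n + 1)"
        by (rule split)
      also have "(\<Sum>i=1..n. \<rho> i) / real n / (real n + 1) = \<xi> n"
        by (simp add: \<xi>_def \<rho>_def sum_divide_distrib mult.commute)
      finally show ?case using elim by simp
    qed
  qed
  have "acid M G X (\<lambda>n \<omega>. if n = 0 then 1 else \<xi> n)"
    unfolding acid_def
  proof (intro conjI allI ballI)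
    show "AE \<omega> in M. real_cond_exp M (G n) (cond_probability M (G (n + 1)) (X (n + 2)) A) \<omega>
        \<le> cond_probability M (G n) (X (n + 1)) A \<omega> + (if n = 0 then 1 else \<xi> n)"
      if "A \<in> sets borel" for A n
      using acid_0[OF that] acid_Suc[OF that, of n] by (cases "n = 0") auto
  qed (use \<xi>_nonneg in auto)
  moreover have "asymptotically_exchangeable M X"
    if o: "(\<lambda>n. h (n + 1) powr d / (real n + 1) * (\<Sum>i=1..n. 1 / h i powr d)) \<in> o(\<lambda>n. 1 / ln (real n))"
  proof -
    have h1: "0 < h 1" by (rule h) simp
    obtain c n0 where c: "0 < c" and decay: "\<And>n. n0 \<le> n \<Longrightarrow> h (n + 1) powr d \<le> c / (real n + 1)\<^sup>2"
      using bandwidth_decay[of "\<lambda>i. h i powr d", OF _ o] h by (metis less_irrefl powr_gt_zero)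
    obtain B where B: "0 < B" and second: "\<And>h' c. 0 < h' \<Longrightarrow> (\<integral>u. min 1 ((h' * u)\<^sup>2) \<partial>kernel_law K)
       \<le> B * tv_dist (kernel_conv_measure K h' (h 1) c) (kernel_measure K (h 1) c)"
      using truncated_second_moment_le_tv_dist[OF K h1] by blast
    \<comment> \<open>The tails of the kernel are deterministic, so they can be read off at a single sample point; taking
      \<open>i = 1\<close> keeps the first bandwidth fixed while the second one tends to zero.\<close>
    have "AE \<omega> in M. \<forall>n. 1 \<le> n \<longrightarrow> tv_dist (kernel_conv_measure K (h (n + 1)) (h 1) (X 1 \<omega>))
                             (kernel_measure K (h 1) (X 1 \<omega>)) \<le> C * (h (n + 1) powr d / h 1 powr d)"
      unfolding AE_all_countable using tv[of 1] by auto
    then obtain \<omega> where tv1: "\<And>n. 1 \<le> n \<Longrightarrow> tv_dist (kernel_conv_measure K (h (n + 1)) (h 1) (X 1 \<omega>))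
                             (kernel_measure K (h 1) (X 1 \<omega>)) \<le> C * (h (n + 1) powr d / h 1 powr d)"
      by (auto dest!: eventually_happens simp: trivial_limit_def ae_filter_eq_bot_iff emeasure_space_1)
    define D where "D = B * C / h 1 powr d * c"
    have D: "0 < D" using B C c h1 by (simp add: D_def)
    have V: "(\<integral>u. min 1 ((h (n + 1) * u)\<^sup>2) \<partial>kernel_law K) \<le> D / (real n + 1)\<^sup>2" if n: "1 \<le> n" "n0 \<le> n" for n
    proof -
      have "(\<integral>u. min 1 ((h (n + 1) * u)\<^sup>2) \<partial>kernel_law K) \<le> B * (C * (h (n + 1) powr d / h 1 powr d))"
        using h[of "n + 1"] B by (intro order_trans[OF second mult_left_mono[OF tv1[OF n(1)]]]) auto
      also have "\<dots> = B * C / h 1 powr d * h (n + 1) powr d" by simp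
      also have "\<dots> \<le> B * C / h 1 powr d * (c / (real n + 1)\<^sup>2)"
        using decay[OF n(2)] B C by (intro mult_left_mono) auto
      finally show ?thesis by (simp add: D_def)
    qed
    \<comment> \<open>The first two terms come from \<open>\<eta> = 1 / (n + 1)\<close> for large \<open>n\<close>; the last one makes the bound at least
        the trivial bound 2 for \<open>n < n0\<close>.\<close>
    define E where "E = 1 + 2 * D + 2 * (real n0 + 1)\<^sup>2"
    define b where "b n = E * inverse ((real (Suc n))\<^sup>2)" for n
    have "summable (\<lambda>n. inverse ((real (Suc n))\<^sup>2))"
      using inverse_power_summable[of 2, where 'a = real] by (subst summable_Suc_iff) (simp_all add: numeral_2_eq_2)
    then have b_summable: "summable b" unfolding b_def by (rule summable_mult)
    have b_eq: "b n = E / (real n + 1)\<^sup>2" for n by (simp add: b_def divide_inverse add.commute)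
    have drift: "\<bar>smooth K (h (n + 1)) g c - g c\<bar> / (real n + 1) \<le> b n"
      if n: "1 \<le> n" and g: "g \<in> bounded_lipschitz" for n g c
    proof (cases "n0 \<le> n")
      case True
      let ?V = "\<integral>u. min 1 ((h (n + 1) * u)\<^sup>2) \<partial>kernel_law K"
      have "\<bar>smooth K (h (n + 1)) g c - g c\<bar> \<le> 1 / (real n + 1) + 2 / (1 / (real n + 1)) * ?V"
        using h[of "n + 1"] by (intro smooth_approx_bounded_lipschitz[OF K _ _ _ g]) auto
      also have "\<dots> \<le> 1 / (real n + 1) + 2 / (1 / (real n + 1)) * (D / (real n + 1)\<^sup>2)"
        using V[OF n True] by (intro add_left_mono mult_left_mono) auto
      also have "\<dots> = (1 + 2 * D) / (real n + 1)"
        by (simp add: power2_eq_square divide_simps) (simp add: algebra_simps)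
      finally have "\<bar>smooth K (h (n + 1)) g c - g c\<bar> / (real n + 1) \<le> (1 + 2 * D) / (real n + 1) / (real n + 1)"
        by (rule divide_right_mono) simp
      also have "\<dots> = (1 + 2 * D) / (real n + 1)\<^sup>2" by (simp add: power2_eq_square)
      also have "\<dots> \<le> b n" unfolding b_eq E_def by (intro divide_right_mono) auto
      finally show ?thesis .
    next
      case False
      have gb: "\<bar>g x\<bar> \<le> 1" for x by (rule bounded_lipschitz_bound[OF g])
      have "\<bar>smooth K (h (n + 1)) g c - g c\<bar> \<le> 2"
        using smooth_bound[OF K bounded_lipschitz_measurable[OF g] gb, of "h (n + 1)" c] gb[of c] by linarith
      then have "\<bar>smooth K (h (n + 1)) g c - g c\<bar> / (real n + 1) \<le> 2 / (real n + 1)"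
        by (rule divide_right_mono) simp
      also have "\<dots> \<le> 2" by (simp add: divide_le_eq)
      also have "2 \<le> b n"
      proof -
        have "(real n + 1)\<^sup>2 \<le> (real n0 + 1)\<^sup>2" using False by (intro power_mono) auto
        then have "2 * (real n + 1)\<^sup>2 \<le> E" using D unfolding E_def by linarith
        then show ?thesis unfolding b_eq by (simp add: le_divide_eq)
      qed
      finally show ?thesis .
    qed
    interpret kernel_process_drift M X K h b
      by unfold_locales (fact b_summable drift)+
    show ?thesis by (rule process_asymptotically_exchangeable)
  qed
  ultimately show ?thesis unfolding \<xi>_def by blast
qed

end
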